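(* Let $H=\{H_\alpha\}_{\alpha\in\pi}$ be a Hopf $\pi$-coalgebra, let $(C,\sigma)$ be a left $\pi$-coisotropic quantum subgroup of $H$, and let $V=\{V_\alpha\}_{\alpha\in\pi}$ be a right $\pi$-comodule over $C$ by $\rho=\{\rho_{\alpha,\beta}:V_{\alpha\beta}\to V_\alpha\otimes C_\beta\}_{\alpha,\beta\in\pi}$. For $\alpha\in\pi$ put $$Ind(\rho)_\alpha=\{x\in V_1\otimes H_\alpha:\ (I_1\otimes L_{1,\alpha})x=(\rho_{1,1}\otimes I_\alpha)x\},\qquad L_{1,\alpha}=(\sigma_1\otimes I_\alpha)\Delta^H_{1,\alpha}.$$ Then $Ind(\rho)=\{Ind(\rho)_\alpha\}_{\alpha\in\pi}$ is a right $\pi$-comodule over $H$ by the family $\{(I\otimes\Delta)_{\alpha,\beta}=I_1\otimes\Delta^H_{\alpha,\beta}\}_{\alpha,\beta\in\pi}$ (restricted to $Ind(\rho)_{\alpha\beta}$, with values in $Ind(\rho)_\alpha\otimes H_\beta$).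
   Context: $K$ is a field; all spaces, maps and tensor products are over $K$; $\pi$ is a group with unit $1$; $I_\alpha$ denotes the identity map of the $\alpha$-component of the relevant family. A $\pi$-coalgebra is a family $C=\{C_\alpha\}_{\alpha\in\pi}$ of $K$-spaces with linear maps $\Delta_{\alpha,\beta}:C_{\alpha\beta}\to C_\alpha\otimes C_\beta$ and $\varepsilon:C_1\to K$ such that $(\Delta_{\alpha,\beta}\otimes I_\gamma)\Delta_{\alpha\beta,\gamma}=(I_\alpha\otimes\Delta_{\beta,\gamma})\Delta_{\alpha,\beta\gamma}$ and, up to the canonical identifications $K\otimes C_\alpha\cong C_\alpha\cong C_\alpha\otimes K$, $(\varepsilon\otimes I_\alpha)\Delta_{1,\alpha}=I_\alpha=(I_\alpha\otimes\varepsilon)\Delta_{\alpha,1}$. A Hopf $\pi$-coalgebra is a $\pi$-coalgebra $H=\{H_\alpha\}$ in which each $H_\alpha$ is an associative unital algebra (multiplication $\mu_\alpha$, unit $1_\alpha$), all $\Delta_{\alpha,\beta}$ and $\varepsilon$ are algebra maps, together with linear maps $S_\alpha:H_\alpha\to H_{\alpha^{-1}}$ such that $\mu_\alpha(S_{\alpha^{-1}}\otimes I_\alpha)\Delta_{\alpha^{-1},\alpha}=1_\alpha\varepsilon=\mu_\alpha(I_\alpha\otimes S_{\alpha^{-1}})\Delta_{\alpha,\alpha^{-1}}$. A left $\pi$-coisotropic quantum subgroup of $H$ is a pair $(C,\sigma)$ where $C$ is a $\pi$-coalgebra, each $C_\alpha$ is a left $H_\alpha$-module by $\omega_\alpha:H_\alpha\otimes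 C_\alpha\to C_\alpha$, and $\sigma=\{\sigma_\alpha:H_\alpha\to C_\alpha\}$ is a family of surjective linear maps such that each $\sigma_\alpha$ is a left $H_\alpha$-module map, $\Delta^C_{\alpha,\beta}\sigma_{\alpha\beta}=(\sigma_\alpha\otimes\sigma_\beta)\Delta^H_{\alpha,\beta}$, and $\varepsilon^C\sigma_1=\varepsilon^H$. A right $\pi$-comodule over a $\pi$-coalgebra $C$ is a family $M=\{M_\alpha\}$ of $K$-spaces with linear maps $\theta_{\alpha,\beta}:M_{\alpha\beta}\to M_\alpha\otimes C_\beta$ such that $(\theta_{\alpha,\beta}\otimes I_\gamma)\theta_{\alpha\beta,\gamma}=(I_\alpha\otimes\Delta_{\beta,\gamma})\theta_{\alpha,\beta\gamma}$ and $(I_\alpha\otimes\varepsilon)\theta_{\alpha,1}$ is the canonical map $M_\alpha\to M_\alpha\otimes K$. *)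

theory Defs
  imports "HOL-Algebra.Module" "HOL-Algebra.AbelCoset"
begin

text \<open>
  A vector space over \<open>K\<close> is a \<open>module K M\<close> with \<open>field K\<close>. Module records
  also carry a multiplication and a unit (fields \<open>mult\<close> and \<open>one\<close>); these are
  meaningful only where an algebra structure is demanded.
\<close>

definition linear_maps ::
    "('k, 'm) ring_scheme \<Rightarrow> ('k, 'a, 'x) module_scheme \<Rightarrow> ('k, 'b, 'y) module_scheme \<Rightarrow> ('a \<Rightarrow> 'b) set"
  where "linear_maps K M N =
    {f \<in> carrier M \<rightarrow> carrier N.
       (\<forall>x\<in>carrier M. \<forall>y\<in>carrier M. f (x \<oplus>\<^bsub>M\<^esub> y) = f x \<oplus>\<^bsub>N\<^esub> f y) \<and>
       (\<forall>k\<in>carrier K. \<forall>x\<in>carrier M. f (k \<odot>\<^bsub>M\<^esub> x) = k \<odot>\<^bsub>N\<^esub> f x)}"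

definition base_module :: "('k, 'm) ring_scheme \<Rightarrow> ('k, 'k) module"
  where "base_module K =
    \<lparr>carrier = carrier K, mult = mult K, one = \<one>\<^bsub>K\<^esub>,
     zero = \<zero>\<^bsub>K\<^esub>, add = add K, smult = mult K\<rparr>"


subsection \<open>Tensor products\<close>

definition free_module :: "('k, 'm) ring_scheme \<Rightarrow> 'a set \<Rightarrow> ('k, 'a \<Rightarrow> 'k) module"
  where "free_module K X =
    \<lparr>carrier = {f. (\<forall>p. f p \<in> carrier K) \<and> (\<forall>p. p \<notin> X \<longrightarrow> f p = \<zero>\<^bsub>K\<^esub>) \<and>
                   finite {p. f p \<noteq> \<zero>\<^bsub>K\<^esub>}},
     mult = (\<lambda>_ _. undefined), one = undefined,
     zero = (\<lambda>_. \<zero>\<^bsub>K\<^esub>),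
     add = (\<lambda>f g p. f p \<oplus>\<^bsub>K\<^esub> g p),
     smult = (\<lambda>k f p. k \<otimes>\<^bsub>K\<^esub> f p)\<rparr>"

definition free_basis :: "('k, 'm) ring_scheme \<Rightarrow> 'a \<Rightarrow> 'a \<Rightarrow> 'k"
  where "free_basis K p = (\<lambda>q. if q = p then \<one>\<^bsub>K\<^esub> else \<zero>\<^bsub>K\<^esub>)"

abbreviation tensor_free ::
    "('k, 'm) ring_scheme \<Rightarrow> ('k, 'a, 'x) module_scheme \<Rightarrow> ('k, 'b, 'y) module_scheme \<Rightarrow>
     ('k, 'a \<times> 'b \<Rightarrow> 'k) module"
  where "tensor_free K M N \<equiv> free_module K (carrier M \<times> carrier N)"

definition tensor_relators ::
    "('k, 'm) ring_scheme \<Rightarrow> ('k, 'a, 'x) module_scheme \<Rightarrow> ('k, 'b, 'y) module_scheme \<Rightarrow>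
     ('a \<times> 'b \<Rightarrow> 'k) set"
  where "tensor_relators K M N =
    (let F = tensor_free K M N; e = (\<lambda>a b. free_basis K (a, b)) in
       {e (a \<oplus>\<^bsub>M\<^esub> a') b \<ominus>\<^bsub>F\<^esub> (e a b \<oplus>\<^bsub>F\<^esub> e a' b) | a a' b.
          a \<in> carrier M \<and> a' \<in> carrier M \<and> b \<in> carrier N} \<union>
       {e a (b \<oplus>\<^bsub>N\<^esub> b') \<ominus>\<^bsub>F\<^esub> (e a b \<oplus>\<^bsub>F\<^esub> e a b') | a b b'.
          a \<in> carrier M \<and> b \<in> carrier N \<and> b' \<in> carrier N} \<union>
       {e (k \<odot>\<^bsub>M\<^esub> a) b \<ominus>\<^bsub>F\<^esub> (k \<odot>\<^bsub>F\<^esub> e a b) | k a b.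
          k \<in> carrier K \<and> a \<in> carrier M \<and> b \<in> carrier N} \<union>
       {e a (k \<odot>\<^bsub>N\<^esub> b) \<ominus>\<^bsub>F\<^esub> (k \<odot>\<^bsub>F\<^esub> e a b) | k a b.
          k \<in> carrier K \<and> a \<in> carrier M \<and> b \<in> carrier N})"

definition tensor_null ::
    "('k, 'm) ring_scheme \<Rightarrow> ('k, 'a, 'x) module_scheme \<Rightarrow> ('k, 'b, 'y) module_scheme \<Rightarrow>
     ('a \<times> 'b \<Rightarrow> 'k) set"
  where "tensor_null K M N =
    \<Inter>{R. submodule R K (tensor_free K M N) \<and> tensor_relators K M N \<subseteq> R}"

text \<open>
  The tensor product is the quotient of the free module on \<open>carrier M \<times> carrier N\<close>
  by the bilinearity relations; its elements are cosets.
\<close>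

definition tensor ::
    "('k, 'm) ring_scheme \<Rightarrow> ('k, 'a, 'x) module_scheme \<Rightarrow> ('k, 'b, 'y) module_scheme \<Rightarrow>
     ('k, ('a \<times> 'b \<Rightarrow> 'k) set) module"
  where "tensor K M N =
    (let F = tensor_free K M N; R = tensor_null K M N in
     \<lparr>carrier = a_rcosets\<^bsub>F\<^esub> R,
      mult = (\<lambda>_ _. undefined), one = undefined,
      zero = R,
      add = (\<lambda>X Y. X <+>\<^bsub>F\<^esub> Y),
      smult = (\<lambda>k X. \<Union>f\<in>X. R +>\<^bsub>F\<^esub> (k \<odot>\<^bsub>F\<^esub> f))\<rparr>)"

definition pure_tensor ::
    "('k, 'm) ring_scheme \<Rightarrow> ('k, 'a, 'x) module_scheme \<Rightarrow> ('k, 'b, 'y) module_scheme \<Rightarrow>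
     'a \<Rightarrow> 'b \<Rightarrow> ('a \<times> 'b \<Rightarrow> 'k) set"
  where "pure_tensor K M N a b = tensor_null K M N +>\<^bsub>tensor_free K M N\<^esub> free_basis K (a, b)"

text \<open>
  The linear map out of a tensor product into \<open>P\<close> induced by a bilinear map \<open>\<phi>\<close>:
  all representatives of a coset yield the same value, and this value is returned.
  The source modules need not be given.
\<close>

definition tensor_lift ::
    "('k, 'm) ring_scheme \<Rightarrow> ('k, 'c, 'x) module_scheme \<Rightarrow> ('a \<Rightarrow> 'b \<Rightarrow> 'c) \<Rightarrow>
     ('a \<times> 'b \<Rightarrow> 'k) set \<Rightarrow> 'c"
  where "tensor_lift K P \<phi> X =
    (THE y. \<forall>f\<in>X. y = (\<Oplus>\<^bsub>P\<^esub>p\<in>{p. f p \<noteq> \<zero>\<^bsub>K\<^esub>}. f p \<odot>\<^bsub>P\<^esub> \<phi> (fst p) (snd p)))"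

text \<open>\<open>tensor_map K M' N' f g\<close> is \<open>f \<otimes> g\<close>, where \<open>M'\<close> and \<open>N'\<close> are the targets of \<open>f\<close> and \<open>g\<close>.\<close>

definition tensor_map ::
    "('k, 'm) ring_scheme \<Rightarrow> ('k, 'c, 'x) module_scheme \<Rightarrow> ('k, 'd, 'y) module_scheme \<Rightarrow>
     ('a \<Rightarrow> 'c) \<Rightarrow> ('b \<Rightarrow> 'd) \<Rightarrow> ('a \<times> 'b \<Rightarrow> 'k) set \<Rightarrow> ('c \<times> 'd \<Rightarrow> 'k) set"
  where "tensor_map K M' N' f g =
    tensor_lift K (tensor K M' N') (\<lambda>a b. pure_tensor K M' N' (f a) (g b))"

text \<open>The canonical isomorphism from \<open>(M \<otimes> N) \<otimes> P\<close> to \<open>M \<otimes> (N \<otimes> P)\<close>.\<close>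

definition tensor_assoc ::
    "('k, 'm) ring_scheme \<Rightarrow> ('k, 'a, 'x) module_scheme \<Rightarrow> ('k, 'b, 'y) module_scheme \<Rightarrow>
     ('k, 'c, 'z) module_scheme \<Rightarrow>
     (('a \<times> 'b \<Rightarrow> 'k) set \<times> 'c \<Rightarrow> 'k) set \<Rightarrow> ('a \<times> ('b \<times> 'c \<Rightarrow> 'k) set \<Rightarrow> 'k) set"
  where "tensor_assoc K M N P =
    (let T = tensor K M (tensor K N P) in
     tensor_lift K T (\<lambda>X c. tensor_lift K T
       (\<lambda>a b. pure_tensor K M (tensor K N P) a (pure_tensor K N P b c)) X))"

text \<open>The canonical isomorphisms from \<open>K \<otimes> M\<close> and from \<open>M \<otimes> K\<close> to \<open>M\<close>.\<close>

definition tensor_unit_left ::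
    "('k, 'm) ring_scheme \<Rightarrow> ('k, 'a, 'x) module_scheme \<Rightarrow> ('k \<times> 'a \<Rightarrow> 'k) set \<Rightarrow> 'a"
  where "tensor_unit_left K M = tensor_lift K M (\<lambda>k a. k \<odot>\<^bsub>M\<^esub> a)"

definition tensor_unit_right ::
    "('k, 'm) ring_scheme \<Rightarrow> ('k, 'a, 'x) module_scheme \<Rightarrow> ('a \<times> 'k \<Rightarrow> 'k) set \<Rightarrow> 'a"
  where "tensor_unit_right K M = tensor_lift K M (\<lambda>a k. k \<odot>\<^bsub>M\<^esub> a)"

text \<open>
  The tensor product of two algebras, with the multiplication determined by
  \<open>(a \<otimes> b) (a' \<otimes> b') = a a' \<otimes> b b'\<close>.
\<close>

definition tensor_algebra ::
    "('k, 'm) ring_scheme \<Rightarrow> ('k, 'a, 'x) module_scheme \<Rightarrow> ('k, 'b, 'y) module_scheme \<Rightarrow>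
     ('k, ('a \<times> 'b \<Rightarrow> 'k) set) module"
  where "tensor_algebra K A B = (tensor K A B)
    \<lparr>mult := (\<lambda>X Y. tensor_lift K (tensor K A B)
        (\<lambda>a b. tensor_lift K (tensor K A B)
          (\<lambda>a' b'. pure_tensor K A B (a \<otimes>\<^bsub>A\<^esub> a') (b \<otimes>\<^bsub>B\<^esub> b')) Y) X),
     one := pure_tensor K A B \<one>\<^bsub>A\<^esub> \<one>\<^bsub>B\<^esub>\<rparr>"

definition algebra_mult ::
    "('k, 'm) ring_scheme \<Rightarrow> ('k, 'a, 'x) module_scheme \<Rightarrow> ('a \<times> 'a \<Rightarrow> 'k) set \<Rightarrow> 'a"
  where "algebra_mult K A = tensor_lift K A (\<lambda>a b. a \<otimes>\<^bsub>A\<^esub> b)"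

text \<open>The library's \<open>algebra\<close> is commutative, so associative unital algebras are introduced here.\<close>

locale assoc_algebra = module K A + ring A
  for K :: "('k, 'm) ring_scheme" and A :: "('k, 'a, 'x) module_scheme" (structure) +
  assumes smult_mult_left:
      "\<lbrakk>k \<in> carrier K; a \<in> carrier A; b \<in> carrier A\<rbrakk> \<Longrightarrow>
         (k \<odot>\<^bsub>A\<^esub> a) \<otimes>\<^bsub>A\<^esub> b = k \<odot>\<^bsub>A\<^esub> (a \<otimes>\<^bsub>A\<^esub> b)"
    and smult_mult_right:
      "\<lbrakk>k \<in> carrier K; a \<in> carrier A; b \<in> carrier A\<rbrakk> \<Longrightarrow>
         a \<otimes>\<^bsub>A\<^esub> (k \<odot>\<^bsub>A\<^esub> b) = k \<odot>\<^bsub>A\<^esub> (a \<otimes>\<^bsub>A\<^esub> b)"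

definition algebra_homs ::
    "('k, 'm) ring_scheme \<Rightarrow> ('k, 'a, 'x) module_scheme \<Rightarrow> ('k, 'b, 'y) module_scheme \<Rightarrow> ('a \<Rightarrow> 'b) set"
  where "algebra_homs K A B = linear_maps K A B \<inter> ring_hom A B"


subsection \<open>Coalgebras, comodules and Hopf coalgebras graded by a group\<close>

locale pi_coalgebra =
  fixes K :: "('k, 'm) ring_scheme"
    and \<pi> :: "('g, 'n) monoid_scheme"
    and C :: "'g \<Rightarrow> ('k, 'c) module"
    and \<Delta> :: "'g \<Rightarrow> 'g \<Rightarrow> 'c \<Rightarrow> ('c \<times> 'c \<Rightarrow> 'k) set"
    and \<epsilon> :: "'c \<Rightarrow> 'k"
  assumes field_K: "field K"
    and group_pi: "group \<pi>"
    and module_C: "\<alpha> \<in> carrier \<pi> \<Longrightarrow> module K (C \<alpha>)"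
    and comult_linear: "\<lbrakk>\<alpha> \<in> carrier \<pi>; \<beta> \<in> carrier \<pi>\<rbrakk> \<Longrightarrow>
      \<Delta> \<alpha> \<beta> \<in> linear_maps K (C (\<alpha> \<otimes>\<^bsub>\<pi>\<^esub> \<beta>)) (tensor K (C \<alpha>) (C \<beta>))"
    and counit_linear: "\<epsilon> \<in> linear_maps K (C \<one>\<^bsub>\<pi>\<^esub>) (base_module K)"
    and coassoc:
      "\<lbrakk>\<alpha> \<in> carrier \<pi>; \<beta> \<in> carrier \<pi>; \<gamma> \<in> carrier \<pi>;
        x \<in> carrier (C (\<alpha> \<otimes>\<^bsub>\<pi>\<^esub> \<beta> \<otimes>\<^bsub>\<pi>\<^esub> \<gamma>))\<rbrakk> \<Longrightarrow>
       tensor_assoc K (C \<alpha>) (C \<beta>) (C \<gamma>)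
         (tensor_map K (tensor K (C \<alpha>) (C \<beta>)) (C \<gamma>) (\<Delta> \<alpha> \<beta>) id (\<Delta> (\<alpha> \<otimes>\<^bsub>\<pi>\<^esub> \<beta>) \<gamma> x)) =
       tensor_map K (C \<alpha>) (tensor K (C \<beta>) (C \<gamma>)) id (\<Delta> \<beta> \<gamma>) (\<Delta> \<alpha> (\<beta> \<otimes>\<^bsub>\<pi>\<^esub> \<gamma>) x)"
    and counit_left: "\<lbrakk>\<alpha> \<in> carrier \<pi>; x \<in> carrier (C \<alpha>)\<rbrakk> \<Longrightarrow>
       tensor_unit_left K (C \<alpha>)
         (tensor_map K (base_module K) (C \<alpha>) \<epsilon> id (\<Delta> \<one>\<^bsub>\<pi>\<^esub> \<alpha> x)) = x"
    and counit_right: "\<lbrakk>\<alpha> \<in> carrier \<pi>; x \<in> carrier (C \<alpha>)\<rbrakk> \<Longrightarrow>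
       tensor_unit_right K (C \<alpha>)
         (tensor_map K (C \<alpha>) (base_module K) id \<epsilon> (\<Delta> \<alpha> \<one>\<^bsub>\<pi>\<^esub> x)) = x"

locale right_pi_comodule = pi_coalgebra K \<pi> C \<Delta> \<epsilon>
  for K :: "('k, 'm) ring_scheme"
    and \<pi> :: "('g, 'n) monoid_scheme"
    and C :: "'g \<Rightarrow> ('k, 'c) module"
    and \<Delta> :: "'g \<Rightarrow> 'g \<Rightarrow> 'c \<Rightarrow> ('c \<times> 'c \<Rightarrow> 'k) set"
    and \<epsilon> :: "'c \<Rightarrow> 'k" +
  fixes M :: "'g \<Rightarrow> ('k, 'v) module"
    and \<theta> :: "'g \<Rightarrow> 'g \<Rightarrow> 'v \<Rightarrow> ('v \<times> 'c \<Rightarrow> 'k) set"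
  assumes module_M: "\<alpha> \<in> carrier \<pi> \<Longrightarrow> module K (M \<alpha>)"
    and coaction_linear: "\<lbrakk>\<alpha> \<in> carrier \<pi>; \<beta> \<in> carrier \<pi>\<rbrakk> \<Longrightarrow>
      \<theta> \<alpha> \<beta> \<in> linear_maps K (M (\<alpha> \<otimes>\<^bsub>\<pi>\<^esub> \<beta>)) (tensor K (M \<alpha>) (C \<beta>))"
    and coaction_coassoc:
      "\<lbrakk>\<alpha> \<in> carrier \<pi>; \<beta> \<in> carrier \<pi>; \<gamma> \<in> carrier \<pi>;
        x \<in> carrier (M (\<alpha> \<otimes>\<^bsub>\<pi>\<^esub> \<beta> \<otimes>\<^bsub>\<pi>\<^esub> \<gamma>))\<rbrakk> \<Longrightarrow>
       tensor_assoc K (M \<alpha>) (C \<beta>) (C \<gamma>)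
         (tensor_map K (tensor K (M \<alpha>) (C \<beta>)) (C \<gamma>) (\<theta> \<alpha> \<beta>) id (\<theta> (\<alpha> \<otimes>\<^bsub>\<pi>\<^esub> \<beta>) \<gamma> x)) =
       tensor_map K (M \<alpha>) (tensor K (C \<beta>) (C \<gamma>)) id (\<Delta> \<beta> \<gamma>) (\<theta> \<alpha> (\<beta> \<otimes>\<^bsub>\<pi>\<^esub> \<gamma>) x)"
    and coaction_counit: "\<lbrakk>\<alpha> \<in> carrier \<pi>; x \<in> carrier (M \<alpha>)\<rbrakk> \<Longrightarrow>
       tensor_unit_right K (M \<alpha>)
         (tensor_map K (M \<alpha>) (base_module K) id \<epsilon> (\<theta> \<alpha> \<one>\<^bsub>\<pi>\<^esub> x)) = x"

locale hopf_pi_coalgebra = pi_coalgebra K \<pi> H \<Delta> \<epsilon>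
  for K :: "('k, 'm) ring_scheme"
    and \<pi> :: "('g, 'n) monoid_scheme"
    and H :: "'g \<Rightarrow> ('k, 'h) module"
    and \<Delta> :: "'g \<Rightarrow> 'g \<Rightarrow> 'h \<Rightarrow> ('h \<times> 'h \<Rightarrow> 'k) set"
    and \<epsilon> :: "'h \<Rightarrow> 'k" +
  fixes S :: "'g \<Rightarrow> 'h \<Rightarrow> 'h"
  assumes algebra_H: "\<alpha> \<in> carrier \<pi> \<Longrightarrow> assoc_algebra K (H \<alpha>)"
    and comult_algebra_hom: "\<lbrakk>\<alpha> \<in> carrier \<pi>; \<beta> \<in> carrier \<pi>\<rbrakk> \<Longrightarrow>
      \<Delta> \<alpha> \<beta> \<in> algebra_homs K (H (\<alpha> \<otimes>\<^bsub>\<pi>\<^esub> \<beta>)) (tensor_algebra K (H \<alpha>) (H \<beta>))"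
    and counit_algebra_hom: "\<epsilon> \<in> algebra_homs K (H \<one>\<^bsub>\<pi>\<^esub>) (base_module K)"
    and antipode_linear: "\<alpha> \<in> carrier \<pi> \<Longrightarrow>
      S \<alpha> \<in> linear_maps K (H \<alpha>) (H (inv\<^bsub>\<pi>\<^esub> \<alpha>))"
    and antipode_left: "\<lbrakk>\<alpha> \<in> carrier \<pi>; x \<in> carrier (H \<one>\<^bsub>\<pi>\<^esub>)\<rbrakk> \<Longrightarrow>
      algebra_mult K (H \<alpha>)
        (tensor_map K (H \<alpha>) (H \<alpha>) (S (inv\<^bsub>\<pi>\<^esub> \<alpha>)) id (\<Delta> (inv\<^bsub>\<pi>\<^esub> \<alpha>) \<alpha> x)) =
      \<epsilon> x \<odot>\<^bsub>H \<alpha>\<^esub> \<one>\<^bsub>H \<alpha>\<^esub>"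
    and antipode_right: "\<lbrakk>\<alpha> \<in> carrier \<pi>; x \<in> carrier (H \<one>\<^bsub>\<pi>\<^esub>)\<rbrakk> \<Longrightarrow>
      algebra_mult K (H \<alpha>)
        (tensor_map K (H \<alpha>) (H \<alpha>) id (S (inv\<^bsub>\<pi>\<^esub> \<alpha>)) (\<Delta> \<alpha> (inv\<^bsub>\<pi>\<^esub> \<alpha>) x)) =
      \<epsilon> x \<odot>\<^bsub>H \<alpha>\<^esub> \<one>\<^bsub>H \<alpha>\<^esub>"

definition left_algebra_module ::
    "('k, 'm) ring_scheme \<Rightarrow> ('k, 'a, 'x) module_scheme \<Rightarrow> ('k, 'c, 'y) module_scheme \<Rightarrow>
     (('a \<times> 'c \<Rightarrow> 'k) set \<Rightarrow> 'c) \<Rightarrow> bool"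
  where "left_algebra_module K A M \<omega> \<longleftrightarrow>
    module K M \<and>
    \<omega> \<in> linear_maps K (tensor K A M) M \<and>
    (\<forall>a\<in>carrier A. \<forall>b\<in>carrier A. \<forall>m\<in>carrier M.
       \<omega> (pure_tensor K A M (a \<otimes>\<^bsub>A\<^esub> b) m) =
       \<omega> (pure_tensor K A M a (\<omega> (pure_tensor K A M b m)))) \<and>
    (\<forall>m\<in>carrier M. \<omega> (pure_tensor K A M \<one>\<^bsub>A\<^esub> m) = m)"

locale left_coisotropic_subgroup =
  H: hopf_pi_coalgebra K \<pi> H \<Delta>H \<epsilon>H S + C: pi_coalgebra K \<pi> C \<Delta>C \<epsilon>C
  for K :: "('k, 'm) ring_scheme"
    and \<pi> :: "('g, 'n) monoid_scheme"
    and H :: "'g \<Rightarrow> ('k, 'h) module"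
    and \<Delta>H :: "'g \<Rightarrow> 'g \<Rightarrow> 'h \<Rightarrow> ('h \<times> 'h \<Rightarrow> 'k) set"
    and \<epsilon>H :: "'h \<Rightarrow> 'k"
    and S :: "'g \<Rightarrow> 'h \<Rightarrow> 'h"
    and C :: "'g \<Rightarrow> ('k, 'c) module"
    and \<Delta>C :: "'g \<Rightarrow> 'g \<Rightarrow> 'c \<Rightarrow> ('c \<times> 'c \<Rightarrow> 'k) set"
    and \<epsilon>C :: "'c \<Rightarrow> 'k" +
  fixes \<omega> :: "'g \<Rightarrow> ('h \<times> 'c \<Rightarrow> 'k) set \<Rightarrow> 'c"
    and \<sigma> :: "'g \<Rightarrow> 'h \<Rightarrow> 'c"
  assumes action: "\<alpha> \<in> carrier \<pi> \<Longrightarrow> left_algebra_module K (H \<alpha>) (C \<alpha>) (\<omega> \<alpha>)"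
    and sigma_linear: "\<alpha> \<in> carrier \<pi> \<Longrightarrow> \<sigma> \<alpha> \<in> linear_maps K (H \<alpha>) (C \<alpha>)"
    and sigma_surj: "\<alpha> \<in> carrier \<pi> \<Longrightarrow> \<sigma> \<alpha> ` carrier (H \<alpha>) = carrier (C \<alpha>)"
    and sigma_module_map:
      "\<lbrakk>\<alpha> \<in> carrier \<pi>; a \<in> carrier (H \<alpha>); b \<in> carrier (H \<alpha>)\<rbrakk> \<Longrightarrow>
       \<sigma> \<alpha> (a \<otimes>\<^bsub>H \<alpha>\<^esub> b) = \<omega> \<alpha> (pure_tensor K (H \<alpha>) (C \<alpha>) a (\<sigma> \<alpha> b))"
    and sigma_comult:
      "\<lbrakk>\<alpha> \<in> carrier \<pi>; \<beta> \<in> carrier \<pi>; x \<in> carrier (H (\<alpha> \<otimes>\<^bsub>\<pi>\<^esub> \<beta>))\<rbrakk> \<Longrightarrow>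
       \<Delta>C \<alpha> \<beta> (\<sigma> (\<alpha> \<otimes>\<^bsub>\<pi>\<^esub> \<beta>) x) =
       tensor_map K (C \<alpha>) (C \<beta>) (\<sigma> \<alpha>) (\<sigma> \<beta>) (\<Delta>H \<alpha> \<beta> x)"
    and sigma_counit: "x \<in> carrier (H \<one>\<^bsub>\<pi>\<^esub>) \<Longrightarrow> \<epsilon>C (\<sigma> \<one>\<^bsub>\<pi>\<^esub> x) = \<epsilon>H x"


subsection \<open>The induced comodule\<close>

text \<open>The map \<open>L\<close> at \<open>(1, \<alpha>)\<close>, from \<open>H \<alpha>\<close> to \<open>C 1 \<otimes> H \<alpha>\<close>.\<close>

definition ind_L ::
    "('k, 'm) ring_scheme \<Rightarrow> ('g, 'n) monoid_scheme \<Rightarrow> ('g \<Rightarrow> ('k, 'h) module) \<Rightarrow>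
     ('g \<Rightarrow> 'g \<Rightarrow> 'h \<Rightarrow> ('h \<times> 'h \<Rightarrow> 'k) set) \<Rightarrow> ('g \<Rightarrow> ('k, 'c) module) \<Rightarrow>
     ('g \<Rightarrow> 'h \<Rightarrow> 'c) \<Rightarrow> 'g \<Rightarrow> 'h \<Rightarrow> ('c \<times> 'h \<Rightarrow> 'k) set"
  where "ind_L K \<pi> H \<Delta>H C \<sigma> \<alpha> h =
    tensor_map K (C \<one>\<^bsub>\<pi>\<^esub>) (H \<alpha>) (\<sigma> \<one>\<^bsub>\<pi>\<^esub>) id (\<Delta>H \<one>\<^bsub>\<pi>\<^esub> \<alpha> h)"

definition Ind ::
    "('k, 'm) ring_scheme \<Rightarrow> ('g, 'n) monoid_scheme \<Rightarrow> ('g \<Rightarrow> ('k, 'h) module) \<Rightarrow>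
     ('g \<Rightarrow> 'g \<Rightarrow> 'h \<Rightarrow> ('h \<times> 'h \<Rightarrow> 'k) set) \<Rightarrow> ('g \<Rightarrow> ('k, 'c) module) \<Rightarrow>
     ('g \<Rightarrow> 'h \<Rightarrow> 'c) \<Rightarrow> ('g \<Rightarrow> ('k, 'v) module) \<Rightarrow>
     ('g \<Rightarrow> 'g \<Rightarrow> 'v \<Rightarrow> ('v \<times> 'c \<Rightarrow> 'k) set) \<Rightarrow> 'g \<Rightarrow> ('k, ('v \<times> 'h \<Rightarrow> 'k) set) module"
  where "Ind K \<pi> H \<Delta>H C \<sigma> V \<rho> \<alpha> =
    (let V1 = V \<one>\<^bsub>\<pi>\<^esub>; C1 = C \<one>\<^bsub>\<pi>\<^esub> in
     (tensor K V1 (H \<alpha>))\<lparr>carrier :=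
       {x \<in> carrier (tensor K V1 (H \<alpha>)).
          tensor_map K V1 (tensor K C1 (H \<alpha>)) id (ind_L K \<pi> H \<Delta>H C \<sigma> \<alpha>) x =
          tensor_assoc K V1 C1 (H \<alpha>)
            (tensor_map K (tensor K V1 C1) (H \<alpha>) (\<rho> \<one>\<^bsub>\<pi>\<^esub> \<one>\<^bsub>\<pi>\<^esub>) id x)}\<rparr>)"

text \<open>
  For a subspace \<open>W\<close> of \<open>M \<otimes> N\<close>, the canonical map from \<open>W \<otimes> P\<close> to \<open>M \<otimes> (N \<otimes> P)\<close>:
  the inclusion tensored with the identity, followed by the associativity
  isomorphism. An element of \<open>W \<otimes> P\<close> is a coset in the free module on
  \<open>carrier W \<times> carrier P\<close>, so this map is not an inclusion of sets.
\<close>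

definition subtensor_embed ::
    "('k, 'm) ring_scheme \<Rightarrow> ('k, 'a, 'x) module_scheme \<Rightarrow> ('k, 'b, 'y) module_scheme \<Rightarrow>
     ('k, 'c, 'z) module_scheme \<Rightarrow>
     (('a \<times> 'b \<Rightarrow> 'k) set \<times> 'c \<Rightarrow> 'k) set \<Rightarrow> ('a \<times> ('b \<times> 'c \<Rightarrow> 'k) set \<Rightarrow> 'k) set"
  where "subtensor_embed K M N P X =
    tensor_assoc K M N P (tensor_map K (tensor K M N) P id id X)"

end

theory Submission
  imports Defs
begin

text \<open>
  Regroup \<open>id \<otimes> \<Delta>\<close> to a map \<open>d : V\<^sub>1 \<otimes> H\<^bsub>\<alpha>\<beta>\<^esub> \<rightarrow> (V\<^sub>1 \<otimes> H\<^sub>\<alpha>) \<otimes> H\<^sub>\<beta>\<close>. It is natural in \<open>V\<^sub>1\<close>,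
  and it is coassociative and counital because \<open>\<Delta>\<close> is. Now \<open>Ind(\<rho>)\<^sub>\<alpha>\<close> is the equalizer of the two maps
  \<open>f\<^sub>\<alpha> = id \<otimes> L\<close> and \<open>g\<^sub>\<alpha> = \<rho> \<otimes> id\<close> on \<open>V\<^sub>1 \<otimes> H\<^sub>\<alpha>\<close>. Coassociativity (for \<open>f\<close>) and naturality
  (for \<open>g\<close>) give \<open>(f\<^sub>\<alpha> \<otimes> id) d = e f\<^bsub>\<alpha>\<beta>\<^esub>\<close> and \<open>(g\<^sub>\<alpha> \<otimes> id) d = e g\<^bsub>\<alpha>\<beta>\<^esub>\<close> with one and the
  same map \<open>e\<close>, so \<open>d\<close> sends \<open>Ind(\<rho>)\<^bsub>\<alpha>\<beta>\<^esub>\<close> into the equalizer of \<open>f\<^sub>\<alpha> \<otimes> id\<close> and \<open>g\<^sub>\<alpha> \<otimes> id\<close>.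
  Over a field this equalizer is \<open>Ind(\<rho>)\<^sub>\<alpha> \<otimes> H\<^sub>\<beta>\<close>: a linear map \<open>h\<close>
  has a linear \<open>s\<close> with \<open>h s h = h\<close>, and \<open>id - s h\<close> projects onto the kernel of \<open>h\<close>.
  The comodule axioms are then inherited through the injections \<open>Ind(\<rho>)\<^sub>\<alpha> \<otimes> N \<rightarrow> V\<^sub>1 \<otimes> H\<^sub>\<alpha> \<otimes> N\<close>.
\<close>


section \<open>Linear maps\<close>

lemma linear_mapsI:
  assumes "\<And>x. x \<in> carrier M \<Longrightarrow> f x \<in> carrier N"
    and "\<And>x y. x \<in> carrier M \<Longrightarrow> y \<in> carrier M \<Longrightarrow> f (x \<oplus>\<^bsub>M\<^esub> y) = f x \<oplus>\<^bsub>N\<^esub> f y"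
    and "\<And>k x. k \<in> carrier K \<Longrightarrow> x \<in> carrier M \<Longrightarrow> f (k \<odot>\<^bsub>M\<^esub> x) = k \<odot>\<^bsub>N\<^esub> f x"
  shows "f \<in> linear_maps K M N"
  using assms by (auto simp: linear_maps_def)

lemma linear_mapsD:
  assumes "f \<in> linear_maps K M N"
  shows linear_closed: "x \<in> carrier M \<Longrightarrow> f x \<in> carrier N"
    and linear_add: "x \<in> carrier M \<Longrightarrow> y \<in> carrier M \<Longrightarrow> f (x \<oplus>\<^bsub>M\<^esub> y) = f x \<oplus>\<^bsub>N\<^esub> f y"
    and linear_smult: "k \<in> carrier K \<Longrightarrow> x \<in> carrier M \<Longrightarrow> f (k \<odot>\<^bsub>M\<^esub> x) = k \<odot>\<^bsub>N\<^esub> f x"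
  using assms by (auto simp: linear_maps_def)

lemma module_cring: "module K M \<Longrightarrow> cring K"
  by (rule module.axioms)

lemma linear_zero:
  assumes "module K M" "module K N" "f \<in> linear_maps K M N"
  shows "f \<zero>\<^bsub>M\<^esub> = \<zero>\<^bsub>N\<^esub>"
proof -
  interpret M: module K M by fact
  interpret N: module K N by fact
  have "f \<zero>\<^bsub>M\<^esub> = f (\<zero>\<^bsub>K\<^esub> \<odot>\<^bsub>M\<^esub> \<zero>\<^bsub>M\<^esub>)" by simp
  also have "\<dots> = \<zero>\<^bsub>K\<^esub> \<odot>\<^bsub>N\<^esub> f \<zero>\<^bsub>M\<^esub>"
    by (rule linear_smult[OF assms(3)]) auto
  also have "\<dots> = \<zero>\<^bsub>N\<^esub>" using linear_closed[OF assms(3)] by simp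
  finally show ?thesis .
qed

text \<open>Writing negation as a scalar multiple reduces every statement about inverses to the
  compatibility with scalars that \<open>linear_maps\<close> already contains.\<close>

lemma module_minus_eq:
  assumes "module K M" "x \<in> carrier M"
  shows "\<ominus>\<^bsub>M\<^esub> x = (\<ominus>\<^bsub>K\<^esub> \<one>\<^bsub>K\<^esub>) \<odot>\<^bsub>M\<^esub> x"
proof -
  interpret M: module K M by fact
  show ?thesis using assms(2) by (simp add: M.smult_l_minus)
qed

lemma linear_a_inv:
  assumes "module K M" "module K N" "f \<in> linear_maps K M N" "x \<in> carrier M"
  shows "f (\<ominus>\<^bsub>M\<^esub> x) = \<ominus>\<^bsub>N\<^esub> f x"
proof -
  interpret M: module K M by fact
  show ?thesis
    using assms by (simp add: module_minus_eq[where K=K] linear_smult linear_closed)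
qed

lemma linear_minus:
  assumes "module K M" "module K N" "f \<in> linear_maps K M N" "x \<in> carrier M" "y \<in> carrier M"
  shows "f (x \<ominus>\<^bsub>M\<^esub> y) = f x \<ominus>\<^bsub>N\<^esub> f y"
proof -
  interpret M: module K M by fact
  show ?thesis using assms
    by (simp add: a_minus_def linear_add[OF assms(3)] linear_a_inv[OF assms(1-3)])
qed

text \<open>Closure under negation, which the introduction rule for submodules asks for, is closure
  under the scalar -1.\<close>

lemma submodule_of_smult_closed:
  assumes "module K M" "W \<subseteq> carrier M" "\<zero>\<^bsub>M\<^esub> \<in> W"
    and "\<And>x y. x \<in> W \<Longrightarrow> y \<in> W \<Longrightarrow> x \<oplus>\<^bsub>M\<^esub> y \<in> W"
    and "\<And>k x. k \<in> carrier K \<Longrightarrow> x \<in> W \<Longrightarrow> k \<odot>\<^bsub>M\<^esub> x \<in> W"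
  shows "submodule W K M"
proof -
  interpret M: module K M by fact
  show ?thesis
    using assms by (intro M.submoduleI) (auto simp: module_minus_eq[OF assms(1)] subset_iff)
qed

text \<open>Used for kernels (with \<open>g\<close> the zero map), for the agreement set of two maps
  in extensionality arguments, and for the carrier of \<open>Ind\<close> itself.\<close>

lemma submodule_equalizer:
  assumes "module K M" "module K N" "f \<in> linear_maps K M N" "g \<in> linear_maps K M N"
  shows "submodule {x \<in> carrier M. f x = g x} K M"
proof -
  interpret M: module K M by fact
  show ?thesis
    using assms
    by (intro submodule_of_smult_closed)
       (auto simp: linear_zero[OF assms(1,2)] linear_add[OF assms(3)] linear_add[OF assms(4)]
          linear_smult[OF assms(3)] linear_smult[OF assms(4)])
qed

lemma linear_comp:
  assumes "f \<in> linear_maps K M N" "g \<in> linear_maps K N P"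
  shows "(\<lambda>x. g (f x)) \<in> linear_maps K M P"
  using assms by (auto simp: linear_maps_def Pi_iff)

lemma linear_id: "id \<in> linear_maps K M M"
  by (auto simp: linear_maps_def)

lemma linear_sum:
  assumes "module K N" "f \<in> linear_maps K M N" "g \<in> linear_maps K M N"
  shows "(\<lambda>x. f x \<oplus>\<^bsub>N\<^esub> g x) \<in> linear_maps K M N"
proof -
  interpret N: module K N by fact
  show ?thesis
    using linear_mapsD[OF assms(2)] linear_mapsD[OF assms(3)]
    by (intro linear_mapsI) (auto simp: N.add.m_ac N.smult_r_distr)
qed

lemma linear_scale:
  assumes "module K N" "f \<in> linear_maps K M N" "k \<in> carrier K"
  shows "(\<lambda>x. k \<odot>\<^bsub>N\<^esub> f x) \<in> linear_maps K M N"
proof -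
  interpret N: module K N by fact
  show ?thesis
    using linear_mapsD[OF assms(2)] assms(3)
    by (intro linear_mapsI) (auto simp: N.smult_r_distr N.smult_assoc1[symmetric] N.R.m_comm)
qed

lemma linear_cong:
  assumes "module K M" "f \<in> linear_maps K M N" "\<And>x. x \<in> carrier M \<Longrightarrow> g x = f x"
  shows "g \<in> linear_maps K M N"
proof -
  interpret M: module K M by fact
  show ?thesis using linear_mapsD[OF assms(2)] by (intro linear_mapsI) (simp_all add: assms(3))
qed

lemma linear_diff:
  assumes M: "module K M" and N: "module K N"
    and fg: "f \<in> linear_maps K M N" "g \<in> linear_maps K M N"
  shows "(\<lambda>x. f x \<ominus>\<^bsub>N\<^esub> g x) \<in> linear_maps K M N"
proof (rule linear_cong[OF M])
  interpret N: module K N by fact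
  show "(\<lambda>x. f x \<oplus>\<^bsub>N\<^esub> (\<ominus>\<^bsub>K\<^esub> \<one>\<^bsub>K\<^esub>) \<odot>\<^bsub>N\<^esub> g x) \<in> linear_maps K M N"
    using assms by (intro linear_sum linear_scale) auto
  show "f x \<ominus>\<^bsub>N\<^esub> g x = f x \<oplus>\<^bsub>N\<^esub> (\<ominus>\<^bsub>K\<^esub> \<one>\<^bsub>K\<^esub>) \<odot>\<^bsub>N\<^esub> g x" if "x \<in> carrier M" for x
    using linear_closed[OF fg(2) that] by (simp add: a_minus_def module_minus_eq[OF N])
qed


section \<open>Free modules\<close>

lemma free_module_simps:
  "\<zero>\<^bsub>free_module K X\<^esub> = (\<lambda>_. \<zero>\<^bsub>K\<^esub>)"
  "f \<oplus>\<^bsub>free_module K X\<^esub> g = (\<lambda>p. f p \<oplus>\<^bsub>K\<^esub> g p)"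
  "k \<odot>\<^bsub>free_module K X\<^esub> f = (\<lambda>p. k \<otimes>\<^bsub>K\<^esub> f p)"
  by (simp_all add: free_module_def)

lemma free_module_carrier:
  "f \<in> carrier (free_module K X) \<longleftrightarrow>
    (\<forall>p. f p \<in> carrier K) \<and> (\<forall>p. p \<notin> X \<longrightarrow> f p = \<zero>\<^bsub>K\<^esub>) \<and> finite {p. f p \<noteq> \<zero>\<^bsub>K\<^esub>}"
  by (simp add: free_module_def)

context
  notes free_module_simps [simp]
begin

lemma module_free_module:
  assumes "cring K"
  shows "module K (free_module K X)"
proof -
  interpret K: cring K by fact
  let ?F = "free_module K X"
  have add: "(\<lambda>p. f p \<oplus>\<^bsub>K\<^esub> g p) \<in> carrier ?F" if "f \<in> carrier ?F" "g \<in> carrier ?F" for f g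
  proof -
    have "finite ({p. f p \<noteq> \<zero>\<^bsub>K\<^esub>} \<union> {p. g p \<noteq> \<zero>\<^bsub>K\<^esub>})"
      using that by (auto simp: free_module_carrier)
    then have "finite {p. f p \<oplus>\<^bsub>K\<^esub> g p \<noteq> \<zero>\<^bsub>K\<^esub>}"
      by (rule rev_finite_subset) auto
    then show ?thesis using that by (auto simp: free_module_carrier)
  qed
  have smult: "(\<lambda>p. k \<otimes>\<^bsub>K\<^esub> f p) \<in> carrier ?F" if "f \<in> carrier ?F" "k \<in> carrier K" for f k
  proof -
    have "finite {p. f p \<noteq> \<zero>\<^bsub>K\<^esub>}"
      using that by (auto simp: free_module_carrier)
    then have "finite {p. k \<otimes>\<^bsub>K\<^esub> f p \<noteq> \<zero>\<^bsub>K\<^esub>}"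
      by (rule rev_finite_subset) (use that in auto)
    then show ?thesis using that by (auto simp: free_module_carrier)
  qed
  have "abelian_group ?F"
  proof (rule abelian_groupI)
    fix f assume f: "f \<in> carrier ?F"
    have "(\<lambda>p. \<ominus>\<^bsub>K\<^esub> \<one>\<^bsub>K\<^esub> \<otimes>\<^bsub>K\<^esub> f p) \<in> carrier ?F" using f by (intro smult) auto
    moreover have "\<ominus>\<^bsub>K\<^esub> \<one>\<^bsub>K\<^esub> \<otimes>\<^bsub>K\<^esub> f p \<oplus>\<^bsub>K\<^esub> f p = \<zero>\<^bsub>K\<^esub>" for p
      using f by (simp add: free_module_carrier K.l_minus K.l_neg)
    ultimately show "\<exists>g\<in>carrier ?F. g \<oplus>\<^bsub>?F\<^esub> f = \<zero>\<^bsub>?F\<^esub>" by (auto intro!: bexI)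
  qed (auto intro!: add ext, auto simp: free_module_carrier K.a_ac)
  then show ?thesis
    by (intro moduleI assms)
       (auto intro!: smult ext, auto simp: free_module_carrier K.l_distr K.r_distr K.m_assoc)
qed

lemma free_basis_carrier:
  assumes "cring K" "p \<in> X"
  shows "free_basis K p \<in> carrier (free_module K X)"
proof -
  interpret K: cring K by fact
  have "finite {q. (if q = p then \<one>\<^bsub>K\<^esub> else \<zero>\<^bsub>K\<^esub>) \<noteq> \<zero>\<^bsub>K\<^esub>}"
    by (rule finite_subset[of _ "{p}"]) auto
  then show ?thesis using assms(2) by (auto simp: free_module_carrier free_basis_def)
qed

text \<open>Induction on the size of the support: deleting the coefficient at one point
  \<open>p\<close> of the support leaves a smaller function \<open>?g\<close>, and \<open>f\<close>
  is \<open>?g\<close> plus \<open>f p\<close> times the basis element at \<open>p\<close>.\<close>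

lemma free_module_spanned:
  assumes "cring K" and W: "submodule W K (free_module K X)"
    and basis: "\<And>p. p \<in> X \<Longrightarrow> free_basis K p \<in> W"
  shows "carrier (free_module K X) \<subseteq> W"
proof
  interpret K: cring K by fact
  interpret F: module K "free_module K X" by (rule module_free_module) fact
  note W' = F.submoduleE[OF W]
  have zero: "(\<lambda>_. \<zero>\<^bsub>K\<^esub>) \<in> W"
    using subgroup.one_closed[OF submodule.axioms(1)[OF W]] by simp
  fix f assume "f \<in> carrier (free_module K X)"
  then show "f \<in> W"
  proof (induction "card {p. f p \<noteq> \<zero>\<^bsub>K\<^esub>}" arbitrary: f)
    case 0
    then have "f = (\<lambda>_. \<zero>\<^bsub>K\<^esub>)" by (auto simp: free_module_carrier)
    then show ?case using zero by simp
  next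
    case (Suc n)
    then obtain p where p: "f p \<noteq> \<zero>\<^bsub>K\<^esub>" by (metis (mono_tags) card.empty empty_Collect_eq nat.distinct(1))
    let ?g = "f(p := \<zero>\<^bsub>K\<^esub>)"
    have eq: "{q. ?g q \<noteq> \<zero>\<^bsub>K\<^esub>} = {q. f q \<noteq> \<zero>\<^bsub>K\<^esub>} - {p}" by auto
    have "?g \<in> carrier (free_module K X)"
      using Suc.prems eq by (auto simp: free_module_carrier)
    moreover have "n = card {q. ?g q \<noteq> \<zero>\<^bsub>K\<^esub>}"
      unfolding eq using p Suc by (simp add: free_module_carrier)
    ultimately have "?g \<in> W" using Suc.hyps(1) by blast
    moreover have "f p \<odot>\<^bsub>free_module K X\<^esub> free_basis K p \<in> W"
      using p Suc.prems by (intro W'(4) basis) (auto simp: free_module_carrier)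
    ultimately have "?g \<oplus>\<^bsub>free_module K X\<^esub> f p \<odot>\<^bsub>free_module K X\<^esub> free_basis K p \<in> W"
      by (rule W'(5))
    moreover have "?g \<oplus>\<^bsub>free_module K X\<^esub> f p \<odot>\<^bsub>free_module K X\<^esub> free_basis K p = f"
      using Suc.prems by (auto simp: free_module_carrier free_basis_def)
    ultimately show ?case by simp
  qed
qed

text \<open>The sum that \<open>tensor_lift\<close> evaluates on a representative, isolated as the
  linear extension of \<psi> from the basis to the free module. Its properties can then be proved
  before any coset is taken.\<close>

definition free_lift where
  "free_lift K P \<psi> f = (\<Oplus>\<^bsub>P\<^esub>p\<in>{p. f p \<noteq> \<zero>\<^bsub>K\<^esub>}. f p \<odot>\<^bsub>P\<^esub> \<psi> p)"

text \<open>Two functions have different supports, so their sums must be brought to a common finite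
  index set before they can be compared; the added terms have coefficient zero.\<close>

lemma free_lift_superset:
  assumes P: "module K P" and \<psi>: "\<And>p. p \<in> X \<Longrightarrow> \<psi> p \<in> carrier P"
    and f: "f \<in> carrier (free_module K X)"
    and A: "finite A" "A \<subseteq> X" "{p. f p \<noteq> \<zero>\<^bsub>K\<^esub>} \<subseteq> A"
  shows "free_lift K P \<psi> f = (\<Oplus>\<^bsub>P\<^esub>p\<in>A. f p \<odot>\<^bsub>P\<^esub> \<psi> p)"
proof -
  interpret P: module K P by fact
  show ?thesis unfolding free_lift_def
    using A f by (intro P.add.finprod_mono_neutral_cong_left) (auto simp: \<psi> free_module_carrier subset_iff)
qed

lemma free_lift_linear:
  assumes P: "module K P" and \<psi>: "\<And>p. p \<in> X \<Longrightarrow> \<psi> p \<in> carrier P"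
  shows "free_lift K P \<psi> \<in> linear_maps K (free_module K X) P"
proof -
  interpret P: module K P by fact
  interpret F: module K "free_module K X" by (rule module_free_module) (rule P.R.is_cring)
  note sup = free_lift_superset[where \<psi>=\<psi> and X=X, OF P]
  show ?thesis
  proof (rule linear_mapsI)
    fix f assume f: "f \<in> carrier (free_module K X)"
    then have supp: "finite {p. f p \<noteq> \<zero>\<^bsub>K\<^esub>}" "{p. f p \<noteq> \<zero>\<^bsub>K\<^esub>} \<subseteq> X"
      by (auto simp: free_module_carrier)
    then show "free_lift K P \<psi> f \<in> carrier P"
      unfolding free_lift_def using f by (intro P.finsum_closed) (auto simp: \<psi> free_module_carrier)
    {
      fix g assume g: "g \<in> carrier (free_module K X)"
      \<comment> \<open>The common index set also contains the support of the sum of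
        \<open>f\<close> and \<open>g\<close>, which may be smaller through cancellation.\<close>
      define A where "A = {p. f p \<noteq> \<zero>\<^bsub>K\<^esub>} \<union> {p. g p \<noteq> \<zero>\<^bsub>K\<^esub>}"
      have A: "finite A" "A \<subseteq> X" "{p. f p \<noteq> \<zero>\<^bsub>K\<^esub>} \<subseteq> A" "{p. g p \<noteq> \<zero>\<^bsub>K\<^esub>} \<subseteq> A"
        using f g by (auto simp: free_module_carrier A_def)
      have fg: "(\<lambda>p. f p \<oplus>\<^bsub>K\<^esub> g p) \<in> carrier (free_module K X)"
        using F.add.m_closed[OF f g] by simp
      have fc: "f p \<in> carrier K" and gc: "g p \<in> carrier K" for p
        using f g by (simp_all add: free_module_carrier)
      have \<psi>A: "\<psi> p \<in> carrier P" if "p \<in> A" for p using \<psi> A(2) that by blast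
      have fgA: "{p. f p \<oplus>\<^bsub>K\<^esub> g p \<noteq> \<zero>\<^bsub>K\<^esub>} \<subseteq> A" by (auto simp: A_def)
      have "free_lift K P \<psi> (\<lambda>p. f p \<oplus>\<^bsub>K\<^esub> g p) = (\<Oplus>\<^bsub>P\<^esub>p\<in>A. (f p \<oplus>\<^bsub>K\<^esub> g p) \<odot>\<^bsub>P\<^esub> \<psi> p)"
        by (rule sup[OF \<psi> fg A(1,2) fgA])
      also have "\<dots> = (\<Oplus>\<^bsub>P\<^esub>p\<in>A. f p \<odot>\<^bsub>P\<^esub> \<psi> p \<oplus>\<^bsub>P\<^esub> g p \<odot>\<^bsub>P\<^esub> \<psi> p)"
        by (intro P.finsum_cong') (simp_all add: fc gc \<psi>A P.smult_l_distr)
      also have "\<dots> = (\<Oplus>\<^bsub>P\<^esub>p\<in>A. f p \<odot>\<^bsub>P\<^esub> \<psi> p) \<oplus>\<^bsub>P\<^esub> (\<Oplus>\<^bsub>P\<^esub>p\<in>A. g p \<odot>\<^bsub>P\<^esub> \<psi> p)"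
        by (intro P.finsum_addf) (simp_all add: fc gc \<psi>A)
      also have "(\<Oplus>\<^bsub>P\<^esub>p\<in>A. f p \<odot>\<^bsub>P\<^esub> \<psi> p) = free_lift K P \<psi> f"
        by (rule sup[symmetric, OF \<psi> f A(1,2,3)])
      also have "(\<Oplus>\<^bsub>P\<^esub>p\<in>A. g p \<odot>\<^bsub>P\<^esub> \<psi> p) = free_lift K P \<psi> g"
        by (rule sup[symmetric, OF \<psi> g A(1,2,4)])
      finally show "free_lift K P \<psi> (f \<oplus>\<^bsub>free_module K X\<^esub> g) = free_lift K P \<psi> f \<oplus>\<^bsub>P\<^esub> free_lift K P \<psi> g"
        by simp
    }
    have fc: "f p \<in> carrier K" for p
      using f by (simp add: free_module_carrier)
    have \<psi>f: "\<psi> p \<in> carrier P" if "f p \<noteq> \<zero>\<^bsub>K\<^esub>" for p using \<psi> supp(2) that by blast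
    fix k assume k: "k \<in> carrier K"
    have kf: "(\<lambda>p. k \<otimes>\<^bsub>K\<^esub> f p) \<in> carrier (free_module K X)"
      using F.smult_closed[OF k f] by simp
    \<comment> \<open>Scaling can shrink the support, so the sum is taken over the support of
      \<open>f\<close> instead.\<close>
    have "free_lift K P \<psi> (\<lambda>p. k \<otimes>\<^bsub>K\<^esub> f p) = (\<Oplus>\<^bsub>P\<^esub>p\<in>{p. f p \<noteq> \<zero>\<^bsub>K\<^esub>}. (k \<otimes>\<^bsub>K\<^esub> f p) \<odot>\<^bsub>P\<^esub> \<psi> p)"
      by (rule sup[OF \<psi> kf supp]) (use k in auto)
    also have "\<dots> = (\<Oplus>\<^bsub>P\<^esub>p\<in>{p. f p \<noteq> \<zero>\<^bsub>K\<^esub>}. k \<odot>\<^bsub>P\<^esub> (f p \<odot>\<^bsub>P\<^esub> \<psi> p))"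
      by (intro P.finsum_cong') (simp_all add: k fc \<psi>f P.smult_assoc1)
    also have "\<dots> = k \<odot>\<^bsub>P\<^esub> free_lift K P \<psi> f"
      unfolding free_lift_def
      by (intro P.finsum_smult_ldistr[symmetric]) (simp_all add: k fc \<psi>f supp)
    finally show "free_lift K P \<psi> (k \<odot>\<^bsub>free_module K X\<^esub> f) = k \<odot>\<^bsub>P\<^esub> free_lift K P \<psi> f"
      by simp
  qed
qed

lemma free_lift_basis:
  assumes P: "module K P" and \<psi>: "\<And>p. p \<in> X \<Longrightarrow> \<psi> p \<in> carrier P" and p: "p \<in> X"
  shows "free_lift K P \<psi> (free_basis K p) = \<psi> p"
proof -
  interpret P: module K P by fact
  \<comment> \<open>The index set is \<open>{p}\<close> and not the support: only a commutative ring
    is available here, and if 1 = 0 in it then the support is empty.\<close>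
  have "free_lift K P \<psi> (free_basis K p) = (\<Oplus>\<^bsub>P\<^esub>q\<in>{p}. free_basis K p q \<odot>\<^bsub>P\<^esub> \<psi> q)"
    using p by (intro free_lift_superset[where X=X] P \<psi> free_basis_carrier P.R.is_cring) (auto simp: free_basis_def)
  also have "\<dots> = \<psi> p"
    using \<psi>[OF p] by (simp add: P.finsum_insert[of "{}"] free_basis_def)
  finally show ?thesis .
qed


end


section \<open>Tensor products\<close>

lemma tensor_relators_carrier:
  assumes "module K M" "module K N"
  shows "tensor_relators K M N \<subseteq> carrier (tensor_free K M N)"
proof -
  interpret M: module K M by fact
  interpret N: module K N by fact
  interpret F: module K "tensor_free K M N" by (rule module_free_module) (rule M.R.is_cring)
  have e: "free_basis K (a, b) \<in> carrier (tensor_free K M N)"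
    if "a \<in> carrier M" "b \<in> carrier N" for a b
    by (rule free_basis_carrier) (use that M.R.is_cring in auto)
  show ?thesis
    unfolding tensor_relators_def Let_def
    by (auto
        intro!: e F.minus_closed F.add.m_closed F.smult_closed)
qed

lemma submodule_tensor_null:
  assumes "module K M" "module K N"
  shows "submodule (tensor_null K M N) K (tensor_free K M N)"
proof -
  interpret M: module K M by fact
  interpret F: module K "tensor_free K M N" by (rule module_free_module) (rule M.R.is_cring)
  let ?\<R> = "{R. submodule R K (tensor_free K M N) \<and> tensor_relators K M N \<subseteq> R}"
  \<comment> \<open>The family that is intersected is nonempty; without this the intersection would
    not lie in the carrier.\<close>
  have top: "carrier (tensor_free K M N) \<in> ?\<R>"
    using F.carrier_is_submodule tensor_relators_carrier[OF assms] by simp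
  show ?thesis
    unfolding tensor_null_def
  proof (rule F.submoduleI)
    show "\<Inter>?\<R> \<subseteq> carrier (tensor_free K M N)" using top by blast
    show "\<zero>\<^bsub>tensor_free K M N\<^esub> \<in> \<Inter>?\<R>"
      using subgroup.one_closed[OF submodule.axioms(1)] by fastforce
    show "\<ominus>\<^bsub>tensor_free K M N\<^esub> f \<in> \<Inter>?\<R>" if "f \<in> \<Inter>?\<R>" for f
      using that F.submoduleE(3) by blast
    show "f \<oplus>\<^bsub>tensor_free K M N\<^esub> g \<in> \<Inter>?\<R>" if "f \<in> \<Inter>?\<R>" "g \<in> \<Inter>?\<R>" for f g
    proof
      fix R assume R: "R \<in> ?\<R>"
      then show "f \<oplus>\<^bsub>tensor_free K M N\<^esub> g \<in> R"
        using that by (intro F.submoduleE(5)[of R]) auto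
    qed
    show "k \<odot>\<^bsub>tensor_free K M N\<^esub> f \<in> \<Inter>?\<R>" if "k \<in> carrier K" "f \<in> \<Inter>?\<R>" for k f
    proof
      fix R assume R: "R \<in> ?\<R>"
      then show "k \<odot>\<^bsub>tensor_free K M N\<^esub> f \<in> R"
        using that by (intro F.submoduleE(4)[of R]) auto
    qed
  qed
qed

lemma tensor_relators_null: "tensor_relators K M N \<subseteq> tensor_null K M N"
  by (auto simp: tensor_null_def)

section \<open>The tensor product as a quotient module\<close>

locale module_pair = M: module K M + N: module K N
  for K :: "('k, 'm) ring_scheme"
    and M :: "('k, 'a, 'x) module_scheme" and N :: "('k, 'b, 'y) module_scheme"
begin

abbreviation "FF \<equiv> tensor_free K M N"
abbreviation "RR \<equiv> tensor_null K M N"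

sublocale F: module K FF by (rule module_free_module) (rule M.R.is_cring)

lemma null_submodule: "submodule RR K FF"
  by (rule submodule_tensor_null) unfold_locales

sublocale R: abelian_subgroup RR FF
  by (intro abelian_subgroupI3 additive_subgroup.intro submodule.axioms(1)[OF null_submodule]
      F.abelian_group_axioms)

lemma tensor_carrier_eq: "carrier (tensor K M N) = (\<lambda>f. RR +>\<^bsub>FF\<^esub> f) ` carrier FF"
  by (auto simp: tensor_def Let_def A_RCOSETS_def')

lemma coset_eq:
  assumes "f \<in> carrier FF" "g \<in> carrier FF"
  shows "RR +>\<^bsub>FF\<^esub> f = RR +>\<^bsub>FF\<^esub> g \<longleftrightarrow> f \<ominus>\<^bsub>FF\<^esub> g \<in> RR"
  using assms R.a_rcos_module R.a_repr_independence' R.a_rcos_self by (metis a_minus_def)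

lemma coset_add:
  assumes "f \<in> carrier FF" "g \<in> carrier FF"
  shows "(RR +>\<^bsub>FF\<^esub> f) \<oplus>\<^bsub>tensor K M N\<^esub> (RR +>\<^bsub>FF\<^esub> g) = RR +>\<^bsub>FF\<^esub> (f \<oplus>\<^bsub>FF\<^esub> g)"
  using R.a_rcos_sum[OF assms] by (simp add: tensor_def Let_def)

text \<open>The scalar multiple of a coset is defined as a union over all its representatives. Two
  representatives differ by an element of the submodule \<open>RR\<close>, and so do their
  multiples, hence all members of the union are the same coset.\<close>

lemma coset_smult:
  assumes "k \<in> carrier K" "f \<in> carrier FF"
  shows "k \<odot>\<^bsub>tensor K M N\<^esub> (RR +>\<^bsub>FF\<^esub> f) = RR +>\<^bsub>FF\<^esub> (k \<odot>\<^bsub>FF\<^esub> f)"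
proof -
  have "RR +>\<^bsub>FF\<^esub> (k \<odot>\<^bsub>FF\<^esub> g) = RR +>\<^bsub>FF\<^esub> (k \<odot>\<^bsub>FF\<^esub> f)" if g: "g \<in> RR +>\<^bsub>FF\<^esub> f" for g
  proof -
    have gc: "g \<in> carrier FF" using R.a_elemrcos_carrier assms(2) g by blast
    have "g \<ominus>\<^bsub>FF\<^esub> f \<in> RR"
      using coset_eq[OF gc assms(2)] F.a_repr_independence[OF g assms(2)] R.a_subgroup by simp
    then have "k \<odot>\<^bsub>FF\<^esub> (g \<ominus>\<^bsub>FF\<^esub> f) \<in> RR"
      using F.submoduleE(4)[OF null_submodule] assms(1) by blast
    moreover have "k \<odot>\<^bsub>FF\<^esub> (g \<ominus>\<^bsub>FF\<^esub> f) = k \<odot>\<^bsub>FF\<^esub> g \<ominus>\<^bsub>FF\<^esub> k \<odot>\<^bsub>FF\<^esub> f"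
      using gc assms by (simp add: a_minus_def F.smult_r_distr F.smult_r_minus)
    ultimately show ?thesis using gc assms by (simp add: coset_eq)
  qed
  \<comment> \<open>The union is over a nonempty index set, so it equals the common value of its
    members.\<close>
  moreover have "f \<in> RR +>\<^bsub>FF\<^esub> f" using assms(2) by (rule R.a_rcos_self)
  ultimately have "(\<Union>g\<in>RR +>\<^bsub>FF\<^esub> f. RR +>\<^bsub>FF\<^esub> (k \<odot>\<^bsub>FF\<^esub> g)) = RR +>\<^bsub>FF\<^esub> (k \<odot>\<^bsub>FF\<^esub> f)"
    by blast
  then show ?thesis by (simp add: tensor_def Let_def)
qed

lemma coset_zero: "\<zero>\<^bsub>tensor K M N\<^esub> = RR +>\<^bsub>FF\<^esub> \<zero>\<^bsub>FF\<^esub>"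
  using F.a_coset_add_zero[OF R.a_subset] by (simp add: tensor_def Let_def)

lemma tensor_is_module: "module K (tensor K M N)"
proof (intro moduleI abelian_groupI M.R.is_cring)
  fix X assume "X \<in> carrier (tensor K M N)"
  then obtain f where f: "f \<in> carrier FF" "X = RR +>\<^bsub>FF\<^esub> f" by (auto simp: tensor_carrier_eq)
  have "(RR +>\<^bsub>FF\<^esub> (\<ominus>\<^bsub>FF\<^esub> f)) \<oplus>\<^bsub>tensor K M N\<^esub> X = \<zero>\<^bsub>tensor K M N\<^esub>"
    using f by (simp add: coset_add coset_zero F.l_neg)
  then show "\<exists>Y\<in>carrier (tensor K M N). Y \<oplus>\<^bsub>tensor K M N\<^esub> X = \<zero>\<^bsub>tensor K M N\<^esub>"
    using f by (auto simp: tensor_carrier_eq)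
qed (auto simp: tensor_carrier_eq coset_add coset_smult coset_zero F.a_ac F.smult_l_distr F.smult_r_distr
      F.smult_assoc1)

lemma coset_linear: "(\<lambda>f. RR +>\<^bsub>FF\<^esub> f) \<in> linear_maps K FF (tensor K M N)"
  by (rule linear_mapsI) (auto simp: tensor_carrier_eq coset_add coset_smult)

end

lemma module_tensor: "module K M \<Longrightarrow> module K N \<Longrightarrow> module K (tensor K M N)"
  by (simp add: module_pair.tensor_is_module module_pair.intro)

section \<open>Bilinear maps and the universal property\<close>

definition bilinear_maps where
  "bilinear_maps K M N P = {\<phi>. (\<forall>a\<in>carrier M. \<phi> a \<in> linear_maps K N P) \<and>
    (\<forall>b\<in>carrier N. (\<lambda>a. \<phi> a b) \<in> linear_maps K M P)}"

context module_pair
begin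

lemma basis_carrier:
  assumes "a \<in> carrier M" "b \<in> carrier N"
  shows "free_basis K (a, b) \<in> carrier FF"
  by (rule free_basis_carrier) (use assms M.R.is_cring in auto)

text \<open>Each bilinearity law of \<open>pure_tensor\<close> is the vanishing of one relator
  modulo \<open>RR\<close>; this is the passage from the relator to the equality of cosets.\<close>

lemma pure_tensor_eqI:
  assumes "f \<ominus>\<^bsub>FF\<^esub> g \<in> tensor_relators K M N" "f \<in> carrier FF" "g \<in> carrier FF"
  shows "RR +>\<^bsub>FF\<^esub> f = RR +>\<^bsub>FF\<^esub> g"
  using assms tensor_relators_null[of K M N] by (auto simp: coset_eq)

lemma pure_bilinear: "pure_tensor K M N \<in> bilinear_maps K M N (tensor K M N)"
proof -
  let ?e = "\<lambda>a b. free_basis K (a, b)"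
  have "pure_tensor K M N a (b \<oplus>\<^bsub>N\<^esub> b') = pure_tensor K M N a b \<oplus>\<^bsub>tensor K M N\<^esub> pure_tensor K M N a b'"
    if "a \<in> carrier M" "b \<in> carrier N" "b' \<in> carrier N" for a b b'
  proof -
    have "?e a (b \<oplus>\<^bsub>N\<^esub> b') \<ominus>\<^bsub>FF\<^esub> (?e a b \<oplus>\<^bsub>FF\<^esub> ?e a b') \<in> tensor_relators K M N"
      unfolding tensor_relators_def Let_def using that by blast
    from pure_tensor_eqI[OF this] show ?thesis
      using that by (simp add: pure_tensor_def coset_add basis_carrier F.add.m_closed)
  qed
  moreover have "pure_tensor K M N (a \<oplus>\<^bsub>M\<^esub> a') b = pure_tensor K M N a b \<oplus>\<^bsub>tensor K M N\<^esub> pure_tensor K M N a' b"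
    if "a \<in> carrier M" "a' \<in> carrier M" "b \<in> carrier N" for a a' b
  proof -
    have "?e (a \<oplus>\<^bsub>M\<^esub> a') b \<ominus>\<^bsub>FF\<^esub> (?e a b \<oplus>\<^bsub>FF\<^esub> ?e a' b) \<in> tensor_relators K M N"
      unfolding tensor_relators_def Let_def using that by blast
    from pure_tensor_eqI[OF this] show ?thesis
      using that by (simp add: pure_tensor_def coset_add basis_carrier F.add.m_closed)
  qed
  moreover have "pure_tensor K M N (k \<odot>\<^bsub>M\<^esub> a) b = k \<odot>\<^bsub>tensor K M N\<^esub> pure_tensor K M N a b"
    if "k \<in> carrier K" "a \<in> carrier M" "b \<in> carrier N" for k a b
  proof -
    have "?e (k \<odot>\<^bsub>M\<^esub> a) b \<ominus>\<^bsub>FF\<^esub> (k \<odot>\<^bsub>FF\<^esub> ?e a b) \<in> tensor_relators K M N"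
      unfolding tensor_relators_def Let_def using that by blast
    from pure_tensor_eqI[OF this] show ?thesis
      using that by (simp add: pure_tensor_def coset_smult basis_carrier F.smult_closed)
  qed
  moreover have "pure_tensor K M N a (k \<odot>\<^bsub>N\<^esub> b) = k \<odot>\<^bsub>tensor K M N\<^esub> pure_tensor K M N a b"
    if "k \<in> carrier K" "a \<in> carrier M" "b \<in> carrier N" for k a b
  proof -
    have "?e a (k \<odot>\<^bsub>N\<^esub> b) \<ominus>\<^bsub>FF\<^esub> (k \<odot>\<^bsub>FF\<^esub> ?e a b) \<in> tensor_relators K M N"
      unfolding tensor_relators_def Let_def using that by blast
    from pure_tensor_eqI[OF this] show ?thesis
      using that by (simp add: pure_tensor_def coset_smult basis_carrier F.smult_closed)
  qed
  moreover have "pure_tensor K M N a b \<in> carrier (tensor K M N)"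
    if "a \<in> carrier M" "b \<in> carrier N" for a b
    using that by (simp add: pure_tensor_def tensor_carrier_eq basis_carrier)
  ultimately show ?thesis
    unfolding bilinear_maps_def by (auto intro!: linear_mapsI)
qed

text \<open>The representatives on whose cosets \<open>f\<close> and \<open>g\<close> agree form a
  submodule of the free module. It contains the basis, whose cosets are the pure tensors, so it is
  everything.\<close>

lemma ext_on_pure:
  assumes P: "module K P"
    and fg: "f \<in> linear_maps K (tensor K M N) P" "g \<in> linear_maps K (tensor K M N) P"
    and eq: "\<And>a b. a \<in> carrier M \<Longrightarrow> b \<in> carrier N \<Longrightarrow>
      f (pure_tensor K M N a b) = g (pure_tensor K M N a b)"
    and x: "x \<in> carrier (tensor K M N)"
  shows "f x = g x"
proof -
  let ?W = "{y \<in> carrier FF. f (RR +>\<^bsub>FF\<^esub> y) = g (RR +>\<^bsub>FF\<^esub> y)}"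
  have "submodule ?W K FF"
    by (rule submodule_equalizer[OF F.module_axioms P])
       (rule linear_comp[OF coset_linear fg(1)], rule linear_comp[OF coset_linear fg(2)])
  then have "carrier FF \<subseteq> ?W"
    using eq by (intro free_module_spanned M.R.is_cring) (auto simp: pure_tensor_def basis_carrier)
  then show ?thesis using x by (auto simp: tensor_carrier_eq)
qed

text \<open>The kernel of the linear extension \<open>?l\<close> is a submodule that contains the
  relators by bilinearity, hence it contains the least such submodule \<open>RR\<close>. So
  \<open>?l\<close> is constant on each coset and the definite description in
  \<open>tensor_lift\<close> denotes its value.\<close>

lemma lift_linear_pure:
  assumes P: "module K P" and \<phi>: "\<phi> \<in> bilinear_maps K M N P"
  shows tensor_lift_linear: "tensor_lift K P \<phi> \<in> linear_maps K (tensor K M N) P"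
    and tensor_lift_pure: "a \<in> carrier M \<Longrightarrow> b \<in> carrier N \<Longrightarrow>
      tensor_lift K P \<phi> (pure_tensor K M N a b) = \<phi> a b"
proof -
  interpret P: module K P by fact
  let ?l = "free_lift K P (\<lambda>p. \<phi> (fst p) (snd p))"
  have \<phi>r: "\<phi> a \<in> linear_maps K N P" if "a \<in> carrier M" for a
    using \<phi> that by (simp add: bilinear_maps_def)
  have \<phi>l: "(\<lambda>a. \<phi> a b) \<in> linear_maps K M P" if "b \<in> carrier N" for b
    using \<phi> that by (simp add: bilinear_maps_def)
  have \<phi>c: "\<phi> (fst p) (snd p) \<in> carrier P" if "p \<in> carrier M \<times> carrier N" for p
    using that linear_closed[OF \<phi>r] by auto
  have lin: "?l \<in> linear_maps K FF P"
    by (rule free_lift_linear[OF P \<phi>c])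
  have bas: "?l (free_basis K (a, b)) = \<phi> a b" if "a \<in> carrier M" "b \<in> carrier N" for a b
    using free_lift_basis[where X="carrier M \<times> carrier N" and \<psi>="\<lambda>p. \<phi> (fst p) (snd p)", OF P \<phi>c, of "(a,b)"] that
    by simp
  note lin' = linear_minus[OF F.module_axioms P lin] linear_add[OF lin] linear_smult[OF lin] bas basis_carrier
  let ?W = "{f \<in> carrier FF. ?l f = \<zero>\<^bsub>P\<^esub>}"
  have "(\<lambda>_. \<zero>\<^bsub>P\<^esub>) \<in> linear_maps K FF P" by (rule linear_mapsI) auto
  then have W: "submodule ?W K FF"
    by (rule submodule_equalizer[OF F.module_axioms P lin])
  have cancel: "x \<ominus>\<^bsub>P\<^esub> x = \<zero>\<^bsub>P\<^esub>" if "x \<in> carrier P" for x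
    using that by (simp add: a_minus_def P.r_neg)
  \<comment> \<open>Bilinearity of \<phi> turns the value of \<open>?l\<close> on each relator into
    a difference of equal terms.\<close>
  have "tensor_relators K M N \<subseteq> ?W"
    unfolding tensor_relators_def Let_def
    by (auto simp: lin' linear_add[OF \<phi>r] linear_smult[OF \<phi>r] linear_add[OF \<phi>l]
        linear_smult[OF \<phi>l] linear_closed[OF \<phi>r] cancel)
  then have null: "?l f = \<zero>\<^bsub>P\<^esub>" if "f \<in> RR" for f
    using W that unfolding tensor_null_def by blast
  have lift: "tensor_lift K P \<phi> (RR +>\<^bsub>FF\<^esub> f) = ?l f" if f: "f \<in> carrier FF" for f
  proof -
    have const: "?l g = ?l f" if g: "g \<in> RR +>\<^bsub>FF\<^esub> f" for g
    proof -
      obtain r where r: "r \<in> RR" "g = r \<oplus>\<^bsub>FF\<^esub> f" using g by (auto simp: a_r_coset_def')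
      then show ?thesis
        using f null[OF r(1)] linear_closed[OF lin f] R.a_Hcarr[OF r(1)] 
        by (simp add: linear_add[OF lin])
    qed
    \<comment> \<open>A representative inside the coset is needed for uniqueness, since the
      description quantifies over the members of the coset.\<close>
    have self: "f \<in> RR +>\<^bsub>FF\<^esub> f" using f by (rule R.a_rcos_self)
    show ?thesis
      unfolding tensor_lift_def free_lift_def[symmetric]
    proof (intro the_equality ballI)
      show "?l f = ?l g" if "g \<in> RR +>\<^bsub>FF\<^esub> f" for g
        using const[OF that] by (rule sym)
      show "y = ?l f" if "\<forall>g\<in>RR +>\<^bsub>FF\<^esub> f. y = ?l g" for y
        using bspec[OF that self] .
    qed
  qed
  show "tensor_lift K P \<phi> \<in> linear_maps K (tensor K M N) P"
    using linear_mapsD[OF lin] by (intro linear_mapsI)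
     (auto simp: tensor_carrier_eq lift coset_add coset_smult)
  show "tensor_lift K P \<phi> (pure_tensor K M N a b) = \<phi> a b" if "a \<in> carrier M" "b \<in> carrier N"
    using that by (simp add: pure_tensor_def lift basis_carrier bas)
qed

end

lemma module_pairI: "module K M \<Longrightarrow> module K N \<Longrightarrow> module_pair K M N"
  by (rule module_pair.intro)

lemma bilinear_mapsI:
  assumes "\<And>a. a \<in> carrier M \<Longrightarrow> \<phi> a \<in> linear_maps K N P"
    and "\<And>b. b \<in> carrier N \<Longrightarrow> (\<lambda>a. \<phi> a b) \<in> linear_maps K M P"
  shows "\<phi> \<in> bilinear_maps K M N P"
  using assms by (simp add: bilinear_maps_def)

lemma bilinear_mapsD:
  assumes "\<phi> \<in> bilinear_maps K M N P"
  shows bilinear_right: "a \<in> carrier M \<Longrightarrow> \<phi> a \<in> linear_maps K N P"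
    and bilinear_left: "b \<in> carrier N \<Longrightarrow> (\<lambda>a. \<phi> a b) \<in> linear_maps K M P"
  using assms by (simp_all add: bilinear_maps_def)

lemma pure_right_linear:
  "module K M \<Longrightarrow> module K N \<Longrightarrow> a \<in> carrier M \<Longrightarrow>
    pure_tensor K M N a \<in> linear_maps K N (tensor K M N)"
  by (rule bilinear_right[OF module_pair.pure_bilinear[OF module_pairI]])

lemma pure_left_linear:
  "module K M \<Longrightarrow> module K N \<Longrightarrow> b \<in> carrier N \<Longrightarrow>
    (\<lambda>a. pure_tensor K M N a b) \<in> linear_maps K M (tensor K M N)"
  by (rule bilinear_left[OF module_pair.pure_bilinear[OF module_pairI]])

lemma pure_closed:
  "module K M \<Longrightarrow> module K N \<Longrightarrow> a \<in> carrier M \<Longrightarrow> b \<in> carrier N \<Longrightarrow>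
    pure_tensor K M N a b \<in> carrier (tensor K M N)"
  by (rule linear_closed[OF pure_right_linear])

lemmas lift_linear = module_pair.tensor_lift_linear[OF module_pairI]
lemmas lift_pure = module_pair.tensor_lift_pure[OF module_pairI]

lemmas tensor_ext = module_pair.ext_on_pure[OF module_pairI]

section \<open>Functoriality of the tensor product\<close>

lemma tensor_map_bilinear:
  assumes "module K M" "module K N" "module K M'" "module K N'"
    and "f \<in> linear_maps K M M'" "g \<in> linear_maps K N N'"
  shows "(\<lambda>a b. pure_tensor K M' N' (f a) (g b)) \<in> bilinear_maps K M N (tensor K M' N')"
proof (rule bilinear_mapsI)
  show "(\<lambda>b. pure_tensor K M' N' (f a) (g b)) \<in> linear_maps K N (tensor K M' N')" if "a \<in> carrier M" for a
    by (rule linear_comp[OF assms(6) pure_right_linear[OF assms(3,4) linear_closed[OF assms(5) that]]])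
  show "(\<lambda>a. pure_tensor K M' N' (f a) (g b)) \<in> linear_maps K M (tensor K M' N')" if "b \<in> carrier N" for b
    by (rule linear_comp[OF assms(5) pure_left_linear[OF assms(3,4) linear_closed[OF assms(6) that]]])
qed

lemma tensor_map_linear:
  assumes "module K M" "module K N" "module K M'" "module K N'"
    and "f \<in> linear_maps K M M'" "g \<in> linear_maps K N N'"
  shows "tensor_map K M' N' f g \<in> linear_maps K (tensor K M N) (tensor K M' N')"
  unfolding tensor_map_def
  by (rule lift_linear[OF assms(1,2) module_tensor[OF assms(3,4)] tensor_map_bilinear[OF assms]])

lemma tensor_map_pure:
  assumes "module K M" "module K N" "module K M'" "module K N'"
    and "f \<in> linear_maps K M M'" "g \<in> linear_maps K N N'" "a \<in> carrier M" "b \<in> carrier N"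
  shows "tensor_map K M' N' f g (pure_tensor K M N a b) = pure_tensor K M' N' (f a) (g b)"
  unfolding tensor_map_def
  by (rule lift_pure[OF assms(1,2) module_tensor[OF assms(3,4)] tensor_map_bilinear[OF assms(1-6)] assms(7,8)])

lemmas tensor_map_closed = linear_closed[OF tensor_map_linear]

text \<open>Membership in \<open>linear_maps\<close> says nothing about values outside the carrier,
  so the factors of a tensor map may be rewritten as soon as they agree on the carriers. Most later
  calculations alternate this with \<open>tensor_map_comp\<close>.\<close>

lemma tensor_map_cong:
  assumes "module K M" "module K N" "module K M'" "module K N'"
    and "f \<in> linear_maps K M M'" "g \<in> linear_maps K N N'"
    and "\<And>a. a \<in> carrier M \<Longrightarrow> f a = f' a" "\<And>b. b \<in> carrier N \<Longrightarrow> g b = g' b"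
    and "x \<in> carrier (tensor K M N)"
  shows "tensor_map K M' N' f g x = tensor_map K M' N' f' g' x"
proof -
  have f': "f' \<in> linear_maps K M M'" and g': "g' \<in> linear_maps K N N'"
    by (rule linear_cong[OF assms(1,5)] linear_cong[OF assms(2,6)], simp add: assms(7,8))+
  show ?thesis
    by (rule tensor_ext[OF assms(1,2) module_tensor[OF assms(3,4)] tensor_map_linear tensor_map_linear])
       (simp_all add: assms f' g' tensor_map_pure[OF assms(1-4)])
qed

lemma tensor_map_comp:
  assumes "module K M" "module K N" "module K M'" "module K N'" "module K M''" "module K N''"
    and "f \<in> linear_maps K M M'" "g \<in> linear_maps K N N'"
    and "f' \<in> linear_maps K M' M''" "g' \<in> linear_maps K N' N''"
    and "x \<in> carrier (tensor K M N)"
  shows "tensor_map K M'' N'' f' g' (tensor_map K M' N' f g x) =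
    tensor_map K M'' N'' (\<lambda>a. f' (f a)) (\<lambda>b. g' (g b)) x"
proof -
  note lin = linear_comp[OF assms(7,9)] linear_comp[OF assms(8,10)]
  show ?thesis
    by (rule tensor_ext[OF assms(1,2) module_tensor[OF assms(5,6)]
          linear_comp[OF tensor_map_linear[OF assms(1-4,7,8)] tensor_map_linear[OF assms(3-6,9,10)]]
          tensor_map_linear[OF assms(1,2,5,6) lin] _ assms(11)])
       (simp add: tensor_map_pure[OF assms(1-4,7,8)] tensor_map_pure[OF assms(3-6,9,10)]
          tensor_map_pure[OF assms(1,2,5,6) lin] linear_closed[OF assms(7)] linear_closed[OF assms(8)])
qed

lemma tensor_map_id:
  assumes "module K M" "module K N" "x \<in> carrier (tensor K M N)"
  shows "tensor_map K M N id id x = x"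
proof -
  have "tensor_map K M N id id x = id x"
    by (rule tensor_ext[OF assms(1,2) module_tensor[OF assms(1,2)] tensor_map_linear linear_id])
       (simp_all add: assms linear_id tensor_map_pure[of K M N])
  then show ?thesis by simp
qed

text \<open>Here \<open>y\<close> is fixed and the map varies with its parameter \<open>a\<close>.
  Each law compares two linear maps in \<open>y\<close>, so it can be tested on pure tensors, where
  it is linearity of \<phi> in its first argument. This supplies one half of the bilinearity behind
  \<open>tensor_assoc_inv\<close>.\<close>

lemma tensor_map_family_linear:
  assumes M: "module K M" and N: "module K N" and T: "module K T" and P: "module K P"
    and \<phi>: "\<phi> \<in> bilinear_maps K M N T" and y: "y \<in> carrier (tensor K N P)"
  shows "(\<lambda>a. tensor_map K T P (\<phi> a) id y) \<in> linear_maps K M (tensor K T P)"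
proof -
  interpret M: module K M by fact
  note TP = module_tensor[OF T P]
  interpret TP: module K "tensor K T P" by fact
  have lin: "tensor_map K T P (\<phi> a) id \<in> linear_maps K (tensor K N P) (tensor K T P)"
    if "a \<in> carrier M" for a
    using tensor_map_linear[OF N P T P bilinear_right[OF \<phi> that] linear_id] .
  have pure: "tensor_map K T P (\<phi> a) id (pure_tensor K N P n p) = pure_tensor K T P (\<phi> a n) p"
    if "a \<in> carrier M" "n \<in> carrier N" "p \<in> carrier P" for a n p
    using tensor_map_pure[OF N P T P bilinear_right[OF \<phi> that(1)] linear_id that(2,3)] by simp
  have pl: "(\<lambda>a. pure_tensor K T P (\<phi> a n) p) \<in> linear_maps K M (tensor K T P)"
    if "n \<in> carrier N" "p \<in> carrier P" for n p
    using linear_comp[OF bilinear_left[OF \<phi> that(1)] pure_left_linear[OF T P that(2)]] .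
  show ?thesis
  proof (rule linear_mapsI)
    fix a assume a: "a \<in> carrier M"
    then show "tensor_map K T P (\<phi> a) id y \<in> carrier (tensor K T P)"
      using linear_closed[OF lin[OF a] y] by simp
    show "tensor_map K T P (\<phi> (a \<oplus>\<^bsub>M\<^esub> b)) id y =
        tensor_map K T P (\<phi> a) id y \<oplus>\<^bsub>tensor K T P\<^esub> tensor_map K T P (\<phi> b) id y"
      if b: "b \<in> carrier M" for b
      by (rule tensor_ext[OF N P TP lin linear_sum[OF TP lin lin]])
         (use a b y pure linear_add[OF pl] in simp_all)
    show "tensor_map K T P (\<phi> (k \<odot>\<^bsub>M\<^esub> a)) id y = k \<odot>\<^bsub>tensor K T P\<^esub> tensor_map K T P (\<phi> a) id y"
      if k: "k \<in> carrier K" for k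
      by (rule tensor_ext[OF N P TP lin linear_scale[OF TP lin]])
         (use a k y pure linear_smult[OF pl] in simp_all)
  qed
qed

section \<open>The associator, its inverse and their naturality\<close>

lemma tensor_ext_left:
  assumes M: "module K M" and N: "module K N" and P: "module K P" and Q: "module K Q"
    and f: "f \<in> linear_maps K (tensor K (tensor K M N) P) Q"
    and g: "g \<in> linear_maps K (tensor K (tensor K M N) P) Q"
    and eq: "\<And>a b c. a \<in> carrier M \<Longrightarrow> b \<in> carrier N \<Longrightarrow> c \<in> carrier P \<Longrightarrow>
      f (pure_tensor K (tensor K M N) P (pure_tensor K M N a b) c) =
      g (pure_tensor K (tensor K M N) P (pure_tensor K M N a b) c)"
    and x: "x \<in> carrier (tensor K (tensor K M N) P)"
  shows "f x = g x"
proof (rule tensor_ext[OF module_tensor[OF M N] P Q f g _ x])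
  fix X c assume X: "X \<in> carrier (tensor K M N)" and c: "c \<in> carrier P"
  note pl = pure_left_linear[OF module_tensor[OF M N] P c]
  show "f (pure_tensor K (tensor K M N) P X c) = g (pure_tensor K (tensor K M N) P X c)"
    by (rule tensor_ext[OF M N Q linear_comp[OF pl f] linear_comp[OF pl g] eq[OF _ _ c] X])
qed

lemma tensor_ext_right:
  assumes M: "module K M" and N: "module K N" and P: "module K P" and Q: "module K Q"
    and f: "f \<in> linear_maps K (tensor K M (tensor K N P)) Q"
    and g: "g \<in> linear_maps K (tensor K M (tensor K N P)) Q"
    and eq: "\<And>a b c. a \<in> carrier M \<Longrightarrow> b \<in> carrier N \<Longrightarrow> c \<in> carrier P \<Longrightarrow>
      f (pure_tensor K M (tensor K N P) a (pure_tensor K N P b c)) =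
      g (pure_tensor K M (tensor K N P) a (pure_tensor K N P b c))"
    and x: "x \<in> carrier (tensor K M (tensor K N P))"
  shows "f x = g x"
proof (rule tensor_ext[OF M module_tensor[OF N P] Q f g _ x])
  fix a Y assume a: "a \<in> carrier M" and Y: "Y \<in> carrier (tensor K N P)"
  note pr = pure_right_linear[OF M module_tensor[OF N P] a]
  show "f (pure_tensor K M (tensor K N P) a Y) = g (pure_tensor K M (tensor K N P) a Y)"
    by (rule tensor_ext[OF N P Q linear_comp[OF pr f] linear_comp[OF pr g] eq[OF a] Y])
qed

text \<open>\<open>tensor_assoc\<close> is a lift of lifts, so the inner lift must be shown to
  depend linearly on the outer variable \<open>c\<close>. For fixed \<open>X\<close> this is tested
  on pure tensors by comparing linear maps in \<open>X\<close>.\<close>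

lemma tensor_assoc_bilinear:
  fixes K :: "('k, 'm) ring_scheme" and M :: "('k, 'a, 'x) module_scheme"
    and N :: "('k, 'b, 'y) module_scheme" and P :: "('k, 'c, 'z) module_scheme"
  assumes M: "module K M" and N: "module K N" and P: "module K P"
  defines "T \<equiv> tensor K M (tensor K N P)"
  defines "\<phi> \<equiv> (\<lambda>c. tensor_lift K T (\<lambda>a b. pure_tensor K M (tensor K N P) a (pure_tensor K N P b c)))"
  shows "(\<lambda>X c. \<phi> c X) \<in> bilinear_maps K (tensor K M N) P T"
    and "a \<in> carrier M \<Longrightarrow> b \<in> carrier N \<Longrightarrow> c \<in> carrier P \<Longrightarrow>
      \<phi> c (pure_tensor K M N a b) = pure_tensor K M (tensor K N P) a (pure_tensor K N P b c)"
proof -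
  note NP = module_tensor[OF N P] and MN = module_tensor[OF M N]
  have T: "module K T" unfolding T_def by (rule module_tensor[OF M NP])
  have bil: "(\<lambda>a b. pure_tensor K M (tensor K N P) a (pure_tensor K N P b c)) \<in> bilinear_maps K M N T"
    if c: "c \<in> carrier P" for c
    unfolding T_def
  proof (rule bilinear_mapsI)
    show "(\<lambda>b. pure_tensor K M (tensor K N P) a (pure_tensor K N P b c))
        \<in> linear_maps K N (tensor K M (tensor K N P))" if "a \<in> carrier M" for a
      by (rule linear_comp[OF pure_left_linear[OF N P c] pure_right_linear[OF M NP that]])
    show "(\<lambda>a. pure_tensor K M (tensor K N P) a (pure_tensor K N P b c))
        \<in> linear_maps K M (tensor K M (tensor K N P))" if "b \<in> carrier N" for b
      by (rule pure_left_linear[OF M NP pure_closed[OF N P that c]])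
  qed
  have lin: "\<phi> c \<in> linear_maps K (tensor K M N) T" if "c \<in> carrier P" for c
    unfolding \<phi>_def by (rule lift_linear[OF M N T bil[OF that]])
  have pure: "\<phi> c (pure_tensor K M N a b) = pure_tensor K M (tensor K N P) a (pure_tensor K N P b c)"
    if "a \<in> carrier M" "b \<in> carrier N" "c \<in> carrier P" for a b c
    unfolding \<phi>_def by (rule lift_pure[OF M N T bil[OF that(3)] that(1,2)])
  then show "a \<in> carrier M \<Longrightarrow> b \<in> carrier N \<Longrightarrow> c \<in> carrier P \<Longrightarrow>
      \<phi> c (pure_tensor K M N a b) = pure_tensor K M (tensor K N P) a (pure_tensor K N P b c)" .
  interpret P: module K P by fact
  interpret T: module K T by fact
  have pr: "(\<lambda>c. pure_tensor K M (tensor K N P) a (pure_tensor K N P b c)) \<in> linear_maps K P T"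
    if "a \<in> carrier M" "b \<in> carrier N" for a b
    unfolding T_def
    by (rule linear_comp[OF pure_right_linear[OF N P that(2)] pure_right_linear[OF M NP that(1)]])
  show "(\<lambda>X c. \<phi> c X) \<in> bilinear_maps K (tensor K M N) P T"
  proof (intro bilinear_mapsI linear_mapsI)
    fix X assume X: "X \<in> carrier (tensor K M N)"
    fix c assume c: "c \<in> carrier P"
    show "\<phi> c X \<in> carrier T" using linear_closed[OF lin[OF c] X] .
    show "\<phi> (c \<oplus>\<^bsub>P\<^esub> d) X = \<phi> c X \<oplus>\<^bsub>T\<^esub> \<phi> d X" if d: "d \<in> carrier P" for d
      by (rule tensor_ext[OF M N T lin linear_sum[OF T lin lin]])
         (use c d X pure linear_add[OF pr] in simp_all)
    show "\<phi> (k \<odot>\<^bsub>P\<^esub> c) X = k \<odot>\<^bsub>T\<^esub> \<phi> c X" if k: "k \<in> carrier K" for k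
      by (rule tensor_ext[OF M N T lin linear_scale[OF T lin]])
         (use c k X pure linear_smult[OF pr] in simp_all)
  qed (use linear_mapsD[OF lin] in simp_all)
qed

lemma
  assumes M: "module K M" and N: "module K N" and P: "module K P"
  shows tensor_assoc_linear:
      "tensor_assoc K M N P \<in> linear_maps K (tensor K (tensor K M N) P) (tensor K M (tensor K N P))"
    and tensor_assoc_pure:
      "a \<in> carrier M \<Longrightarrow> b \<in> carrier N \<Longrightarrow> c \<in> carrier P \<Longrightarrow>
        tensor_assoc K M N P (pure_tensor K (tensor K M N) P (pure_tensor K M N a b) c) =
        pure_tensor K M (tensor K N P) a (pure_tensor K N P b c)"
proof -
  note NP = module_tensor[OF N P] and MN = module_tensor[OF M N]
  note bil = tensor_assoc_bilinear[OF assms]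
  show "tensor_assoc K M N P \<in> linear_maps K (tensor K (tensor K M N) P) (tensor K M (tensor K N P))"
    unfolding tensor_assoc_def Let_def
    by (rule lift_linear[OF MN P module_tensor[OF M NP] bil(1)])
  show "tensor_assoc K M N P (pure_tensor K (tensor K M N) P (pure_tensor K M N a b) c) =
        pure_tensor K M (tensor K N P) a (pure_tensor K N P b c)"
    if "a \<in> carrier M" "b \<in> carrier N" "c \<in> carrier P"
    unfolding tensor_assoc_def Let_def
    using lift_pure[OF MN P module_tensor[OF M NP] bil(1) pure_closed[OF M N that(1,2)] that(3)]
      bil(2)[OF that] by simp
qed

text \<open>Lifting only the first factor gives a formula on a pure tensor of \<open>a\<close> with
  an arbitrary \<open>y\<close>, not merely a pure one. That is what allows evaluation at
  comultiplied elements later.\<close>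

definition tensor_assoc_inv where
  "tensor_assoc_inv K M N P = tensor_lift K (tensor K (tensor K M N) P)
    (\<lambda>a. tensor_map K (tensor K M N) P (pure_tensor K M N a) id)"

lemma
  assumes M: "module K M" and N: "module K N" and P: "module K P"
  shows tensor_assoc_inv_linear:
      "tensor_assoc_inv K M N P \<in> linear_maps K (tensor K M (tensor K N P)) (tensor K (tensor K M N) P)"
    and tensor_assoc_inv_pure:
      "a \<in> carrier M \<Longrightarrow> y \<in> carrier (tensor K N P) \<Longrightarrow>
        tensor_assoc_inv K M N P (pure_tensor K M (tensor K N P) a y) =
        tensor_map K (tensor K M N) P (pure_tensor K M N a) id y"
proof -
  note NP = module_tensor[OF N P] and MN = module_tensor[OF M N]
  have bil: "(\<lambda>a. tensor_map K (tensor K M N) P (pure_tensor K M N a) id)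
      \<in> bilinear_maps K M (tensor K N P) (tensor K (tensor K M N) P)"
    using tensor_map_linear[OF N P MN P pure_right_linear[OF M N] linear_id]
      tensor_map_family_linear[OF M N MN P module_pair.pure_bilinear[OF module_pairI[OF M N]]]
    by (intro bilinear_mapsI)
  show "tensor_assoc_inv K M N P \<in> linear_maps K (tensor K M (tensor K N P)) (tensor K (tensor K M N) P)"
    unfolding tensor_assoc_inv_def by (rule lift_linear[OF M NP module_tensor[OF MN P] bil])
  show "tensor_assoc_inv K M N P (pure_tensor K M (tensor K N P) a y) =
        tensor_map K (tensor K M N) P (pure_tensor K M N a) id y"
    if "a \<in> carrier M" "y \<in> carrier (tensor K N P)"
    unfolding tensor_assoc_inv_def by (rule lift_pure[OF M NP module_tensor[OF MN P] bil that])
qed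

lemma tensor_assoc_inv_pure_pure:
  assumes M: "module K M" and N: "module K N" and P: "module K P"
    and abc: "a \<in> carrier M" "b \<in> carrier N" "c \<in> carrier P"
  shows "tensor_assoc_inv K M N P (pure_tensor K M (tensor K N P) a (pure_tensor K N P b c)) =
    pure_tensor K (tensor K M N) P (pure_tensor K M N a b) c"
  using tensor_assoc_inv_pure[OF M N P abc(1) pure_closed[OF N P abc(2,3)]]
    tensor_map_pure[OF N P module_tensor[OF M N] P pure_right_linear[OF M N abc(1)] linear_id abc(2,3)]
  by simp

lemma tensor_assoc_inverse:
  assumes M: "module K M" and N: "module K N" and P: "module K P"
    and x: "x \<in> carrier (tensor K M (tensor K N P))"
  shows "tensor_assoc K M N P (tensor_assoc_inv K M N P x) = x"
proof -
  have "tensor_assoc K M N P (tensor_assoc_inv K M N P x) = id x"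
    by (rule tensor_ext_right[OF M N P module_tensor[OF M module_tensor[OF N P]]
          linear_comp[OF tensor_assoc_inv_linear[OF M N P] tensor_assoc_linear[OF M N P]] linear_id _ x])
       (simp add: tensor_assoc_inv_pure_pure[OF M N P] tensor_assoc_pure[OF M N P])
  then show ?thesis by simp
qed

lemma tensor_assoc_inv_inverse:
  assumes M: "module K M" and N: "module K N" and P: "module K P"
    and x: "x \<in> carrier (tensor K (tensor K M N) P)"
  shows "tensor_assoc_inv K M N P (tensor_assoc K M N P x) = x"
proof -
  have "tensor_assoc_inv K M N P (tensor_assoc K M N P x) = id x"
    by (rule tensor_ext_left[OF M N P module_tensor[OF module_tensor[OF M N] P]
          linear_comp[OF tensor_assoc_linear[OF M N P] tensor_assoc_inv_linear[OF M N P]] linear_id _ x])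
       (simp add: tensor_assoc_inv_pure_pure[OF M N P] tensor_assoc_pure[OF M N P])
  then show ?thesis by simp
qed

lemma tensor_assoc_natural:
  assumes mods: "module K M" "module K N" "module K P" "module K M'" "module K N'" "module K P'"
    and lin: "f \<in> linear_maps K M M'" "g \<in> linear_maps K N N'" "h \<in> linear_maps K P P'"
    and x: "x \<in> carrier (tensor K (tensor K M N) P)"
  shows "tensor_assoc K M' N' P' (tensor_map K (tensor K M' N') P' (tensor_map K M' N' f g) h x) =
    tensor_map K M' (tensor K N' P') f (tensor_map K N' P' g h) (tensor_assoc K M N P x)"
proof -
  note t = module_tensor
  note fg = tensor_map_linear[OF mods(1,2,4,5) lin(1,2)]
  note gh = tensor_map_linear[OF mods(2,3,5,6) lin(2,3)]
  note fg_h = tensor_map_linear[OF t[OF mods(1,2)] mods(3) t[OF mods(4,5)] mods(6) fg lin(3)]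
  note f_gh = tensor_map_linear[OF mods(1) t[OF mods(2,3)] mods(4) t[OF mods(5,6)] lin(1) gh]
  show ?thesis
    by (rule tensor_ext_left[OF mods(1-3) t[OF mods(4) t[OF mods(5,6)]]
        linear_comp[OF fg_h tensor_assoc_linear[OF mods(4-6)]]
        linear_comp[OF tensor_assoc_linear[OF mods(1-3)] f_gh] _ x])
      (simp add: tensor_map_pure[OF t[OF mods(1,2)] mods(3) t[OF mods(4,5)] mods(6) fg lin(3)]
        tensor_map_pure[OF mods(1,2,4,5) lin(1,2)] tensor_map_pure[OF mods(2,3,5,6) lin(2,3)]
        tensor_map_pure[OF mods(1) t[OF mods(2,3)] mods(4) t[OF mods(5,6)] lin(1) gh]
        tensor_assoc_pure[OF mods(1-3)] tensor_assoc_pure[OF mods(4-6)]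
        pure_closed[OF mods(1,2)] pure_closed[OF mods(2,3)] linear_closed[OF lin(1)]
        linear_closed[OF lin(2)] linear_closed[OF lin(3)])
qed

text \<open>Conjugates \<open>tensor_assoc_natural\<close> by the two inverse isomorphisms; no new
  check on pure tensors is needed.\<close>

lemma tensor_assoc_inv_natural:
  assumes mods: "module K M" "module K N" "module K P" "module K M'" "module K N'" "module K P'"
    and lin: "f \<in> linear_maps K M M'" "g \<in> linear_maps K N N'" "h \<in> linear_maps K P P'"
    and x: "x \<in> carrier (tensor K M (tensor K N P))"
  shows "tensor_assoc_inv K M' N' P' (tensor_map K M' (tensor K N' P') f (tensor_map K N' P' g h) x) =
    tensor_map K (tensor K M' N') P' (tensor_map K M' N' f g) h (tensor_assoc_inv K M N P x)"
proof -
  let ?y = "tensor_assoc_inv K M N P x"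
  note y = linear_closed[OF tensor_assoc_inv_linear[OF mods(1-3)] x]
  have "tensor_map K M' (tensor K N' P') f (tensor_map K N' P' g h) x =
      tensor_assoc K M' N' P' (tensor_map K (tensor K M' N') P' (tensor_map K M' N' f g) h ?y)"
    using tensor_assoc_natural[OF mods lin y] tensor_assoc_inverse[OF mods(1-3) x] by simp
  then show ?thesis
    by (simp add: tensor_assoc_inv_inverse[OF mods(4-6)]
        tensor_map_closed[OF module_tensor[OF mods(1,2)] mods(3) module_tensor[OF mods(4,5)] mods(6)
          tensor_map_linear[OF mods(1,2,4,5) lin(1,2)] lin(3) y])
qed

section \<open>The right unit isomorphism\<close>

lemma module_base_module:
  assumes "cring K"
  shows "module K (base_module K)"
proof -
  interpret K: cring K by fact
  show ?thesis
    by (intro moduleI abelian_groupI assms)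
       (auto simp: base_module_def K.a_ac K.l_distr K.r_distr K.m_assoc intro: K.a_inv_closed K.l_neg bexI)
qed

lemma
  assumes M: "module K M"
  shows tensor_unit_right_linear: "tensor_unit_right K M \<in> linear_maps K (tensor K M (base_module K)) M"
    and tensor_unit_right_pure: "a \<in> carrier M \<Longrightarrow> k \<in> carrier K \<Longrightarrow>
      tensor_unit_right K M (pure_tensor K M (base_module K) a k) = k \<odot>\<^bsub>M\<^esub> a"
proof -
  interpret M: module K M by fact
  note B = module_base_module[OF M.R.is_cring]
  have bil: "(\<lambda>a k. k \<odot>\<^bsub>M\<^esub> a) \<in> bilinear_maps K M (base_module K) M"
    by (intro bilinear_mapsI linear_mapsI)
       (auto simp: base_module_def M.smult_l_distr M.smult_r_distr M.smult_assoc1[symmetric] M.R.m_comm)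
  show "tensor_unit_right K M \<in> linear_maps K (tensor K M (base_module K)) M"
    unfolding tensor_unit_right_def by (rule lift_linear[OF M B M bil])
  show "tensor_unit_right K M (pure_tensor K M (base_module K) a k) = k \<odot>\<^bsub>M\<^esub> a"
    if "a \<in> carrier M" "k \<in> carrier K"
    unfolding tensor_unit_right_def
    by (rule lift_pure[OF M B M bil]) (use that in \<open>simp_all add: base_module_def\<close>)
qed

lemma tensor_unit_right_natural:
  assumes M: "module K M" and N: "module K N" and f: "f \<in> linear_maps K M N"
    and x: "x \<in> carrier (tensor K M (base_module K))"
  shows "tensor_unit_right K N (tensor_map K N (base_module K) f id x) = f (tensor_unit_right K M x)"
proof -
  note B = module_base_module[OF module_cring[OF M]]
  have "k \<in> carrier (base_module K) \<Longrightarrow> k \<in> carrier K" for k by (simp add: base_module_def)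
  then show ?thesis
    by (intro tensor_ext[OF M B N linear_comp[OF tensor_map_linear[OF M B N B f linear_id]
          tensor_unit_right_linear[OF N]] linear_comp[OF tensor_unit_right_linear[OF M] f] _ x])
       (simp add: tensor_map_pure[OF M B N B f linear_id] tensor_unit_right_pure M N
         linear_closed[OF f] linear_smult[OF f])
qed

section \<open>Exactness over a field\<close>

lemma (in abelian_group) minus_eq_zero_iff:
  assumes "x \<in> carrier G" "y \<in> carrier G"
  shows "x \<ominus> y = \<zero> \<longleftrightarrow> x = y"
  using assms by (metis a_inv_closed minus_equality minus_minus minus_eq r_neg)

lemma (in abelian_group) add_minus_cancel:
  assumes "x \<in> carrier G" "y \<in> carrier G"
  shows "x \<oplus> (y \<oplus> \<ominus> x) = y"
  using assms by (metis a_comm a_inv_closed a_lcomm r_neg r_zero)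

section \<open>Complements of subspaces\<close>

lemma submodule_add_line:
  assumes M: "module K M" and Q: "submodule Q K M" and x: "x \<in> carrier M"
  shows "submodule {q \<oplus>\<^bsub>M\<^esub> k \<odot>\<^bsub>M\<^esub> x | q k. q \<in> Q \<and> k \<in> carrier K} K M"
proof -
  interpret M: module K M by fact
  note Q' = M.submoduleE[OF Q]
  have Qc: "q \<in> carrier M" if "q \<in> Q" for q using Q'(1) that by blast
  have zero: "\<zero>\<^bsub>M\<^esub> \<in> Q" using subgroup.one_closed[OF submodule.axioms(1)[OF Q]] by simp
  show ?thesis
  proof (rule submodule_of_smult_closed[OF M])
    show "{q \<oplus>\<^bsub>M\<^esub> k \<odot>\<^bsub>M\<^esub> x | q k. q \<in> Q \<and> k \<in> carrier K} \<subseteq> carrier M"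
      using Qc x by auto
    have "\<zero>\<^bsub>M\<^esub> = \<zero>\<^bsub>M\<^esub> \<oplus>\<^bsub>M\<^esub> \<zero>\<^bsub>K\<^esub> \<odot>\<^bsub>M\<^esub> x" using x by simp
    then show "\<zero>\<^bsub>M\<^esub> \<in> {q \<oplus>\<^bsub>M\<^esub> k \<odot>\<^bsub>M\<^esub> x | q k. q \<in> Q \<and> k \<in> carrier K}"
      using zero by blast
  next
    fix y z assume "y \<in> {q \<oplus>\<^bsub>M\<^esub> k \<odot>\<^bsub>M\<^esub> x | q k. q \<in> Q \<and> k \<in> carrier K}"
      and "z \<in> {q \<oplus>\<^bsub>M\<^esub> k \<odot>\<^bsub>M\<^esub> x | q k. q \<in> Q \<and> k \<in> carrier K}"
    then obtain q k r l where *: "y = q \<oplus>\<^bsub>M\<^esub> k \<odot>\<^bsub>M\<^esub> x" "q \<in> Q" "k \<in> carrier K"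
      "z = r \<oplus>\<^bsub>M\<^esub> l \<odot>\<^bsub>M\<^esub> x" "r \<in> Q" "l \<in> carrier K" by blast
    then have "y \<oplus>\<^bsub>M\<^esub> z = (q \<oplus>\<^bsub>M\<^esub> r) \<oplus>\<^bsub>M\<^esub> (k \<oplus>\<^bsub>K\<^esub> l) \<odot>\<^bsub>M\<^esub> x"
      using x Qc by (simp add: M.smult_l_distr M.add.m_ac)
    then show "y \<oplus>\<^bsub>M\<^esub> z \<in> {q \<oplus>\<^bsub>M\<^esub> k \<odot>\<^bsub>M\<^esub> x | q k. q \<in> Q \<and> k \<in> carrier K}"
      using * Q'(5) by blast
  next
    fix c y assume c: "c \<in> carrier K"
      and "y \<in> {q \<oplus>\<^bsub>M\<^esub> k \<odot>\<^bsub>M\<^esub> x | q k. q \<in> Q \<and> k \<in> carrier K}"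
    then obtain q k where *: "y = q \<oplus>\<^bsub>M\<^esub> k \<odot>\<^bsub>M\<^esub> x" "q \<in> Q" "k \<in> carrier K" by blast
    then have "c \<odot>\<^bsub>M\<^esub> y = c \<odot>\<^bsub>M\<^esub> q \<oplus>\<^bsub>M\<^esub> (c \<otimes>\<^bsub>K\<^esub> k) \<odot>\<^bsub>M\<^esub> x"
      using x c Qc by (simp add: M.smult_r_distr M.smult_assoc1)
    then show "c \<odot>\<^bsub>M\<^esub> y \<in> {q \<oplus>\<^bsub>M\<^esub> k \<odot>\<^bsub>M\<^esub> x | q k. q \<in> Q \<and> k \<in> carrier K}"
      using * c Q'(4)[OF c *(2)] M.R.m_closed by blast
  qed
qed

lemma submodule_Union_chain:
  assumes M: "module K M" and ne: "\<C> \<noteq> {}" and chain: "subset.chain {Q. submodule Q K M} \<C>"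
  shows "submodule (\<Union>\<C>) K M"
proof -
  interpret M: module K M by fact
  have sub: "submodule Q K M" if "Q \<in> \<C>" for Q
    using chain that by (auto simp: subset.chain_def)
  show ?thesis
  proof (rule submodule_of_smult_closed[OF M])
    show "\<Union>\<C> \<subseteq> carrier M" using M.submoduleE(1)[OF sub] by blast
    show "\<zero>\<^bsub>M\<^esub> \<in> \<Union>\<C>" using ne subgroup.one_closed[OF submodule.axioms(1)[OF sub]] by fastforce
    show "k \<odot>\<^bsub>M\<^esub> x \<in> \<Union>\<C>" if "k \<in> carrier K" "x \<in> \<Union>\<C>" for k x
      using that M.submoduleE(4)[OF sub] by blast
    show "x \<oplus>\<^bsub>M\<^esub> y \<in> \<Union>\<C>" if xy: "x \<in> \<Union>\<C>" "y \<in> \<Union>\<C>" for x y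
    proof -
      obtain P Q where PQ: "P \<in> \<C>" "x \<in> P" "Q \<in> \<C>" "y \<in> Q" using xy by blast
      then have "P \<subseteq> Q \<or> Q \<subseteq> P" using chain by (auto simp: subset_chain_def)
      then obtain R where "R \<in> \<C>" "x \<in> R" "y \<in> R" using PQ by blast
      then show ?thesis using M.submoduleE(5)[OF sub] by blast
    qed
  qed
qed

text \<open>Zorn's lemma gives a maximal \<open>Q\<close> that meets \<open>W\<close> trivially. If
  some \<open>x\<close> were outside the sum of \<open>W\<close> and \<open>Q\<close>, adjoining the
  line through \<open>x\<close> to \<open>Q\<close> would keep the intersection trivial and
  contradict maximality.\<close>

lemma submodule_complement:
  assumes K: "field K" and M: "module K M" and W: "submodule W K M"
  obtains Q where "submodule Q K M" "W \<inter> Q \<subseteq> {\<zero>\<^bsub>M\<^esub>}"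
    "\<And>x. x \<in> carrier M \<Longrightarrow> \<exists>w\<in>W. \<exists>q\<in>Q. x = w \<oplus>\<^bsub>M\<^esub> q"
proof -
  interpret M: module K M by fact
  interpret K: field K by fact
  note W' = M.submoduleE[OF W]
  have Wc: "w \<in> carrier M" if "w \<in> W" for w using W'(1) that by blast
  let ?A = "{Q. submodule Q K M \<and> W \<inter> Q \<subseteq> {\<zero>\<^bsub>M\<^esub>}}"
  have "submodule {\<zero>\<^bsub>M\<^esub>} K M" by (rule submodule_of_smult_closed[OF M]) auto
  then have "?A \<noteq> {}" by blast
  moreover have "\<Union>\<C> \<in> ?A" if "\<C> \<noteq> {}" "subset.chain ?A \<C>" for \<C>
  proof -
    have "subset.chain {Q. submodule Q K M} \<C>"
      using that(2) by (auto simp: subset.chain_def)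
    then have "submodule (\<Union>\<C>) K M" by (rule submodule_Union_chain[OF M that(1)])
    moreover have "W \<inter> \<Union>\<C> \<subseteq> {\<zero>\<^bsub>M\<^esub>}" using that(2) by (auto simp: subset.chain_def)
    ultimately show ?thesis by blast
  qed
  ultimately obtain Q where "Q \<in> ?A" and max: "\<forall>X\<in>?A. Q \<subseteq> X \<longrightarrow> X = Q"
    using subset_Zorn_nonempty[of ?A] by blast
  then have Q: "submodule Q K M" and WQ: "W \<inter> Q \<subseteq> {\<zero>\<^bsub>M\<^esub>}" by auto
  note Q' = M.submoduleE[OF Q]
  have Qc: "q \<in> carrier M" if "q \<in> Q" for q using Q'(1) that by blast
  have zero: "\<zero>\<^bsub>M\<^esub> \<in> Q" "\<zero>\<^bsub>M\<^esub> \<in> W"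
    using subgroup.one_closed[OF submodule.axioms(1)[OF Q]]
      subgroup.one_closed[OF submodule.axioms(1)[OF W]] by simp_all
  have "\<exists>w\<in>W. \<exists>q\<in>Q. x = w \<oplus>\<^bsub>M\<^esub> q" if x: "x \<in> carrier M" for x
  proof (rule ccontr)
    assume neg: "\<not> ?thesis"
    let ?Q = "{q \<oplus>\<^bsub>M\<^esub> k \<odot>\<^bsub>M\<^esub> x | q k. q \<in> Q \<and> k \<in> carrier K}"
    have "W \<inter> ?Q \<subseteq> {\<zero>\<^bsub>M\<^esub>}"
    proof
      fix w assume "w \<in> W \<inter> ?Q"
      then obtain q k where w: "w \<in> W" "w = q \<oplus>\<^bsub>M\<^esub> k \<odot>\<^bsub>M\<^esub> x" and q: "q \<in> Q" and k: "k \<in> carrier K"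
        by blast
      show "w \<in> {\<zero>\<^bsub>M\<^esub>}"
      proof (cases "k = \<zero>\<^bsub>K\<^esub>")
        case True
        then have "w = q" using w q x Qc by simp
        then show ?thesis using w q WQ by blast
      next
        case False
        \<comment> \<open>This is where the field enters: dividing by \<open>k\<close> would write
          \<open>x\<close> as a sum of elements of \<open>W\<close> and \<open>Q\<close>, against
          \<open>neg\<close>.\<close>
        then have kU: "k \<in> Units K" using k by (simp add: K.field_Units)
        let ?i = "inv\<^bsub>K\<^esub> k"
        have i: "?i \<in> carrier K" "?i \<otimes>\<^bsub>K\<^esub> k = \<one>\<^bsub>K\<^esub>" using kU by auto
        have "w \<oplus>\<^bsub>M\<^esub> \<ominus>\<^bsub>M\<^esub> q = k \<odot>\<^bsub>M\<^esub> x"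
          using w(2) Qc[OF q] k x by (simp add: M.add.m_ac M.r_neg1 M.r_neg2)
        then have "?i \<odot>\<^bsub>M\<^esub> (w \<oplus>\<^bsub>M\<^esub> \<ominus>\<^bsub>M\<^esub> q) = x"
          using i k x by (simp add: M.smult_assoc1[symmetric])
        then have "x = ?i \<odot>\<^bsub>M\<^esub> w \<oplus>\<^bsub>M\<^esub> ?i \<odot>\<^bsub>M\<^esub> (\<ominus>\<^bsub>M\<^esub> q)"
          using i Wc[OF w(1)] Qc[OF q] by (simp add: M.smult_r_distr)
        then show ?thesis using neg W'(4)[OF i(1) w(1)] Q'(4)[OF i(1) Q'(3)[OF q]] by blast
      qed
    qed
    then have "?Q \<in> ?A" using submodule_add_line[OF M Q x] by blast
    moreover have "Q \<subseteq> ?Q"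
    proof
      fix q assume q: "q \<in> Q"
      then have "q = q \<oplus>\<^bsub>M\<^esub> \<zero>\<^bsub>K\<^esub> \<odot>\<^bsub>M\<^esub> x" using x Qc by simp
      then show "q \<in> ?Q" using q by blast
    qed
    ultimately have "?Q = Q" using max by blast
    \<comment> \<open>Maximality has put the line inside \<open>Q\<close>, so \<open>x\<close>
      itself lies in \<open>Q\<close> and decomposes as zero plus \<open>x\<close>.\<close>
    moreover have "x = \<zero>\<^bsub>M\<^esub> \<oplus>\<^bsub>M\<^esub> \<one>\<^bsub>K\<^esub> \<odot>\<^bsub>M\<^esub> x" using x by simp
    ultimately have "x \<in> Q" using zero by blast
    moreover have "x = \<zero>\<^bsub>M\<^esub> \<oplus>\<^bsub>M\<^esub> x" using x by simp
    ultimately show False using neg zero by blast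
  qed
  then show thesis using that[OF Q WQ] by blast
qed

section \<open>Projections and generalized inverses\<close>

lemma module_subspace: "module K M \<Longrightarrow> submodule W K M \<Longrightarrow> module K (M\<lparr>carrier := W\<rparr>)"
  by (rule submodule.submodule_is_module)

lemma linear_subspace_id:
  assumes "W \<subseteq> carrier M"
  shows "id \<in> linear_maps K (M\<lparr>carrier := W\<rparr>) M"
  using assms by (auto simp: linear_maps_def)

lemma linear_into_subspace:
  assumes "f \<in> linear_maps K M N" "\<And>x. x \<in> carrier M \<Longrightarrow> f x \<in> W"
  shows "f \<in> linear_maps K M (N\<lparr>carrier := W\<rparr>)"
  using assms by (auto simp: linear_maps_def)

text \<open>With a complement \<open>Q\<close> of \<open>W\<close>, the map \<open>p\<close> reads
  off the component in \<open>W\<close>. Linearity follows because sums and multiples of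
  decompositions are again decompositions.\<close>

lemma subspace_projection:
  assumes K: "field K" and M: "module K M" and W: "submodule W K M"
  obtains p where "p \<in> linear_maps K M (M\<lparr>carrier := W\<rparr>)" "\<And>w. w \<in> W \<Longrightarrow> p w = w"
proof -
  interpret M: module K M by fact
  obtain Q where Q: "submodule Q K M" and WQ: "W \<inter> Q \<subseteq> {\<zero>\<^bsub>M\<^esub>}"
    and dec: "\<And>x. x \<in> carrier M \<Longrightarrow> \<exists>w\<in>W. \<exists>q\<in>Q. x = w \<oplus>\<^bsub>M\<^esub> q"
    using submodule_complement[OF assms] by blast
  note W' = M.submoduleE[OF W] and Q' = M.submoduleE[OF Q]
  have Wc: "w \<in> carrier M" if "w \<in> W" for w using W'(1) that by blast
  have Qc: "q \<in> carrier M" if "q \<in> Q" for q using Q'(1) that by blast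
  \<comment> \<open>The difference of the two \<open>W\<close>-components equals that of the two
    \<open>Q\<close>-components in reverse, so it lies in the trivial intersection.\<close>
  have uniq: "w = w'" if "w \<oplus>\<^bsub>M\<^esub> q = w' \<oplus>\<^bsub>M\<^esub> q'" "w \<in> W" "w' \<in> W" "q \<in> Q" "q' \<in> Q" for w w' q q'
  proof -
    note c = Wc[OF that(2)] Wc[OF that(3)] Qc[OF that(4)] Qc[OF that(5)]
    have "w \<oplus>\<^bsub>M\<^esub> \<ominus>\<^bsub>M\<^esub> w' = q' \<oplus>\<^bsub>M\<^esub> \<ominus>\<^bsub>M\<^esub> q"
    proof -
      have "w \<oplus>\<^bsub>M\<^esub> \<ominus>\<^bsub>M\<^esub> w' = (w \<oplus>\<^bsub>M\<^esub> q) \<oplus>\<^bsub>M\<^esub> \<ominus>\<^bsub>M\<^esub> q \<oplus>\<^bsub>M\<^esub> \<ominus>\<^bsub>M\<^esub> w'"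
        using c by (simp add: M.add.m_assoc M.r_neg)
      also have "\<dots> = q' \<oplus>\<^bsub>M\<^esub> \<ominus>\<^bsub>M\<^esub> q"
        unfolding that(1) using c by (simp add: M.add.m_ac M.add_minus_cancel)
      finally show ?thesis .
    qed
    moreover have "w \<oplus>\<^bsub>M\<^esub> \<ominus>\<^bsub>M\<^esub> w' \<in> W" using that W'(3,5) by blast
    moreover have "q' \<oplus>\<^bsub>M\<^esub> \<ominus>\<^bsub>M\<^esub> q \<in> Q" using that Q'(3,5) by blast
    ultimately have "w \<ominus>\<^bsub>M\<^esub> w' = \<zero>\<^bsub>M\<^esub>" using WQ by (auto simp: a_minus_def)
    then show ?thesis using c by (simp add: M.minus_eq_zero_iff)
  qed
  define p where "p x = (THE w. w \<in> W \<and> (\<exists>q\<in>Q. x = w \<oplus>\<^bsub>M\<^esub> q))" for x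
  have p: "p (w \<oplus>\<^bsub>M\<^esub> q) = w" if "w \<in> W" "q \<in> Q" for w q
    unfolding p_def using that uniq by (intro the_equality) blast+
  show thesis
  proof (rule that)
    show "p w = w" if "w \<in> W" for w
      using p[OF that, of "\<zero>\<^bsub>M\<^esub>"] subgroup.one_closed[OF submodule.axioms(1)[OF Q]] Wc[OF that] by simp
    show "p \<in> linear_maps K M (M\<lparr>carrier := W\<rparr>)"
    proof (rule linear_mapsI)
      fix x assume "x \<in> carrier M"
      then obtain w q where x: "w \<in> W" "q \<in> Q" "x = w \<oplus>\<^bsub>M\<^esub> q" using dec by blast
      then show "p x \<in> carrier (M\<lparr>carrier := W\<rparr>)" by (simp add: p)
      show "p (k \<odot>\<^bsub>M\<^esub> x) = k \<odot>\<^bsub>M\<lparr>carrier := W\<rparr>\<^esub> p x" if k: "k \<in> carrier K" for k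
        using p[OF W'(4)[OF k x(1)] Q'(4)[OF k x(2)]] x k Wc Qc by (simp add: M.smult_r_distr p)
      fix y assume "y \<in> carrier M"
      then obtain w' q' where y: "w' \<in> W" "q' \<in> Q" "y = w' \<oplus>\<^bsub>M\<^esub> q'" using dec by blast
      have "x \<oplus>\<^bsub>M\<^esub> y = (w \<oplus>\<^bsub>M\<^esub> w') \<oplus>\<^bsub>M\<^esub> (q \<oplus>\<^bsub>M\<^esub> q')"
        using x y Wc Qc by (simp add: M.add.m_ac)
      then show "p (x \<oplus>\<^bsub>M\<^esub> y) = p x \<oplus>\<^bsub>M\<lparr>carrier := W\<rparr>\<^esub> p y"
        using p[OF W'(5)[OF x(1) y(1)] Q'(5)[OF x(2) y(2)]] x y by (simp add: p)
    qed
  qed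
qed

text \<open>Project the target onto the image of \<open>f\<close> by \<open>q\<close>, choose
  preimages by \<open>s\<close>, and correct the choice by \<open>r\<close>, which removes the
  kernel component. Although \<open>s\<close> need not be linear, \<open>r\<close> after
  \<open>s\<close> is, and it is the required map.\<close>

lemma generalized_inverse:
  assumes K: "field K" and M: "module K M" and N: "module K N" and f: "f \<in> linear_maps K M N"
  obtains g where "g \<in> linear_maps K N M" "\<And>x. x \<in> carrier M \<Longrightarrow> f (g (f x)) = f x"
proof -
  interpret M: module K M by fact
  interpret N: module K N by fact
  let ?Z = "{x \<in> carrier M. f x = \<zero>\<^bsub>N\<^esub>}"
  have "(\<lambda>_. \<zero>\<^bsub>N\<^esub>) \<in> linear_maps K M N" by (rule linear_mapsI) auto
  then have "submodule ?Z K M" by (rule submodule_equalizer[OF M N f])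
  then obtain p where p: "p \<in> linear_maps K M (M\<lparr>carrier := ?Z\<rparr>)" "\<And>w. w \<in> ?Z \<Longrightarrow> p w = w"
    using subspace_projection[OF K M] by blast
  have pM: "p \<in> linear_maps K M M" using p(1) by (auto simp: linear_maps_def)
  have fp: "f (p x) = \<zero>\<^bsub>N\<^esub>" if "x \<in> carrier M" for x
    using linear_closed[OF p(1) that] by simp
  have "submodule (f ` carrier M) K N"
  proof (rule submodule_of_smult_closed[OF N])
    show "\<zero>\<^bsub>N\<^esub> \<in> f ` carrier M" using linear_zero[OF M N f] by (metis M.zero_closed imageI)
  qed (auto simp: linear_closed[OF f] linear_add[OF f, symmetric] linear_smult[OF f, symmetric])
  then obtain q where q: "q \<in> linear_maps K N (N\<lparr>carrier := f ` carrier M\<rparr>)"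
    "\<And>y. y \<in> f ` carrier M \<Longrightarrow> q y = y"
    using subspace_projection[OF K N] by blast
  define s where "s u = (SOME m. m \<in> carrier M \<and> f m = q u)" for u
  have s: "s u \<in> carrier M" "f (s u) = q u" if "u \<in> carrier N" for u
  proof -
    have "q u \<in> f ` carrier M" using linear_closed[OF q(1) that] by simp
    then have "\<exists>m. m \<in> carrier M \<and> f m = q u" by (metis imageE)
    then have "s u \<in> carrier M \<and> f (s u) = q u" unfolding s_def by (rule someI_ex)
    then show "s u \<in> carrier M" "f (s u) = q u" by auto
  qed
  define r where "r m = m \<ominus>\<^bsub>M\<^esub> p m" for m
  have r: "r \<in> linear_maps K M M"
    unfolding r_def using linear_diff[OF M M linear_id pM] by simp
  \<comment> \<open>The map \<open>r\<close> vanishes on the kernel of \<open>f\<close>, so it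
    forgets which preimage was chosen. Linearity of the composite with \<open>s\<close> rests on
    this.\<close>
  have r_eq: "r m = r m'" if "m \<in> carrier M" "m' \<in> carrier M" "f m = f m'" for m m'
  proof -
    have d: "m \<ominus>\<^bsub>M\<^esub> m' \<in> ?Z"
      using that linear_minus[OF M N f that(1,2)] linear_closed[OF f that(2)]
      by (simp add: M.minus_closed N.minus_eq_zero_iff)
    then have "r (m \<ominus>\<^bsub>M\<^esub> m') = \<zero>\<^bsub>M\<^esub>" using p(2)[OF d] by (simp add: r_def M.minus_eq_zero_iff)
    then show ?thesis
      using linear_minus[OF M M r that(1,2)] linear_closed[OF r that(1)] linear_closed[OF r that(2)]
      by (simp add: M.minus_eq_zero_iff)
  qed
  show thesis
  proof (rule that)
    show "(\<lambda>u. r (s u)) \<in> linear_maps K N M"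
    proof (rule linear_mapsI)
      fix u assume u: "u \<in> carrier N"
      show "r (s u) \<in> carrier M" using linear_closed[OF r s(1)[OF u]] .
      show "r (s (u \<oplus>\<^bsub>N\<^esub> v)) = r (s u) \<oplus>\<^bsub>M\<^esub> r (s v)" if v: "v \<in> carrier N" for v
      proof -
        have "r (s (u \<oplus>\<^bsub>N\<^esub> v)) = r (s u \<oplus>\<^bsub>M\<^esub> s v)"
          using u v s linear_add[OF q(1) u v] by (intro r_eq) (simp_all add: linear_add[OF f])
        then show ?thesis using linear_add[OF r s(1)[OF u] s(1)[OF v]] by simp
      qed
      show "r (s (k \<odot>\<^bsub>N\<^esub> u)) = k \<odot>\<^bsub>M\<^esub> r (s u)" if k: "k \<in> carrier K" for k
      proof -
        have "r (s (k \<odot>\<^bsub>N\<^esub> u)) = r (k \<odot>\<^bsub>M\<^esub> s u)"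
          using u k s linear_smult[OF q(1) k u] by (intro r_eq) (simp_all add: linear_smult[OF f])
        then show ?thesis using linear_smult[OF r k s(1)[OF u]] by simp
      qed
    qed
    fix x assume x: "x \<in> carrier M"
    have fx: "f x \<in> carrier N" using linear_closed[OF f x] .
    \<comment> \<open>The subtracted term is zero since \<open>p\<close> has values in the kernel;
      the other is \<open>q (f x)\<close>, and \<open>q\<close> fixes the image of
      \<open>f\<close>.\<close>
    have "f (r (s (f x))) = f (s (f x)) \<ominus>\<^bsub>N\<^esub> f (p (s (f x)))"
      unfolding r_def using linear_minus[OF M N f s(1)[OF fx] linear_closed[OF pM s(1)[OF fx]]] .
    also have "\<dots> = f x"
      using fp[OF s(1)[OF fx]] s(2)[OF fx] q(2)[of "f x"] x fx by (simp add: a_minus_def)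
    finally show "f (r (s (f x))) = f x" .
  qed
qed

section \<open>Tensoring subspaces and equalizers\<close>

lemma tensor_map_add:
  assumes mods: "module K M" "module K N" "module K M'" "module K N'"
    and f: "f \<in> linear_maps K M M'" and g: "g \<in> linear_maps K M M'" and h: "h \<in> linear_maps K N N'"
    and x: "x \<in> carrier (tensor K M N)"
  shows "tensor_map K M' N' (\<lambda>a. f a \<oplus>\<^bsub>M'\<^esub> g a) h x =
    tensor_map K M' N' f h x \<oplus>\<^bsub>tensor K M' N'\<^esub> tensor_map K M' N' g h x"
proof -
  note MN' = module_tensor[OF mods(3,4)]
  note fg = linear_sum[OF mods(3) f g]
  show ?thesis
    by (rule tensor_ext[OF mods(1,2) MN' tensor_map_linear[OF mods fg h]
          linear_sum[OF MN' tensor_map_linear[OF mods f h] tensor_map_linear[OF mods g h]] _ x])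
       (simp add: tensor_map_pure[OF mods fg h] tensor_map_pure[OF mods f h] tensor_map_pure[OF mods g h]
         linear_add[OF pure_left_linear[OF mods(3,4)]] linear_closed[OF f] linear_closed[OF g] linear_closed[OF h])
qed

text \<open>A projection \<open>p\<close> onto \<open>W\<close>, tensored with the identity, is a
  left inverse.\<close>

lemma tensor_subspace_inj:
  assumes K: "field K" and M: "module K M" and N: "module K N" and W: "submodule W K M"
  shows "inj_on (tensor_map K M N id id) (carrier (tensor K (M\<lparr>carrier := W\<rparr>) N))"
proof -
  interpret M: module K M by fact
  obtain p where p: "p \<in> linear_maps K M (M\<lparr>carrier := W\<rparr>)" "\<And>w. w \<in> W \<Longrightarrow> p w = w"
    using subspace_projection[OF K M W] by blast
  note WM = module_subspace[OF M W] and i = linear_subspace_id[OF M.submoduleE(1)[OF W], where K=K]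
  show ?thesis
  proof (rule inj_on_inverseI)
    fix x assume x: "x \<in> carrier (tensor K (M\<lparr>carrier := W\<rparr>) N)"
    have "tensor_map K (M\<lparr>carrier := W\<rparr>) N p id (tensor_map K M N id id x) =
        tensor_map K (M\<lparr>carrier := W\<rparr>) N (\<lambda>a. p (id a)) (\<lambda>b. id (id b)) x"
      by (rule tensor_map_comp[OF WM N M N WM N i linear_id p(1) linear_id x])
    also have "\<dots> = tensor_map K (M\<lparr>carrier := W\<rparr>) N id id x"
      by (rule tensor_map_cong[OF WM N WM N linear_comp[OF i p(1)] linear_comp[OF linear_id linear_id] _ _ x])
         (simp_all add: p(2))
    also have "\<dots> = x" by (rule tensor_map_id[OF WM N x])
    finally show "tensor_map K (M\<lparr>carrier := W\<rparr>) N p id (tensor_map K M N id id x) = x" .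
  qed
qed

text \<open>Let \<open>?d\<close> be the difference of \<open>f\<close> and \<open>g\<close>, with
  generalized inverse \<open>s\<close>. Then \<open>p = id - s ?d\<close> maps into the equalizer,
  and the hypothesis on \<open>z\<close> makes \<open>p\<close> tensored with the identity fix
  \<open>z\<close>; factoring \<open>p\<close> through the equalizer exhibits the preimage.\<close>

lemma tensor_equalizer_exact:
  assumes K: "field K" and M: "module K M" and U: "module K U" and N: "module K N"
    and f: "f \<in> linear_maps K M U" and g: "g \<in> linear_maps K M U"
    and z: "z \<in> carrier (tensor K M N)"
    and eq: "tensor_map K U N f id z = tensor_map K U N g id z"
  shows "z \<in> tensor_map K M N id id ` carrier (tensor K (M\<lparr>carrier := {x \<in> carrier M. f x = g x}\<rparr>) N)"
proof -
  interpret M: module K M by fact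
  interpret U: module K U by fact
  let ?W = "{x \<in> carrier M. f x = g x}" and ?d = "\<lambda>x. f x \<ominus>\<^bsub>U\<^esub> g x"
  let ?WM = "M\<lparr>carrier := ?W\<rparr>"
  have d: "?d \<in> linear_maps K M U" using linear_diff[OF M U f g] .
  obtain s where s: "s \<in> linear_maps K U M" "\<And>x. x \<in> carrier M \<Longrightarrow> ?d (s (?d x)) = ?d x"
    using generalized_inverse[OF K M U d] by blast
  define p where "p x = x \<ominus>\<^bsub>M\<^esub> s (?d x)" for x
  have sd: "(\<lambda>x. s (?d x)) \<in> linear_maps K M M" by (rule linear_comp[OF d s(1)])
  have pM: "p \<in> linear_maps K M M"
    unfolding p_def using linear_diff[OF M M linear_id sd] by simp
  have "p x \<in> ?W" if x: "x \<in> carrier M" for x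
  proof -
    have "?d (p x) = ?d x \<ominus>\<^bsub>U\<^esub> ?d (s (?d x))"
      unfolding p_def using linear_minus[OF M U d x linear_closed[OF sd x]] .
    also have "\<dots> = \<zero>\<^bsub>U\<^esub>" unfolding s(2)[OF x] using linear_closed[OF d x] by (simp add: U.minus_eq_zero_iff)
    finally show ?thesis
      using linear_closed[OF pM x] linear_closed[OF f] linear_closed[OF g] by (simp add: U.minus_eq_zero_iff)
  qed
  then have p: "p \<in> linear_maps K M ?WM" by (rule linear_into_subspace[OF pM])
  have W: "submodule ?W K M" by (rule submodule_equalizer[OF M U f g])
  note WM = module_subspace[OF M W]
  note sf = linear_comp[OF f s(1)] and sg = linear_comp[OF g s(1)]
  note MN = module_tensor[OF M N]
  interpret MN: module K "tensor K M N" by fact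
  let ?t = "\<lambda>h. tensor_map K M N h id z"
  have tc: "?t h \<in> carrier (tensor K M N)" if "h \<in> linear_maps K M M" for h
    using tensor_map_closed[OF M N M N that linear_id z] .
  have "?t (\<lambda>x. s (f x)) = tensor_map K M N s id (tensor_map K U N f id z)"
    using tensor_map_comp[OF M N U N M N f linear_id s(1) linear_id z] by (simp add: id_def)
  also have "\<dots> = ?t (\<lambda>x. s (g x))"
    unfolding eq using tensor_map_comp[OF M N U N M N g linear_id s(1) linear_id z] by (simp add: id_def)
  \<comment> \<open>The hypothesis on \<open>z\<close>, pushed forward along \<open>s\<close>
    tensored with the identity.\<close>
  finally have tt: "?t (\<lambda>x. s (f x)) = ?t (\<lambda>x. s (g x))" .
  \<comment> \<open>The definition of \<open>p\<close>, rearranged so that only sums occur. After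
    \<open>tensor_map_add\<close> splits both sides, the terms with \<open>s f\<close> and
    \<open>s g\<close> cancel by \<open>tt\<close>.\<close>
  have "?t (\<lambda>x. p x \<oplus>\<^bsub>M\<^esub> s (f x)) = ?t (\<lambda>x. id x \<oplus>\<^bsub>M\<^esub> s (g x))"
  proof (rule tensor_map_cong[OF M N M N linear_sum[OF M pM sf] linear_id _ _ z])
    fix x assume x: "x \<in> carrier M"
    have "s (?d x) = s (f x) \<ominus>\<^bsub>M\<^esub> s (g x)"
      using linear_minus[OF U M s(1) linear_closed[OF f x] linear_closed[OF g x]] .
    then show "p x \<oplus>\<^bsub>M\<^esub> s (f x) = id x \<oplus>\<^bsub>M\<^esub> s (g x)"
      using x linear_closed[OF sf x] linear_closed[OF sg x]
      by (simp add: p_def a_minus_def M.minus_add M.add.m_ac M.add_minus_cancel)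
  qed simp
  then have "?t p \<oplus>\<^bsub>tensor K M N\<^esub> ?t (\<lambda>x. s (f x)) = ?t id \<oplus>\<^bsub>tensor K M N\<^esub> ?t (\<lambda>x. s (g x))"
    using tensor_map_add[OF M N M N pM sf linear_id z] tensor_map_add[OF M N M N linear_id sg linear_id z]
    by simp
  then have "?t p = ?t id"
    unfolding tt using tc[OF pM] tc[OF linear_id] tc[OF sg] by simp
  then have "z = ?t p" using tensor_map_id[OF M N z] by simp
  also have "\<dots> = tensor_map K M N id id (tensor_map K ?WM N p id z)"
    using tensor_map_comp[OF M N WM N M N p linear_id linear_subspace_id linear_id z] by (simp add: id_def)
  finally show ?thesis
    using tensor_map_closed[OF M N WM N p linear_id z] by (rule image_eqI)
qed

section \<open>The coaction on a tensor product\<close>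

text \<open>
  The map \<open>id \<otimes> \<delta>\<close> regrouped: on a pure tensor \<open>v \<otimes> h\<close> it applies \<open>v \<otimes> _\<close>
  to the left factors of \<open>\<delta> h\<close>.
\<close>

definition cofree where
  "cofree K V A B \<delta> x = tensor_assoc_inv K V A B (tensor_map K V (tensor K A B) id \<delta> x)"

lemma cofree_linear:
  assumes "module K V" "module K X" "module K A" "module K B"
    and "\<delta> \<in> linear_maps K X (tensor K A B)"
  shows "cofree K V A B \<delta> \<in> linear_maps K (tensor K V X) (tensor K (tensor K V A) B)"
proof -
  have "(\<lambda>x. cofree K V A B \<delta> x) \<in> linear_maps K (tensor K V X) (tensor K (tensor K V A) B)"
    unfolding cofree_def using assms
    by (intro linear_comp[OF tensor_map_linear tensor_assoc_inv_linear] module_tensor linear_id)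
  then show ?thesis .
qed

lemma cofree_pure:
  assumes "module K V" "module K X" "module K A" "module K B"
    and "\<delta> \<in> linear_maps K X (tensor K A B)" "v \<in> carrier V" "h \<in> carrier X"
  shows "cofree K V A B \<delta> (pure_tensor K V X v h) =
    tensor_map K (tensor K V A) B (pure_tensor K V A v) id (\<delta> h)"
  unfolding cofree_def
  by (simp add: tensor_map_pure[OF assms(1,2,1) module_tensor[OF assms(3,4)] linear_id assms(5-7)]
      tensor_assoc_inv_pure[OF assms(1,3,4,6) linear_closed[OF assms(5,7)]])

text \<open>The maps \<open>f\<close> and \<delta> act on different tensor factors and commute; the
  inverse associator is natural.\<close>

lemma cofree_natural:
  assumes V: "module K V" and V': "module K V'" and X: "module K X" and A: "module K A" and B: "module K B"
    and \<delta>: "\<delta> \<in> linear_maps K X (tensor K A B)" and f: "f \<in> linear_maps K V V'"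
    and x: "x \<in> carrier (tensor K V X)"
  shows "cofree K V' A B \<delta> (tensor_map K V' X f id x) =
    tensor_map K (tensor K V' A) B (tensor_map K V' A f id) id (cofree K V A B \<delta> x)"
proof -
  note AB = module_tensor[OF A B]
  let ?y = "tensor_map K V (tensor K A B) id \<delta> x"
  have y: "?y \<in> carrier (tensor K V (tensor K A B))"
    by (rule tensor_map_closed[OF V X V AB linear_id \<delta> x])
  have "tensor_map K V' (tensor K A B) id \<delta> (tensor_map K V' X f id x) =
      tensor_map K V' (tensor K A B) (\<lambda>a. id (f a)) (\<lambda>b. \<delta> (id b)) x"
    by (rule tensor_map_comp[OF V X V' X V' AB f linear_id linear_id \<delta> x])
  \<comment> \<open>The identity after \<delta> is replaced by a tensor product of identities, the
    shape in which naturality of the inverse associator applies.\<close>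
  also have "\<dots> = tensor_map K V' (tensor K A B) (\<lambda>a. f (id a)) (\<lambda>b. tensor_map K A B id id (\<delta> b)) x"
    by (rule tensor_map_cong[OF V X V' AB linear_comp[OF f linear_id] linear_comp[OF linear_id \<delta>] _ _ x])
       (simp_all add: tensor_map_id[OF A B] linear_closed[OF \<delta>])
  also have "\<dots> = tensor_map K V' (tensor K A B) f (tensor_map K A B id id) ?y"
    by (rule tensor_map_comp[symmetric, OF V X V AB V' AB linear_id \<delta> f
          tensor_map_linear[OF A B A B linear_id linear_id] x])
  finally show ?thesis
    unfolding cofree_def by (simp add: tensor_assoc_inv_natural[OF V A B V' A B f linear_id linear_id y])
qed

text \<open>The maps \<delta>1, \<delta>2, \<delta>3, \<delta>4 stand for the comultiplications
  indexed by (\<alpha>\<beta>, \<gamma>), (\<alpha>, \<beta>), (\<alpha>, \<beta>\<gamma>) and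
  (\<beta>, \<gamma>). On a pure tensor of \<open>v\<close> and \<open>h\<close>, both sides are the
  coassociativity equation at \<open>h\<close> with \<open>v\<close> tensored onto the leftmost
  factor.\<close>

lemma cofree_coassoc:
  assumes V: "module K V" and X: "module K X" and Y: "module K Y" and Z: "module K Z"
    and A: "module K A" and B: "module K B" and C: "module K C"
    and \<delta>1: "\<delta>1 \<in> linear_maps K X (tensor K Y C)" and \<delta>2: "\<delta>2 \<in> linear_maps K Y (tensor K A B)"
    and \<delta>3: "\<delta>3 \<in> linear_maps K X (tensor K A Z)" and \<delta>4: "\<delta>4 \<in> linear_maps K Z (tensor K B C)"
    and coassoc: "\<And>h. h \<in> carrier X \<Longrightarrow>
      tensor_assoc K A B C (tensor_map K (tensor K A B) C \<delta>2 id (\<delta>1 h)) =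
      tensor_map K A (tensor K B C) id \<delta>4 (\<delta>3 h)"
    and x: "x \<in> carrier (tensor K V X)"
  shows "tensor_assoc K (tensor K V A) B C
      (tensor_map K (tensor K (tensor K V A) B) C (cofree K V A B \<delta>2) id (cofree K V Y C \<delta>1 x)) =
    tensor_map K (tensor K V A) (tensor K B C) id \<delta>4 (cofree K V A Z \<delta>3 x)"
proof -
  note VA = module_tensor[OF V A] and VY = module_tensor[OF V Y] and AB = module_tensor[OF A B]
    and BC = module_tensor[OF B C]
  note VAB = module_tensor[OF VA B] and VABC = module_tensor[OF VA BC]
  note c2 = cofree_linear[OF V Y A B \<delta>2]
  note l = linear_comp[OF linear_comp[OF cofree_linear[OF V X Y C \<delta>1]
        tensor_map_linear[OF VY C VAB C c2 linear_id]] tensor_assoc_linear[OF VA B C]]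
  note r = linear_comp[OF cofree_linear[OF V X A Z \<delta>3] tensor_map_linear[OF VA Z VA BC linear_id \<delta>4]]
  show ?thesis
  proof (rule tensor_ext[OF V X VABC l r _ x])
    fix v h assume v: "v \<in> carrier V" and h: "h \<in> carrier X"
    let ?p = "\<lambda>A. pure_tensor K V A v"
    note pA = pure_right_linear[OF V A v] and pY = pure_right_linear[OF V Y v]
    note d1 = linear_closed[OF \<delta>1 h] and d3 = linear_closed[OF \<delta>3 h]
    note pAB = tensor_map_linear[OF A B VA B pA linear_id]
    note d2id = tensor_map_linear[OF Y C AB C \<delta>2 linear_id]
    have "tensor_map K (tensor K (tensor K V A) B) C (cofree K V A B \<delta>2) id
        (cofree K V Y C \<delta>1 (pure_tensor K V X v h)) =
        tensor_map K (tensor K (tensor K V A) B) C (\<lambda>y. cofree K V A B \<delta>2 (?p Y y)) (\<lambda>c. id (id c)) (\<delta>1 h)"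
      unfolding cofree_pure[OF V X Y C \<delta>1 v h]
      by (rule tensor_map_comp[OF Y C VY C VAB C pY linear_id c2 linear_id d1])
    also have "\<dots> = tensor_map K (tensor K (tensor K V A) B) C
        (\<lambda>y. tensor_map K (tensor K V A) B (?p A) id (\<delta>2 y)) (\<lambda>c. id (id c)) (\<delta>1 h)"
      by (rule tensor_map_cong[OF Y C VAB C linear_comp[OF pY c2] linear_comp[OF linear_id linear_id] _ _ d1])
         (simp_all add: cofree_pure[OF V Y A B \<delta>2 v])
    also have "\<dots> = tensor_map K (tensor K (tensor K V A) B) C (tensor_map K (tensor K V A) B (?p A) id) id
        (tensor_map K (tensor K A B) C \<delta>2 id (\<delta>1 h))"
      by (rule tensor_map_comp[symmetric, OF Y C AB C VAB C \<delta>2 linear_id pAB linear_id d1])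
    finally have "tensor_assoc K (tensor K V A) B C
        (tensor_map K (tensor K (tensor K V A) B) C (cofree K V A B \<delta>2) id
          (cofree K V Y C \<delta>1 (pure_tensor K V X v h))) =
        tensor_map K (tensor K V A) (tensor K B C) (?p A) (tensor_map K B C id id)
          (tensor_assoc K A B C (tensor_map K (tensor K A B) C \<delta>2 id (\<delta>1 h)))"
      using tensor_assoc_natural[OF A B C VA B C pA linear_id linear_id linear_closed[OF d2id d1]]
      by simp
    also have "\<dots> = tensor_map K (tensor K V A) (tensor K B C) (?p A) (tensor_map K B C id id)
          (tensor_map K A (tensor K B C) id \<delta>4 (\<delta>3 h))"
      by (simp only: coassoc[OF h])
    also have "\<dots> = tensor_map K (tensor K V A) (tensor K B C) (\<lambda>a. ?p A (id a)) (\<lambda>z. tensor_map K B C id id (\<delta>4 z)) (\<delta>3 h)"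
      by (rule tensor_map_comp[OF A Z A BC VA BC linear_id \<delta>4 pA tensor_map_linear[OF B C B C linear_id linear_id] d3])
    also have "\<dots> = tensor_map K (tensor K V A) (tensor K B C) (\<lambda>a. id (?p A a)) (\<lambda>z. \<delta>4 (id z)) (\<delta>3 h)"
      by (rule tensor_map_cong[OF A Z VA BC linear_comp[OF linear_id pA]
            linear_comp[OF \<delta>4 tensor_map_linear[OF B C B C linear_id linear_id]] _ _ d3])
         (simp_all add: tensor_map_id[OF B C] linear_closed[OF \<delta>4])
    also have "\<dots> = tensor_map K (tensor K V A) (tensor K B C) id \<delta>4 (cofree K V A Z \<delta>3 (pure_tensor K V X v h))"
      unfolding cofree_pure[OF V X A Z \<delta>3 v h]
      by (rule tensor_map_comp[symmetric, OF A Z VA Z VA BC pA linear_id linear_id \<delta>4 d3])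
    finally show "tensor_assoc K (tensor K V A) B C
        (tensor_map K (tensor K (tensor K V A) B) C (cofree K V A B \<delta>2) id
          (cofree K V Y C \<delta>1 (pure_tensor K V X v h))) =
      tensor_map K (tensor K V A) (tensor K B C) id \<delta>4 (cofree K V A Z \<delta>3 (pure_tensor K V X v h))" .
  qed
qed

text \<open>On a pure tensor of \<open>v\<close> and \<open>h\<close>, naturality of the right unit
  along tensoring with \<open>v\<close> reduces the claim to the counit equation at
  \<open>h\<close>.\<close>

lemma cofree_counit:
  assumes V: "module K V" and A: "module K A" and U: "module K U"
    and \<delta>: "\<delta> \<in> linear_maps K A (tensor K A U)" and \<epsilon>: "\<epsilon> \<in> linear_maps K U (base_module K)"
    and counit: "\<And>h. h \<in> carrier A \<Longrightarrow>
      tensor_unit_right K A (tensor_map K A (base_module K) id \<epsilon> (\<delta> h)) = h"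
    and x: "x \<in> carrier (tensor K V A)"
  shows "tensor_unit_right K (tensor K V A)
    (tensor_map K (tensor K V A) (base_module K) id \<epsilon> (cofree K V A U \<delta> x)) = x"
proof -
  note VA = module_tensor[OF V A] and E = module_base_module[OF module_cring[OF V]]
  note l = linear_comp[OF linear_comp[OF cofree_linear[OF V A A U \<delta>]
        tensor_map_linear[OF VA U VA E linear_id \<epsilon>]] tensor_unit_right_linear[OF VA]]
  have "tensor_unit_right K (tensor K V A)
    (tensor_map K (tensor K V A) (base_module K) id \<epsilon> (cofree K V A U \<delta> x)) = id x"
  proof (rule tensor_ext[OF V A VA l linear_id _ x])
    fix v h assume v: "v \<in> carrier V" and h: "h \<in> carrier A"
    let ?p = "pure_tensor K V A v"
    note p = pure_right_linear[OF V A v] and d = linear_closed[OF \<delta> h]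
    have "tensor_map K (tensor K V A) (base_module K) id \<epsilon> (cofree K V A U \<delta> (pure_tensor K V A v h)) =
        tensor_map K (tensor K V A) (base_module K) (\<lambda>a. id (?p a)) (\<lambda>u. \<epsilon> (id u)) (\<delta> h)"
      unfolding cofree_pure[OF V A A U \<delta> v h]
      by (rule tensor_map_comp[OF A U VA U VA E p linear_id linear_id \<epsilon> d])
    also have "\<dots> = tensor_map K (tensor K V A) (base_module K) (\<lambda>a. ?p (id a)) (\<lambda>u. id (\<epsilon> u)) (\<delta> h)"
      by (simp add: id_def)
    also have "\<dots> = tensor_map K (tensor K V A) (base_module K) ?p id (tensor_map K A (base_module K) id \<epsilon> (\<delta> h))"
      by (rule tensor_map_comp[symmetric, OF A U A E VA E linear_id \<epsilon> p linear_id d])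
    finally show "tensor_unit_right K (tensor K V A)
        (tensor_map K (tensor K V A) (base_module K) id \<epsilon> (cofree K V A U \<delta> (pure_tensor K V A v h))) =
        id (pure_tensor K V A v h)"
      using tensor_unit_right_natural[OF A VA p tensor_map_closed[OF A U A E linear_id \<epsilon> d]] counit[OF h]
      by simp
  qed
  then show ?thesis by simp
qed

section \<open>The regrouped map and left coactions\<close>

lemma tensor_assoc_push:
  assumes V: "module K V" and A: "module K A" and B: "module K B"
    and v: "v \<in> carrier V" and y: "y \<in> carrier (tensor K A B)"
  shows "tensor_assoc K V A B (tensor_map K (tensor K V A) B (pure_tensor K V A v) id y) =
    pure_tensor K V (tensor K A B) v y"
  \<comment> \<open>The formula for the inverse associator holds for every \<open>y\<close>;
    applying the associator to it cancels, which avoids a decomposition of \<open>y\<close>.\<close>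
  using tensor_assoc_inverse[OF V A B pure_closed[OF V module_tensor[OF A B] v y]]
    tensor_assoc_inv_pure[OF V A B v y] by simp

text \<open>In the application \<kappa>X and \<kappa>A are comultiplications with left index 1, so
  that following them by \<sigma> gives the maps \<open>L\<close>. Coassociativity moves \<kappa>
  past \<delta>, and naturality of \<open>cofree\<close> moves \<sigma>.\<close>

lemma cofree_left_coaction:
  assumes U: "module K U" and C: "module K C" and X: "module K X" and A: "module K A" and B: "module K B"
    and \<delta>: "\<delta> \<in> linear_maps K X (tensor K A B)"
    and \<kappa>X: "\<kappa>X \<in> linear_maps K X (tensor K U X)" and \<kappa>A: "\<kappa>A \<in> linear_maps K A (tensor K U A)"
    and \<sigma>: "\<sigma> \<in> linear_maps K U C"
    and coassoc: "\<And>h. h \<in> carrier X \<Longrightarrow>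
      tensor_assoc K U A B (tensor_map K (tensor K U A) B \<kappa>A id (\<delta> h)) =
      tensor_map K U (tensor K A B) id \<delta> (\<kappa>X h)"
    and h: "h \<in> carrier X"
  shows "cofree K C A B \<delta> (tensor_map K C X \<sigma> id (\<kappa>X h)) =
    tensor_map K (tensor K C A) B (\<lambda>a. tensor_map K C A \<sigma> id (\<kappa>A a)) id (\<delta> h)"
proof -
  note UA = module_tensor[OF U A] and CA = module_tensor[OF C A]
  note lh = linear_closed[OF \<kappa>X h] and dh = linear_closed[OF \<delta> h]
  note \<sigma>A = tensor_map_linear[OF U A C A \<sigma> linear_id]
  \<comment> \<open>Coassociativity is read from right to left, which exposes an associator for the
    inverse one in \<open>cofree\<close> to cancel.\<close>
  have "cofree K U A B \<delta> (\<kappa>X h) = tensor_map K (tensor K U A) B \<kappa>A id (\<delta> h)"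
    unfolding cofree_def coassoc[OF h, symmetric]
    by (rule tensor_assoc_inv_inverse[OF U A B tensor_map_closed[OF A B UA B \<kappa>A linear_id dh]])
  then have "cofree K C A B \<delta> (tensor_map K C X \<sigma> id (\<kappa>X h)) =
      tensor_map K (tensor K C A) B (tensor_map K C A \<sigma> id) id
        (tensor_map K (tensor K U A) B \<kappa>A id (\<delta> h))"
    using cofree_natural[OF U C X A B \<delta> \<sigma> lh] by simp
  also have "\<dots> = tensor_map K (tensor K C A) B (\<lambda>a. tensor_map K C A \<sigma> id (\<kappa>A a)) (\<lambda>b. id (id b)) (\<delta> h)"
    by (rule tensor_map_comp[OF A B UA B CA B \<kappa>A linear_id \<sigma>A linear_id dh])
  finally show ?thesis by (simp add: id_def)
qed

text \<open>Both composites factor through one map: undo the associator, apply \<open>cofree\<close>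
  for \<open>tensor K V C\<close>, and redo the associator on the left factor. The hypothesis
  \<open>eq\<close> says that this map receives the same input on both sides.\<close>

lemma cofree_equalizes:
  assumes V: "module K V" and C: "module K C" and X: "module K X" and A: "module K A" and B: "module K B"
    and \<delta>: "\<delta> \<in> linear_maps K X (tensor K A B)"
    and LX: "LX \<in> linear_maps K X (tensor K C X)" and LA: "LA \<in> linear_maps K A (tensor K C A)"
    and \<rho>: "\<rho> \<in> linear_maps K V (tensor K V C)"
    and comm: "\<And>h. h \<in> carrier X \<Longrightarrow>
      cofree K C A B \<delta> (LX h) = tensor_map K (tensor K C A) B LA id (\<delta> h)"
    and x: "x \<in> carrier (tensor K V X)"
    and eq: "tensor_map K V (tensor K C X) id LX x =
      tensor_assoc K V C X (tensor_map K (tensor K V C) X \<rho> id x)"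
  shows "tensor_map K (tensor K V (tensor K C A)) B (tensor_map K V (tensor K C A) id LA) id (cofree K V A B \<delta> x) =
    tensor_map K (tensor K V (tensor K C A)) B
      (\<lambda>y. tensor_assoc K V C A (tensor_map K (tensor K V C) A \<rho> id y)) id (cofree K V A B \<delta> x)"
proof -
  note VC = module_tensor[OF V C] and CX = module_tensor[OF C X] and CA = module_tensor[OF C A]
    and VA = module_tensor[OF V A] and VX = module_tensor[OF V X]
  note VCA = module_tensor[OF V CA] and VC_A = module_tensor[OF VC A]
  note VCAB = module_tensor[OF VCA B]
  note as = tensor_assoc_linear[OF V C A]
  note cV = cofree_linear[OF V X A B \<delta>] and cVC = cofree_linear[OF VC X A B \<delta>]
    and cC = cofree_linear[OF C X A B \<delta>]
  note LAV = tensor_map_linear[OF V A V CA linear_id LA]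
  note LXV = tensor_map_linear[OF V X V CX linear_id LX]
  note \<rho>A = tensor_map_linear[OF V A VC A \<rho> linear_id]
  note asB = tensor_map_linear[OF VC_A B VCA B as linear_id]
  \<comment> \<open>The factorization for the side of \<open>LA\<close>, tested on pure tensors so
    that \<open>comm\<close> can be used at a single \<open>h\<close>.\<close>
  have left: "tensor_map K (tensor K V (tensor K C A)) B (tensor_map K V (tensor K C A) id LA) id
      (cofree K V A B \<delta> x) =
    tensor_map K (tensor K V (tensor K C A)) B (tensor_assoc K V C A) id
      (cofree K (tensor K V C) A B \<delta> (tensor_assoc_inv K V C X (tensor_map K V (tensor K C X) id LX x)))"
  proof (rule tensor_ext[OF V X VCAB _ _ _ x])
    show "(\<lambda>x. tensor_map K (tensor K V (tensor K C A)) B (tensor_map K V (tensor K C A) id LA) id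
        (cofree K V A B \<delta> x)) \<in> linear_maps K (tensor K V X) (tensor K (tensor K V (tensor K C A)) B)"
      by (rule linear_comp[OF cV tensor_map_linear[OF VA B VCA B LAV linear_id]])
    show "(\<lambda>x. tensor_map K (tensor K V (tensor K C A)) B (tensor_assoc K V C A) id
      (cofree K (tensor K V C) A B \<delta> (tensor_assoc_inv K V C X (tensor_map K V (tensor K C X) id LX x))))
        \<in> linear_maps K (tensor K V X) (tensor K (tensor K V (tensor K C A)) B)"
      by (rule linear_comp[OF linear_comp[OF linear_comp[OF LXV tensor_assoc_inv_linear[OF V C X]] cVC] asB])
    fix v h assume v: "v \<in> carrier V" and h: "h \<in> carrier X"
    note dh = linear_closed[OF \<delta> h] and lh = linear_closed[OF LX h]
    note pA = pure_right_linear[OF V A v] and pCA = pure_right_linear[OF V CA v]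
      and pC = pure_right_linear[OF V C v]
    note pCidA = tensor_map_linear[OF C A VC A pC linear_id]
    have "tensor_map K (tensor K V (tensor K C A)) B (tensor_map K V (tensor K C A) id LA) id
        (cofree K V A B \<delta> (pure_tensor K V X v h)) =
      tensor_map K (tensor K V (tensor K C A)) B
        (\<lambda>a. tensor_map K V (tensor K C A) id LA (pure_tensor K V A v a)) (\<lambda>b. id (id b)) (\<delta> h)"
      unfolding cofree_pure[OF V X A B \<delta> v h]
      by (rule tensor_map_comp[OF A B VA B VCA B pA linear_id LAV linear_id dh])
    also have "\<dots> = tensor_map K (tensor K V (tensor K C A)) B
        (\<lambda>a. pure_tensor K V (tensor K C A) v (LA a)) (\<lambda>b. id (id b)) (\<delta> h)"
      by (rule tensor_map_cong[OF A B VCA B linear_comp[OF pA LAV] linear_comp[OF linear_id linear_id] _ _ dh])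
         (simp_all add: tensor_map_pure[OF V A V CA linear_id LA v])
    also have "\<dots> = tensor_map K (tensor K V (tensor K C A)) B (pure_tensor K V (tensor K C A) v) id
        (tensor_map K (tensor K C A) B LA id (\<delta> h))"
      by (rule tensor_map_comp[symmetric, OF A B CA B VCA B LA linear_id pCA linear_id dh])
    also have "\<dots> = tensor_map K (tensor K V (tensor K C A)) B (pure_tensor K V (tensor K C A) v) id
        (cofree K C A B \<delta> (LX h))"
      by (simp only: comm[OF h])
    \<comment> \<open>By \<open>tensor_assoc_push\<close>, tensoring with \<open>v\<close> is split
      into tensoring onto the factor \<open>C\<close> followed by the associator; the first part is
      a map to which naturality of \<open>cofree\<close> applies.\<close>
    also have "\<dots> = tensor_map K (tensor K V (tensor K C A)) B
        (\<lambda>y. tensor_assoc K V C A (tensor_map K (tensor K V C) A (pure_tensor K V C v) id y)) (\<lambda>b. id (id b))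
        (cofree K C A B \<delta> (LX h))"
      by (rule tensor_map_cong[OF CA B VCA B pCA linear_id _ _ linear_closed[OF cC lh]])
         (simp_all add: tensor_assoc_push[OF V C A v])
    also have "\<dots> = tensor_map K (tensor K V (tensor K C A)) B (tensor_assoc K V C A) id
        (tensor_map K (tensor K (tensor K V C) A) B (tensor_map K (tensor K V C) A (pure_tensor K V C v) id) id
          (cofree K C A B \<delta> (LX h)))"
      by (rule tensor_map_comp[symmetric, OF CA B VC_A B VCA B pCidA linear_id as linear_id linear_closed[OF cC lh]])
    also have "\<dots> = tensor_map K (tensor K V (tensor K C A)) B (tensor_assoc K V C A) id
        (cofree K (tensor K V C) A B \<delta> (tensor_map K (tensor K V C) X (pure_tensor K V C v) id (LX h)))"
      by (simp only: cofree_natural[OF C VC X A B \<delta> pC lh])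
    also have "tensor_map K (tensor K V C) X (pure_tensor K V C v) id (LX h) =
        tensor_assoc_inv K V C X (tensor_map K V (tensor K C X) id LX (pure_tensor K V X v h))"
      using tensor_map_pure[OF V X V CX linear_id LX v h] tensor_assoc_inv_pure[OF V C X v lh] by simp
    finally show "tensor_map K (tensor K V (tensor K C A)) B (tensor_map K V (tensor K C A) id LA) id
        (cofree K V A B \<delta> (pure_tensor K V X v h)) =
      tensor_map K (tensor K V (tensor K C A)) B (tensor_assoc K V C A) id
        (cofree K (tensor K V C) A B \<delta>
          (tensor_assoc_inv K V C X (tensor_map K V (tensor K C X) id LX (pure_tensor K V X v h))))" .
  qed
  \<comment> \<open>Now \<open>eq\<close> exchanges the input for the one given by \<rho>, whose
    associator cancels; naturality along \<rho> then yields the other side.\<close>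
  have "tensor_assoc_inv K V C X (tensor_map K V (tensor K C X) id LX x) = tensor_map K (tensor K V C) X \<rho> id x"
    unfolding eq by (rule tensor_assoc_inv_inverse[OF V C X tensor_map_closed[OF V X VC X \<rho> linear_id x]])
  then have "cofree K (tensor K V C) A B \<delta>
      (tensor_assoc_inv K V C X (tensor_map K V (tensor K C X) id LX x)) =
    tensor_map K (tensor K (tensor K V C) A) B (tensor_map K (tensor K V C) A \<rho> id) id (cofree K V A B \<delta> x)"
    by (simp only: cofree_natural[OF V VC X A B \<delta> \<rho> x])
  then show ?thesis
    unfolding left
    using tensor_map_comp[OF VA B VC_A B VCA B \<rho>A linear_id as linear_id linear_closed[OF cV x]]
    by (simp add: id_def)
qed

section \<open>The induced comodule\<close>

text \<open>Meant for \<theta>, which is an inverse image and has no formula from which linearity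
  could be read: its composite with an injection is a known linear map.\<close>

lemma linear_by_injection:
  assumes M: "module K M" and N: "module K N" and i: "i \<in> linear_maps K N P"
    and inj: "inj_on i (carrier N)" and closed: "\<And>x. x \<in> carrier M \<Longrightarrow> f x \<in> carrier N"
    and g: "g \<in> linear_maps K M P" and if_g: "\<And>x. x \<in> carrier M \<Longrightarrow> i (f x) = g x"
  shows "f \<in> linear_maps K M N"
proof (rule linear_mapsI)
  interpret M: module K M by fact
  interpret N: module K N by fact
  fix x assume x: "x \<in> carrier M"
  show "f x \<in> carrier N" using closed[OF x] .
  show "f (x \<oplus>\<^bsub>M\<^esub> y) = f x \<oplus>\<^bsub>N\<^esub> f y" if y: "y \<in> carrier M" for y
    by (rule inj_onD[OF inj])
       (simp_all add: closed x y if_g linear_add[OF i] linear_add[OF g])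
  show "f (k \<odot>\<^bsub>M\<^esub> x) = k \<odot>\<^bsub>N\<^esub> f x" if k: "k \<in> carrier K" for k
    by (rule inj_onD[OF inj])
       (simp_all add: closed x k if_g linear_smult[OF i] linear_smult[OF g])
qed

section \<open>Setting, and linearity of the defining maps\<close>

locale coisotropic_comodule =
  left_coisotropic_subgroup K \<pi> H \<Delta>H \<epsilon>H S C \<Delta>C \<epsilon>C \<omega> \<sigma> +
  V: right_pi_comodule K \<pi> C \<Delta>C \<epsilon>C V \<rho>
  for K :: "('k, 'm) ring_scheme"
    and \<pi> :: "('g, 'n) monoid_scheme"
    and H :: "'g \<Rightarrow> ('k, 'h) module"
    and \<Delta>H :: "'g \<Rightarrow> 'g \<Rightarrow> 'h \<Rightarrow> ('h \<times> 'h \<Rightarrow> 'k) set"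
    and \<epsilon>H :: "'h \<Rightarrow> 'k"
    and S :: "'g \<Rightarrow> 'h \<Rightarrow> 'h"
    and C :: "'g \<Rightarrow> ('k, 'c) module"
    and \<Delta>C :: "'g \<Rightarrow> 'g \<Rightarrow> 'c \<Rightarrow> ('c \<times> 'c \<Rightarrow> 'k) set"
    and \<epsilon>C :: "'c \<Rightarrow> 'k"
    and \<omega> :: "'g \<Rightarrow> ('h \<times> 'c \<Rightarrow> 'k) set \<Rightarrow> 'c"
    and \<sigma> :: "'g \<Rightarrow> 'h \<Rightarrow> 'c"
    and V :: "'g \<Rightarrow> ('k, 'v) module"
    and \<rho> :: "'g \<Rightarrow> 'g \<Rightarrow> 'v \<Rightarrow> ('v \<times> 'c \<Rightarrow> 'k) set"
begin

sublocale P: group \<pi> by (rule H.group_pi)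

abbreviation "V1 \<equiv> V \<one>\<^bsub>\<pi>\<^esub>"
abbreviation "C1 \<equiv> C \<one>\<^bsub>\<pi>\<^esub>"
abbreviation "T \<alpha> \<equiv> tensor K V1 (H \<alpha>)"
abbreviation "L \<equiv> ind_L K \<pi> H \<Delta>H C \<sigma>"
abbreviation "lhs \<alpha> \<equiv> tensor_map K V1 (tensor K C1 (H \<alpha>)) id (L \<alpha>)"
abbreviation "rhs \<alpha> \<equiv> (\<lambda>x. tensor_assoc K V1 C1 (H \<alpha>)
  (tensor_map K (tensor K V1 C1) (H \<alpha>) (\<rho> \<one>\<^bsub>\<pi>\<^esub> \<one>\<^bsub>\<pi>\<^esub>) id x))"
abbreviation "I \<equiv> Ind K \<pi> H \<Delta>H C \<sigma> V \<rho>"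
abbreviation "W \<alpha> \<equiv> {x \<in> carrier (T \<alpha>). lhs \<alpha> x = rhs \<alpha> x}"
text \<open>\<open>co\<close> and \<iota> are \<open>D\<close> and \<open>j\<close> before the
  associator: they take values in \<open>tensor K (T \<alpha>) (H \<beta>)\<close>, where the
  exactness results apply directly.\<close>

abbreviation "co \<alpha> \<beta> \<equiv> cofree K V1 (H \<alpha>) (H \<beta>) (\<Delta>H \<alpha> \<beta>)"
abbreviation "\<iota> \<alpha> \<beta> \<equiv> tensor_map K (T \<alpha>) (H \<beta>) id id"
abbreviation "D \<alpha> \<beta> \<equiv> tensor_map K V1 (tensor K (H \<alpha>) (H \<beta>)) id (\<Delta>H \<alpha> \<beta>)"
abbreviation "j \<alpha> \<beta> \<equiv> subtensor_embed K V1 (H \<alpha>) (H \<beta>)"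
abbreviation "\<theta> \<alpha> \<beta> x \<equiv> the_inv_into (carrier (tensor K (I \<alpha>) (H \<beta>))) (j \<alpha> \<beta>) (D \<alpha> \<beta> x)"

text \<open>Puts \<open>Ind\<close> in the form of a carrier update that the results on subspaces
  and equalizers expect.\<close>

lemma Ind_eq: "I \<alpha> = T \<alpha>\<lparr>carrier := W \<alpha>\<rparr>"
  by (simp add: Ind_def Let_def)

lemma V1: "module K V1" and C1: "module K C1"
  by (simp_all add: V.module_M C.module_C)

lemma T: "\<alpha> \<in> carrier \<pi> \<Longrightarrow> module K (T \<alpha>)"
  by (intro module_tensor V1 H.module_C)

lemma \<rho>_linear: "\<rho> \<one>\<^bsub>\<pi>\<^esub> \<one>\<^bsub>\<pi>\<^esub> \<in> linear_maps K V1 (tensor K V1 C1)"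
  using V.coaction_linear[of "\<one>\<^bsub>\<pi>\<^esub>" "\<one>\<^bsub>\<pi>\<^esub>"] by simp

lemma left_comult_linear:
  "\<alpha> \<in> carrier \<pi> \<Longrightarrow> \<Delta>H \<one>\<^bsub>\<pi>\<^esub> \<alpha> \<in> linear_maps K (H \<alpha>) (tensor K (H \<one>\<^bsub>\<pi>\<^esub>) (H \<alpha>))"
  using H.comult_linear[of "\<one>\<^bsub>\<pi>\<^esub>" \<alpha>] by simp

lemma L_linear:
  assumes "\<alpha> \<in> carrier \<pi>"
  shows "L \<alpha> \<in> linear_maps K (H \<alpha>) (tensor K C1 (H \<alpha>))"
proof -
  have "(\<lambda>h. L \<alpha> h) \<in> linear_maps K (H \<alpha>) (tensor K C1 (H \<alpha>))"
    unfolding ind_L_def using assms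
    by (intro linear_comp[OF left_comult_linear tensor_map_linear] H.module_C C1 sigma_linear linear_id) simp_all
  then show ?thesis .
qed

lemma sides_linear:
  assumes "\<alpha> \<in> carrier \<pi>"
  shows "lhs \<alpha> \<in> linear_maps K (T \<alpha>) (tensor K V1 (tensor K C1 (H \<alpha>)))"
    and "rhs \<alpha> \<in> linear_maps K (T \<alpha>) (tensor K V1 (tensor K C1 (H \<alpha>)))"
proof -
  note A = H.module_C[OF assms]
  show "lhs \<alpha> \<in> linear_maps K (T \<alpha>) (tensor K V1 (tensor K C1 (H \<alpha>)))"
    by (rule tensor_map_linear[OF V1 A V1 module_tensor[OF C1 A] linear_id L_linear[OF assms]])
  show "rhs \<alpha> \<in> linear_maps K (T \<alpha>) (tensor K V1 (tensor K C1 (H \<alpha>)))"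
    by (rule linear_comp[OF tensor_map_linear[OF V1 A module_tensor[OF V1 C1] A \<rho>_linear linear_id]
          tensor_assoc_linear[OF V1 C1 A]])
qed

lemma W_submodule:
  assumes "\<alpha> \<in> carrier \<pi>"
  shows "submodule (W \<alpha>) K (T \<alpha>)"
  by (rule submodule_equalizer[OF T[OF assms] _ sides_linear[OF assms]])
     (intro module_tensor V1 C1 H.module_C assms)

lemma I: "\<alpha> \<in> carrier \<pi> \<Longrightarrow> module K (I \<alpha>)"
  unfolding Ind_eq by (rule module_subspace[OF T W_submodule])

lemma I_inclusion: "id \<in> linear_maps K (I \<alpha>) (T \<alpha>)"
  unfolding Ind_eq by (rule linear_subspace_id) blast

lemma I_carrier: "x \<in> carrier (I \<alpha>) \<Longrightarrow> x \<in> carrier (T \<alpha>)"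
  by (simp add: Ind_eq)

lemma co_linear:
  assumes "\<alpha> \<in> carrier \<pi>" "\<beta> \<in> carrier \<pi>"
  shows "co \<alpha> \<beta> \<in> linear_maps K (T (\<alpha> \<otimes>\<^bsub>\<pi>\<^esub> \<beta>)) (tensor K (T \<alpha>) (H \<beta>))"
  using assms by (intro cofree_linear V1 H.module_C H.comult_linear P.m_closed)

lemma \<iota>_linear:
  assumes "\<alpha> \<in> carrier \<pi>" "\<beta> \<in> carrier \<pi>"
  shows "\<iota> \<alpha> \<beta> \<in> linear_maps K (tensor K (I \<alpha>) (H \<beta>)) (tensor K (T \<alpha>) (H \<beta>))"
  using assms by (intro tensor_map_linear I T H.module_C I_inclusion linear_id)

section \<open>The coaction takes values in the induced spaces\<close>

lemma inclusion_inj: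
  assumes "\<alpha> \<in> carrier \<pi>" "module K N"
  shows "inj_on (tensor_map K (T \<alpha>) N id id) (carrier (tensor K (I \<alpha>) N))"
  unfolding Ind_eq by (rule tensor_subspace_inj[OF H.field_K T[OF assms(1)] assms(2) W_submodule[OF assms(1)]])

lemma j_inj:
  assumes "\<alpha> \<in> carrier \<pi>" "\<beta> \<in> carrier \<pi>"
  shows "inj_on (j \<alpha> \<beta>) (carrier (tensor K (I \<alpha>) (H \<beta>)))"
proof (rule inj_onI)
  note B = H.module_C[OF assms(2)]
  fix x y assume x: "x \<in> carrier (tensor K (I \<alpha>) (H \<beta>))" and y: "y \<in> carrier (tensor K (I \<alpha>) (H \<beta>))"
    and "j \<alpha> \<beta> x = j \<alpha> \<beta> y"
  then have "tensor_assoc_inv K V1 (H \<alpha>) (H \<beta>) (tensor_assoc K V1 (H \<alpha>) (H \<beta>) (\<iota> \<alpha> \<beta> x)) =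
      tensor_assoc_inv K V1 (H \<alpha>) (H \<beta>) (tensor_assoc K V1 (H \<alpha>) (H \<beta>) (\<iota> \<alpha> \<beta> y))"
    by (simp add: subtensor_embed_def)
  then have "\<iota> \<alpha> \<beta> x = \<iota> \<alpha> \<beta> y"
    using linear_closed[OF \<iota>_linear[OF assms] x] linear_closed[OF \<iota>_linear[OF assms] y]
    by (simp add: tensor_assoc_inv_inverse[OF V1 H.module_C[OF assms(1)] B])
  then show "x = y" using inj_onD[OF inclusion_inj[OF assms(1) B] _ x y] by simp
qed

text \<open>\<open>cofree_equalizes\<close> shows that \<open>co\<close> maps into the equalizer of
  the two defining maps tensored with the identity, and \<open>tensor_equalizer_exact\<close>
  identifies that equalizer with the image of \<iota>.\<close>

lemma co_in_Ind:
  assumes \<alpha>: "\<alpha> \<in> carrier \<pi>" and \<beta>: "\<beta> \<in> carrier \<pi>" and x: "x \<in> carrier (I (\<alpha> \<otimes>\<^bsub>\<pi>\<^esub> \<beta>))"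
  shows "co \<alpha> \<beta> x \<in> \<iota> \<alpha> \<beta> ` carrier (tensor K (I \<alpha>) (H \<beta>))"
proof -
  note \<alpha>\<beta> = P.m_closed[OF \<alpha> \<beta>]
  note A = H.module_C[OF \<alpha>] and B = H.module_C[OF \<beta>] and X = H.module_C[OF \<alpha>\<beta>]
  note U = H.module_C[OF P.one_closed]
  note VCA = module_tensor[OF V1 module_tensor[OF C1 A]]
  have xT: "x \<in> carrier (T (\<alpha> \<otimes>\<^bsub>\<pi>\<^esub> \<beta>))" and xW: "lhs (\<alpha> \<otimes>\<^bsub>\<pi>\<^esub> \<beta>) x = rhs (\<alpha> \<otimes>\<^bsub>\<pi>\<^esub> \<beta>) x"
    using x by (simp_all add: Ind_eq)
  have L_eq: "L \<gamma> = (\<lambda>h. tensor_map K C1 (H \<gamma>) (\<sigma> \<one>\<^bsub>\<pi>\<^esub>) id (\<Delta>H \<one>\<^bsub>\<pi>\<^esub> \<gamma> h))" for \<gamma>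
    by (simp add: ind_L_def fun_eq_iff)
  \<comment> \<open>Coassociativity at the indices (1, \<alpha>, \<beta>), carried along \<sigma> at
    1.\<close>
  have comm: "cofree K C1 (H \<alpha>) (H \<beta>) (\<Delta>H \<alpha> \<beta>) (L (\<alpha> \<otimes>\<^bsub>\<pi>\<^esub> \<beta>) h) =
      tensor_map K (tensor K C1 (H \<alpha>)) (H \<beta>) (L \<alpha>) id (\<Delta>H \<alpha> \<beta> h)"
    if h: "h \<in> carrier (H (\<alpha> \<otimes>\<^bsub>\<pi>\<^esub> \<beta>))" for h
    unfolding L_eq
  proof (rule cofree_left_coaction[OF U C1 X A B H.comult_linear[OF \<alpha> \<beta>] left_comult_linear[OF \<alpha>\<beta>]
        left_comult_linear[OF \<alpha>] sigma_linear[OF P.one_closed] _ h])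
    fix h assume "h \<in> carrier (H (\<alpha> \<otimes>\<^bsub>\<pi>\<^esub> \<beta>))"
    then show "tensor_assoc K (H \<one>\<^bsub>\<pi>\<^esub>) (H \<alpha>) (H \<beta>)
        (tensor_map K (tensor K (H \<one>\<^bsub>\<pi>\<^esub>) (H \<alpha>)) (H \<beta>) (\<Delta>H \<one>\<^bsub>\<pi>\<^esub> \<alpha>) id (\<Delta>H \<alpha> \<beta> h)) =
      tensor_map K (H \<one>\<^bsub>\<pi>\<^esub>) (tensor K (H \<alpha>) (H \<beta>)) id (\<Delta>H \<alpha> \<beta>) (\<Delta>H \<one>\<^bsub>\<pi>\<^esub> (\<alpha> \<otimes>\<^bsub>\<pi>\<^esub> \<beta>) h)"
      using H.coassoc[OF P.one_closed \<alpha> \<beta>] \<alpha> \<beta> by simp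
  qed
  show ?thesis
    unfolding Ind_eq
    by (rule tensor_equalizer_exact[OF H.field_K T[OF \<alpha>] VCA B sides_linear[OF \<alpha>]
          linear_closed[OF co_linear[OF \<alpha> \<beta>] xT]])
       (rule cofree_equalizes[OF V1 C1 X A B H.comult_linear[OF \<alpha> \<beta>] L_linear[OF \<alpha>\<beta>] L_linear[OF \<alpha>]
          \<rho>_linear comm xT xW])
qed

lemma j_eq_D:
  assumes \<alpha>: "\<alpha> \<in> carrier \<pi>" and \<beta>: "\<beta> \<in> carrier \<pi>" and x: "x \<in> carrier (I (\<alpha> \<otimes>\<^bsub>\<pi>\<^esub> \<beta>))"
    and eq: "\<iota> \<alpha> \<beta> w = co \<alpha> \<beta> x"
  shows "j \<alpha> \<beta> w = D \<alpha> \<beta> x"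
proof -
  note A = H.module_C[OF \<alpha>] and B = H.module_C[OF \<beta>]
  have "D \<alpha> \<beta> x \<in> carrier (tensor K V1 (tensor K (H \<alpha>) (H \<beta>)))"
    using \<alpha> \<beta> I_carrier[OF x]
    by (intro tensor_map_closed[OF V1 H.module_C V1 module_tensor[OF A B] linear_id H.comult_linear]) simp_all
  then show ?thesis
    unfolding subtensor_embed_def eq cofree_def by (rule tensor_assoc_inverse[OF V1 A B])
qed

text \<open>A preimage of \<open>co \<alpha> \<beta> x\<close> under \<iota> is also one of
  \<open>D \<alpha> \<beta> x\<close> under \<open>j\<close>, and injectivity of \<open>j\<close>
  makes it the value of \<theta>. The comodule axioms below use the equation
  \<open>\<iota>_\<theta>\<close> in place of the inverse in the definition of \<theta>.\<close>

lemma \<theta>: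
  assumes \<alpha>: "\<alpha> \<in> carrier \<pi>" and \<beta>: "\<beta> \<in> carrier \<pi>" and x: "x \<in> carrier (I (\<alpha> \<otimes>\<^bsub>\<pi>\<^esub> \<beta>))"
  shows \<theta>_closed: "\<theta> \<alpha> \<beta> x \<in> carrier (tensor K (I \<alpha>) (H \<beta>))"
    and \<iota>_\<theta>: "\<iota> \<alpha> \<beta> (\<theta> \<alpha> \<beta> x) = co \<alpha> \<beta> x"
    and D_in_image: "D \<alpha> \<beta> x \<in> j \<alpha> \<beta> ` carrier (tensor K (I \<alpha>) (H \<beta>))"
proof -
  obtain w where w: "w \<in> carrier (tensor K (I \<alpha>) (H \<beta>))" "\<iota> \<alpha> \<beta> w = co \<alpha> \<beta> x"
    by (rule imageE[OF co_in_Ind[OF assms]]) (rule that, assumption, rule sym)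
  have "D \<alpha> \<beta> x = j \<alpha> \<beta> w" using j_eq_D[OF assms w(2)] by simp
  then have "\<theta> \<alpha> \<beta> x = w" by (simp add: the_inv_into_f_f[OF j_inj[OF \<alpha> \<beta>] w(1)])
  then show "\<theta> \<alpha> \<beta> x \<in> carrier (tensor K (I \<alpha>) (H \<beta>))" "\<iota> \<alpha> \<beta> (\<theta> \<alpha> \<beta> x) = co \<alpha> \<beta> x"
    using w by simp_all
  show "D \<alpha> \<beta> x \<in> j \<alpha> \<beta> ` carrier (tensor K (I \<alpha>) (H \<beta>))"
    using \<open>D \<alpha> \<beta> x = j \<alpha> \<beta> w\<close> w(1) by (rule image_eqI)
qed

section \<open>The comodule axioms\<close>

lemma \<theta>_linear:
  assumes \<alpha>: "\<alpha> \<in> carrier \<pi>" and \<beta>: "\<beta> \<in> carrier \<pi>"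
  shows "\<theta> \<alpha> \<beta> \<in> linear_maps K (I (\<alpha> \<otimes>\<^bsub>\<pi>\<^esub> \<beta>)) (tensor K (I \<alpha>) (H \<beta>))"
proof (rule linear_by_injection[OF I module_tensor[OF I] \<iota>_linear[OF assms] inclusion_inj \<theta>_closed[OF assms]
      linear_comp[OF I_inclusion co_linear[OF assms]]])
  show "\<iota> \<alpha> \<beta> (\<theta> \<alpha> \<beta> x) = co \<alpha> \<beta> (id x)" if "x \<in> carrier (I (\<alpha> \<otimes>\<^bsub>\<pi>\<^esub> \<beta>))" for x
    using \<iota>_\<theta>[OF assms that] by simp
qed (use assms H.module_C in simp_all)

text \<open>Both sides are compared after the injection \<open>?i\<close>. There
  \<open>\<iota>_\<theta>\<close> replaces each \<theta> by \<open>co\<close>, and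
  \<open>cofree_coassoc\<close> finishes.\<close>

lemma \<theta>_coassoc:
  assumes \<alpha>: "\<alpha> \<in> carrier \<pi>" and \<beta>: "\<beta> \<in> carrier \<pi>" and \<gamma>: "\<gamma> \<in> carrier \<pi>"
    and x: "x \<in> carrier (I (\<alpha> \<otimes>\<^bsub>\<pi>\<^esub> \<beta> \<otimes>\<^bsub>\<pi>\<^esub> \<gamma>))"
  shows "tensor_assoc K (I \<alpha>) (H \<beta>) (H \<gamma>)
      (tensor_map K (tensor K (I \<alpha>) (H \<beta>)) (H \<gamma>) (\<theta> \<alpha> \<beta>) id (\<theta> (\<alpha> \<otimes>\<^bsub>\<pi>\<^esub> \<beta>) \<gamma> x)) =
    tensor_map K (I \<alpha>) (tensor K (H \<beta>) (H \<gamma>)) id (\<Delta>H \<beta> \<gamma>) (\<theta> \<alpha> (\<beta> \<otimes>\<^bsub>\<pi>\<^esub> \<gamma>) x)"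
    (is "?l = ?r")
proof -
  note \<alpha>\<beta> = P.m_closed[OF \<alpha> \<beta>] and \<beta>\<gamma> = P.m_closed[OF \<beta> \<gamma>]
  note A = H.module_C[OF \<alpha>] and B = H.module_C[OF \<beta>] and C = H.module_C[OF \<gamma>]
    and Y = H.module_C[OF \<alpha>\<beta>] and Z = H.module_C[OF \<beta>\<gamma>]
    and X = H.module_C[OF P.m_closed[OF \<alpha>\<beta> \<gamma>]]
  note BC = module_tensor[OF B C] and IB = module_tensor[OF I[OF \<alpha>] B] and TB = module_tensor[OF T[OF \<alpha>] B]
  have x': "x \<in> carrier (I (\<alpha> \<otimes>\<^bsub>\<pi>\<^esub> (\<beta> \<otimes>\<^bsub>\<pi>\<^esub> \<gamma>)))"
    using x P.m_assoc[OF \<alpha> \<beta> \<gamma>] by simp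
  note \<theta>1 = \<theta>_closed[OF \<alpha>\<beta> \<gamma> x] and \<theta>2 = \<theta>_closed[OF \<alpha> \<beta>\<gamma> x']
  note \<theta>id = tensor_map_closed[OF I[OF \<alpha>\<beta>] C IB C \<theta>_linear[OF \<alpha> \<beta>] linear_id \<theta>1]
  note \<Delta>\<beta>\<gamma> = H.comult_linear[OF \<beta> \<gamma>]
  note l = linear_closed[OF tensor_assoc_linear[OF I[OF \<alpha>] B C] \<theta>id]
    and r = tensor_map_closed[OF I[OF \<alpha>] Z I[OF \<alpha>] BC linear_id \<Delta>\<beta>\<gamma> \<theta>2]
  \<comment> \<open>Associativity in \<pi> gives this comultiplication the same domain as the one
    indexed by (\<alpha>\<beta>, \<gamma>).\<close>
  have \<delta>3: "\<Delta>H \<alpha> (\<beta> \<otimes>\<^bsub>\<pi>\<^esub> \<gamma>) \<in> linear_maps K (H (\<alpha> \<otimes>\<^bsub>\<pi>\<^esub> \<beta> \<otimes>\<^bsub>\<pi>\<^esub> \<gamma>)) (tensor K (H \<alpha>) (H (\<beta> \<otimes>\<^bsub>\<pi>\<^esub> \<gamma>)))"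
    using H.comult_linear[OF \<alpha> \<beta>\<gamma>] P.m_assoc[OF \<alpha> \<beta> \<gamma>] by simp
  let ?i = "tensor_map K (T \<alpha>) (tensor K (H \<beta>) (H \<gamma>)) id id"
  \<comment> \<open>Splitting the identity on the last two factors lets the inclusion pass through
    the associator by naturality.\<close>
  have "?i ?l = tensor_map K (T \<alpha>) (tensor K (H \<beta>) (H \<gamma>)) id (tensor_map K (H \<beta>) (H \<gamma>) id id) ?l"
    by (rule tensor_map_cong[OF I[OF \<alpha>] BC T[OF \<alpha>] BC I_inclusion linear_id _ _ l])
       (simp_all add: tensor_map_id[OF B C])
  also have "\<dots> = tensor_assoc K (T \<alpha>) (H \<beta>) (H \<gamma>)
      (tensor_map K (tensor K (T \<alpha>) (H \<beta>)) (H \<gamma>) (\<iota> \<alpha> \<beta>) id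
        (tensor_map K (tensor K (I \<alpha>) (H \<beta>)) (H \<gamma>) (\<theta> \<alpha> \<beta>) id (\<theta> (\<alpha> \<otimes>\<^bsub>\<pi>\<^esub> \<beta>) \<gamma> x)))"
    by (rule tensor_assoc_natural[symmetric, OF I[OF \<alpha>] B C T[OF \<alpha>] B C I_inclusion linear_id linear_id \<theta>id])
  also have "tensor_map K (tensor K (T \<alpha>) (H \<beta>)) (H \<gamma>) (\<iota> \<alpha> \<beta>) id
        (tensor_map K (tensor K (I \<alpha>) (H \<beta>)) (H \<gamma>) (\<theta> \<alpha> \<beta>) id (\<theta> (\<alpha> \<otimes>\<^bsub>\<pi>\<^esub> \<beta>) \<gamma> x)) =
      tensor_map K (tensor K (T \<alpha>) (H \<beta>)) (H \<gamma>) (\<lambda>a. \<iota> \<alpha> \<beta> (\<theta> \<alpha> \<beta> a)) (\<lambda>b. id (id b)) (\<theta> (\<alpha> \<otimes>\<^bsub>\<pi>\<^esub> \<beta>) \<gamma> x)"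
    by (rule tensor_map_comp[OF I[OF \<alpha>\<beta>] C IB C TB C \<theta>_linear[OF \<alpha> \<beta>] linear_id \<iota>_linear[OF \<alpha> \<beta>] linear_id \<theta>1])
  also have "\<dots> = tensor_map K (tensor K (T \<alpha>) (H \<beta>)) (H \<gamma>) (\<lambda>a. co \<alpha> \<beta> (id a)) (\<lambda>b. id (id b)) (\<theta> (\<alpha> \<otimes>\<^bsub>\<pi>\<^esub> \<beta>) \<gamma> x)"
    by (rule tensor_map_cong[OF I[OF \<alpha>\<beta>] C TB C linear_comp[OF \<theta>_linear[OF \<alpha> \<beta>] \<iota>_linear[OF \<alpha> \<beta>]]
          linear_comp[OF linear_id linear_id] _ _ \<theta>1])
       (simp_all add: \<iota>_\<theta>[OF \<alpha> \<beta>])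
  also have "\<dots> = tensor_map K (tensor K (T \<alpha>) (H \<beta>)) (H \<gamma>) (co \<alpha> \<beta>) id (\<iota> (\<alpha> \<otimes>\<^bsub>\<pi>\<^esub> \<beta>) \<gamma> (\<theta> (\<alpha> \<otimes>\<^bsub>\<pi>\<^esub> \<beta>) \<gamma> x))"
    by (rule tensor_map_comp[symmetric, OF I[OF \<alpha>\<beta>] C T[OF \<alpha>\<beta>] C TB C I_inclusion linear_id co_linear[OF \<alpha> \<beta>] linear_id \<theta>1])
  also have "\<iota> (\<alpha> \<otimes>\<^bsub>\<pi>\<^esub> \<beta>) \<gamma> (\<theta> (\<alpha> \<otimes>\<^bsub>\<pi>\<^esub> \<beta>) \<gamma> x) = co (\<alpha> \<otimes>\<^bsub>\<pi>\<^esub> \<beta>) \<gamma> x"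
    by (rule \<iota>_\<theta>[OF \<alpha>\<beta> \<gamma> x])
  also have "tensor_assoc K (T \<alpha>) (H \<beta>) (H \<gamma>)
      (tensor_map K (tensor K (T \<alpha>) (H \<beta>)) (H \<gamma>) (co \<alpha> \<beta>) id (co (\<alpha> \<otimes>\<^bsub>\<pi>\<^esub> \<beta>) \<gamma> x)) =
      tensor_map K (T \<alpha>) (tensor K (H \<beta>) (H \<gamma>)) id (\<Delta>H \<beta> \<gamma>) (co \<alpha> (\<beta> \<otimes>\<^bsub>\<pi>\<^esub> \<gamma>) x)"
    by (rule cofree_coassoc[OF V1 X Y Z A B C H.comult_linear[OF \<alpha>\<beta> \<gamma>] H.comult_linear[OF \<alpha> \<beta>] \<delta>3
          \<Delta>\<beta>\<gamma> H.coassoc[OF \<alpha> \<beta> \<gamma>] I_carrier[OF x]])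
  also have "co \<alpha> (\<beta> \<otimes>\<^bsub>\<pi>\<^esub> \<gamma>) x = \<iota> \<alpha> (\<beta> \<otimes>\<^bsub>\<pi>\<^esub> \<gamma>) (\<theta> \<alpha> (\<beta> \<otimes>\<^bsub>\<pi>\<^esub> \<gamma>) x)"
    by (rule \<iota>_\<theta>[symmetric, OF \<alpha> \<beta>\<gamma> x'])
  also have "tensor_map K (T \<alpha>) (tensor K (H \<beta>) (H \<gamma>)) id (\<Delta>H \<beta> \<gamma>) \<dots> =
      tensor_map K (T \<alpha>) (tensor K (H \<beta>) (H \<gamma>)) (\<lambda>a. id (id a)) (\<lambda>b. \<Delta>H \<beta> \<gamma> (id b)) (\<theta> \<alpha> (\<beta> \<otimes>\<^bsub>\<pi>\<^esub> \<gamma>) x)"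
    by (rule tensor_map_comp[OF I[OF \<alpha>] Z T[OF \<alpha>] Z T[OF \<alpha>] BC I_inclusion linear_id linear_id \<Delta>\<beta>\<gamma> \<theta>2])
  also have "\<dots> = tensor_map K (T \<alpha>) (tensor K (H \<beta>) (H \<gamma>)) (\<lambda>a. id (id a)) (\<lambda>b. id (\<Delta>H \<beta> \<gamma> b)) (\<theta> \<alpha> (\<beta> \<otimes>\<^bsub>\<pi>\<^esub> \<gamma>) x)"
    by (simp add: id_def)
  also have "\<dots> = ?i ?r"
    by (rule tensor_map_comp[symmetric, OF I[OF \<alpha>] Z I[OF \<alpha>] BC T[OF \<alpha>] BC linear_id \<Delta>\<beta>\<gamma> I_inclusion linear_id \<theta>2])
  finally show ?thesis
    by (rule inj_onD[OF inclusion_inj[OF \<alpha> BC] _ l r])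
qed

text \<open>The right unit is natural along the inclusion into \<open>T \<alpha>\<close>. That
  inclusion is \<open>id\<close>, so the two unit maps give literally the same element, and
  \<open>cofree_counit\<close> evaluates it.\<close>

lemma \<theta>_counit:
  assumes \<alpha>: "\<alpha> \<in> carrier \<pi>" and x: "x \<in> carrier (I \<alpha>)"
  shows "tensor_unit_right K (I \<alpha>) (tensor_map K (I \<alpha>) (base_module K) id \<epsilon>H (\<theta> \<alpha> \<one>\<^bsub>\<pi>\<^esub> x)) = x"
proof -
  have x': "x \<in> carrier (I (\<alpha> \<otimes>\<^bsub>\<pi>\<^esub> \<one>\<^bsub>\<pi>\<^esub>))" using \<alpha> x by simp
  note A = H.module_C[OF \<alpha>] and U = H.module_C[OF P.one_closed] and E = module_base_module[OF module_cring[OF V1]]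
  note \<theta> = \<theta>_closed[OF \<alpha> P.one_closed x']
  have \<delta>: "\<Delta>H \<alpha> \<one>\<^bsub>\<pi>\<^esub> \<in> linear_maps K (H \<alpha>) (tensor K (H \<alpha>) (H \<one>\<^bsub>\<pi>\<^esub>))"
    using H.comult_linear[OF \<alpha> P.one_closed] \<alpha> by simp
  let ?y = "tensor_map K (I \<alpha>) (base_module K) id \<epsilon>H (\<theta> \<alpha> \<one>\<^bsub>\<pi>\<^esub> x)"
  have y: "?y \<in> carrier (tensor K (I \<alpha>) (base_module K))"
    by (rule tensor_map_closed[OF I[OF \<alpha>] U I[OF \<alpha>] E linear_id H.counit_linear \<theta>])
  have "tensor_map K (T \<alpha>) (base_module K) id id ?y =
      tensor_map K (T \<alpha>) (base_module K) (\<lambda>a. id (id a)) (\<lambda>b. id (\<epsilon>H b)) (\<theta> \<alpha> \<one>\<^bsub>\<pi>\<^esub> x)"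
    by (rule tensor_map_comp[OF I[OF \<alpha>] U I[OF \<alpha>] E T[OF \<alpha>] E linear_id H.counit_linear I_inclusion linear_id \<theta>])
  also have "\<dots> = tensor_map K (T \<alpha>) (base_module K) (\<lambda>a. id (id a)) (\<lambda>b. \<epsilon>H (id b)) (\<theta> \<alpha> \<one>\<^bsub>\<pi>\<^esub> x)"
    by (simp add: id_def)
  also have "\<dots> = tensor_map K (T \<alpha>) (base_module K) id \<epsilon>H (\<iota> \<alpha> \<one>\<^bsub>\<pi>\<^esub> (\<theta> \<alpha> \<one>\<^bsub>\<pi>\<^esub> x))"
    by (rule tensor_map_comp[symmetric, OF I[OF \<alpha>] U T[OF \<alpha>] U T[OF \<alpha>] E I_inclusion linear_id linear_id H.counit_linear \<theta>])
  finally have "tensor_map K (T \<alpha>) (base_module K) id id ?y =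
      tensor_map K (T \<alpha>) (base_module K) id \<epsilon>H (co \<alpha> \<one>\<^bsub>\<pi>\<^esub> x)"
    by (simp only: \<iota>_\<theta>[OF \<alpha> P.one_closed x'])
  then show ?thesis
    using tensor_unit_right_natural[OF I[OF \<alpha>] T[OF \<alpha>] I_inclusion y]
      cofree_counit[OF V1 A U \<delta> H.counit_linear H.counit_right[OF \<alpha>] I_carrier[OF x]]
    by simp
qed

lemma Ind_comodule: "right_pi_comodule K \<pi> H \<Delta>H \<epsilon>H I \<theta>"
  by (intro right_pi_comodule.intro right_pi_comodule_axioms.intro H.pi_coalgebra_axioms
      I \<theta>_linear \<theta>_coassoc \<theta>_counit)

end

text \<open>Elements of \<open>tensor K (I \<alpha>) (H \<beta>)\<close> are cosets in a free module
  of their own, so restricting the codomain of \<open>D\<close> means lifting it through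
  \<open>j\<close>. Injectivity of \<open>j\<close> and the image inclusion ensure that the inverse
  in the coaction is a genuine lift.\<close>

theorem theorem2p6:
  fixes K :: "('k, 'm) ring_scheme"
    and \<pi> :: "('g, 'n) monoid_scheme"
    and H :: "'g \<Rightarrow> ('k, 'h) module"
    and \<Delta>H :: "'g \<Rightarrow> 'g \<Rightarrow> 'h \<Rightarrow> ('h \<times> 'h \<Rightarrow> 'k) set"
    and \<epsilon>H :: "'h \<Rightarrow> 'k"
    and S :: "'g \<Rightarrow> 'h \<Rightarrow> 'h"
    and C :: "'g \<Rightarrow> ('k, 'c) module"
    and \<Delta>C :: "'g \<Rightarrow> 'g \<Rightarrow> 'c \<Rightarrow> ('c \<times> 'c \<Rightarrow> 'k) set"
    and \<epsilon>C :: "'c \<Rightarrow> 'k"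
    and \<omega> :: "'g \<Rightarrow> ('h \<times> 'c \<Rightarrow> 'k) set \<Rightarrow> 'c"
    and \<sigma> :: "'g \<Rightarrow> 'h \<Rightarrow> 'c"
    and V :: "'g \<Rightarrow> ('k, 'v) module"
    and \<rho> :: "'g \<Rightarrow> 'g \<Rightarrow> 'v \<Rightarrow> ('v \<times> 'c \<Rightarrow> 'k) set"
  defines "I \<equiv> Ind K \<pi> H \<Delta>H C \<sigma> V \<rho>"
    and "D \<equiv> (\<lambda>\<alpha> \<beta>. tensor_map K (V \<one>\<^bsub>\<pi>\<^esub>) (tensor K (H \<alpha>) (H \<beta>)) id (\<Delta>H \<alpha> \<beta>))"
    and "j \<equiv> (\<lambda>\<alpha> \<beta>. subtensor_embed K (V \<one>\<^bsub>\<pi>\<^esub>) (H \<alpha>) (H \<beta>))"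
  assumes "hopf_pi_coalgebra K \<pi> H \<Delta>H \<epsilon>H S"
    and "left_coisotropic_subgroup K \<pi> H \<Delta>H \<epsilon>H S C \<Delta>C \<epsilon>C \<omega> \<sigma>"
    and "right_pi_comodule K \<pi> C \<Delta>C \<epsilon>C V \<rho>"
  shows "(\<forall>\<alpha>\<in>carrier \<pi>. \<forall>\<beta>\<in>carrier \<pi>.
            inj_on (j \<alpha> \<beta>) (carrier (tensor K (I \<alpha>) (H \<beta>))) \<and>
            D \<alpha> \<beta> ` carrier (I (\<alpha> \<otimes>\<^bsub>\<pi>\<^esub> \<beta>)) \<subseteq> j \<alpha> \<beta> ` carrier (tensor K (I \<alpha>) (H \<beta>))) \<and>
         right_pi_comodule K \<pi> H \<Delta>H \<epsilon>H I
           (\<lambda>\<alpha> \<beta> x. the_inv_into (carrier (tensor K (I \<alpha>) (H \<beta>))) (j \<alpha> \<beta>) (D \<alpha> \<beta> x))"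
proof -
  interpret coisotropic_comodule K \<pi> H \<Delta>H \<epsilon>H S C \<Delta>C \<epsilon>C \<omega> \<sigma> V \<rho>
    using assms(5,6) by (rule coisotropic_comodule.intro)
  show ?thesis
    unfolding I_def D_def j_def
    using j_inj D_in_image Ind_comodule by blast
qed

end
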